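(* Let $(M,\tau)$ be a von Neumann algebra with a normal faithful trace-state, let $Y_j=Y_j^*\in M$, $1\le j\le n$, be such that $\{Y_1,\dots,Y_n\}$ generates $M$, and let $R>0$ satisfy $R\ge\|Y_j\|$, $1\le j\le n$. Assume that the evaluation map $$\varepsilon_{(Y_1,\dots,Y_n)}:\mathbb{C}_{\langle n\rangle,>R}\to M$$ is one-to-one. If $K=K^*\in\mathrm{Vect}\,\varepsilon_{(Y_1,\dots,Y_n)}\mathbb{C}_{\langle n\rangle,>R}$ is trace-preserving, then the derivation $D_K^{\varepsilon}$ exponentiates to a one-parameter group of automorphisms of $M$.
   Context: $\mathbb{C}_{\langle n\rangle}=\mathbb{C}\langle X_1,\dots,X_n\rangle$ is the ring of noncommutative polynomials. For $R'>0$, $\mathbb{C}_{\langle n\rangle,R',0}$ is the algebra of noncommutative formal power series $\sum_p\sum_{j_1,\dots,j_p}c_{j_1,\dots,j_p}X_{j_1}\cdots X_{j_p}$ with $\sum|c_{j_1,\dots,j_p}|R'^p<\infty$, and $\mathbb{C}_{\langle n\rangle,>R}=\bigcup_{R'>R}\mathbb{C}_{\langle n\rangle,R',0}$. $\varepsilon_{(Y_1,\dots,Y_n)}$ denotes evaluation at $(Y_1,\dots,Y_n)$ (norm convergent since $\|Y_j\|\le R$). $\mathrm{Vect}\,\mathcal{E}=\mathcal{E}^n$, and $K^*=(K_1^*,\dots,K_n^* )$. "Generates" is as a von Neumann algebra. The partial cyclic derivatives $\delta_j:\mathbb{C}_{\langle n\rangle}\to\mathbb{C}_{\langle n\rangle}$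 are the linear maps with $\delta_j1=0$ and $\delta_jX_{i_1}\cdots X_{i_p}=\sum_{k:\,i_k=j}X_{i_{k+1}}\cdots X_{i_p}X_{i_1}\cdots X_{i_{k-1}}$. $K$ is trace-preserving if $\sum_j\tau((\delta_jP)(Y_1,\dots,Y_n)K_j)=0$ for all $P\in\mathbb{C}_{\langle n\rangle}$. If $K_j=\varepsilon_{(Y_1,\dots,Y_n)}\widetilde K_j$ with $\widetilde K_j\in\mathbb{C}_{\langle n\rangle,>R}$, let $D_{\widetilde K}$ be the derivation of $\mathbb{C}_{\langle n\rangle,>R}$ given by $D_{\widetilde K}(\sum c_{j_1,\dots,j_p}X_{j_1}\cdots X_{j_p})=\sum c_{j_1,\dots,j_p}\sum_{k}X_{j_1}\cdots X_{j_{k-1}}\widetilde K_{j_k}X_{j_{k+1}}\cdots X_{j_p}$, and let $D_K^{\varepsilon}=\varepsilon_{(Y_1,\dots,Y_n)}\circ D_{\widetilde K}\circ\varepsilon_{(Y_1,\dots,Y_n)}^{-1}$, viewed as a densely defined operator in $L^2(M,\tau)$ with domain $\varepsilon_{(Y_1,\dots,Y_n)}\mathbb{C}_{\langle n\rangle,>R}$. $M$ acts on $L^2(M,\tau)$ by left multiplication. "$D_K^{\varepsilon}$ exponentiates to a one-parameter group of automorphisms of $M$" means: the closure $\overline{H}$ of $H=-iD_K^{\varepsilon}$ is selfadjoint in $L^2(M,\tau)$ and $x\mapsto e^{it\overline{H}}\,x\,e^{-it\overline{H}}$, $t\in\mathbb{R}$, defines a one-parameter group of automorphisms of $M$. *)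

theory Defs
  imports "HOL-Analysis.Analysis"
begin

section \<open>Complex Hilbert spaces and their bounded operators\<close>

text \<open>
  The real inner product of the library is the real part of the complex one, which is linear in
  its first argument. Positivity and the norm are inherited from the real structure.
\<close>

class chilbert_space = real_inner + complete_space +
  fixes scaleC :: "complex \<Rightarrow> 'a \<Rightarrow> 'a" (infixr "*\<^sub>C" 75)
    and cinner :: "'a \<Rightarrow> 'a \<Rightarrow> complex"
  assumes scaleC_add_right: "a *\<^sub>C (x + y) = a *\<^sub>C x + a *\<^sub>C y"
    and scaleC_add_left: "(a + b) *\<^sub>C x = a *\<^sub>C x + b *\<^sub>C x"
    and scaleC_scaleC: "a *\<^sub>C b *\<^sub>C x = (a * b) *\<^sub>C x"
    and scaleR_eq_scaleC: "r *\<^sub>R x = complex_of_real r *\<^sub>C x"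
    and cinner_commute: "cinner x y = cnj (cinner y x)"
    and cinner_add_left: "cinner (x + y) z = cinner x z + cinner y z"
    and cinner_scaleC_left: "cinner (a *\<^sub>C x) y = a * cinner x y"
    and inner_eq_Re_cinner: "inner x y = Re (cinner x y)"
begin
subclass banach ..
end

instantiation complex :: chilbert_space
begin
definition scaleC_complex :: "complex \<Rightarrow> complex \<Rightarrow> complex" where
  "scaleC_complex a x = a * x"
definition cinner_complex :: "complex \<Rightarrow> complex \<Rightarrow> complex" where
  "cinner_complex x y = x * cnj y"
instance
  by standard (auto simp: scaleC_complex_def cinner_complex_def algebra_simps scaleR_conv_of_real
      inner_complex_def)
end

text \<open>
  Elements of the type \<open>'a \<Rightarrow>\<^sub>L 'a\<close> are only real-linear; the bounded operators of the complex
  Hilbert space are those in \<open>bops\<close>.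
\<close>

definition bops :: "('a::chilbert_space \<Rightarrow>\<^sub>L 'a) set" where
  "bops = {T. \<forall>c x. blinfun_apply T (c *\<^sub>C x) = c *\<^sub>C blinfun_apply T x}"

definition op_scale :: "complex \<Rightarrow> ('a::chilbert_space \<Rightarrow>\<^sub>L 'a) \<Rightarrow> ('a \<Rightarrow>\<^sub>L 'a)" where
  "op_scale c T = Blinfun (\<lambda>x. c *\<^sub>C blinfun_apply T x)"

definition adj :: "('a::chilbert_space \<Rightarrow>\<^sub>L 'a) \<Rightarrow> ('a \<Rightarrow>\<^sub>L 'a)" where
  "adj T = (THE S. \<forall>x y. cinner (blinfun_apply T x) y = cinner x (blinfun_apply S y))"


section \<open>Von Neumann algebras with a normal faithful trace-state\<close>

definition commutant :: "('a::chilbert_space \<Rightarrow>\<^sub>L 'a) set \<Rightarrow> ('a \<Rightarrow>\<^sub>L 'a) set" where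
  "commutant S = {T \<in> bops. \<forall>A\<in>S. T o\<^sub>L A = A o\<^sub>L T}"

definition von_neumann_algebra :: "('a::chilbert_space \<Rightarrow>\<^sub>L 'a) set \<Rightarrow> bool" where
  "von_neumann_algebra M \<longleftrightarrow>
     M \<subseteq> bops \<and> (\<forall>x\<in>M. adj x \<in> M) \<and> commutant (commutant M) = M"

definition vN_generated :: "('a::chilbert_space \<Rightarrow>\<^sub>L 'a) set \<Rightarrow> ('a \<Rightarrow>\<^sub>L 'a) set" where
  "vN_generated S = \<Inter>{N. von_neumann_algebra N \<and> S \<subseteq> N}"

definition square_summable :: "(nat \<Rightarrow> 'a::chilbert_space) \<Rightarrow> bool" where
  "square_summable \<xi> \<longleftrightarrow> summable (\<lambda>k. (norm (\<xi> k))\<^sup>2)"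

definition ultraweak_topology :: "('a::chilbert_space \<Rightarrow>\<^sub>L 'a) topology" where
  "ultraweak_topology = topology_generated_by
     {{T. (\<Sum>k. cinner (blinfun_apply T (\<xi> k)) (\<eta> k)) \<in> V} | \<xi> \<eta> V.
        square_summable \<xi> \<and> square_summable \<eta> \<and> open V}"

text \<open>The values of \<open>\<tau>\<close> outside \<open>M\<close> are irrelevant. Normality is ultraweak continuity.\<close>

definition normal_faithful_trace_state ::
    "('a::chilbert_space \<Rightarrow>\<^sub>L 'a) set \<Rightarrow> (('a \<Rightarrow>\<^sub>L 'a) \<Rightarrow> complex) \<Rightarrow> bool" where
  "normal_faithful_trace_state M \<tau> \<longleftrightarrow>
     (\<forall>x\<in>M. \<forall>y\<in>M. \<tau> (x + y) = \<tau> x + \<tau> y) \<and>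
     (\<forall>c. \<forall>x\<in>M. \<tau> (op_scale c x) = c * \<tau> x) \<and>
     (\<forall>x\<in>M. \<tau> (adj x o\<^sub>L x) \<in> \<real>\<^sub>\<ge>\<^sub>0) \<and>
     \<tau> id_blinfun = 1 \<and>
     (\<forall>x\<in>M. \<forall>y\<in>M. \<tau> (x o\<^sub>L y) = \<tau> (y o\<^sub>L x)) \<and>
     (\<forall>x\<in>M. \<tau> (adj x o\<^sub>L x) = 0 \<longrightarrow> x = 0) \<and>
     continuous_map (subtopology ultraweak_topology M) euclidean \<tau>"

text \<open>
  \<open>L\<^sup>2(M, \<tau>)\<close> is the completion of \<open>M\<close> for the inner product \<open>\<tau>(y\<^sup>* x)\<close>. It is given here by a
  Hilbert space \<open>'b\<close> with an isometric linear map \<open>\<Lambda>\<close> of \<open>M\<close> onto a dense subspace, which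
  determines it up to a unique unitary equivalence.
\<close>

definition is_L2_space :: "('a::chilbert_space \<Rightarrow>\<^sub>L 'a) set \<Rightarrow> (('a \<Rightarrow>\<^sub>L 'a) \<Rightarrow> complex)
    \<Rightarrow> (('a \<Rightarrow>\<^sub>L 'a) \<Rightarrow> 'b::chilbert_space) \<Rightarrow> bool" where
  "is_L2_space M \<tau> \<Lambda> \<longleftrightarrow>
     (\<forall>x\<in>M. \<forall>y\<in>M. \<Lambda> (x + y) = \<Lambda> x + \<Lambda> y) \<and>
     (\<forall>c. \<forall>x\<in>M. \<Lambda> (op_scale c x) = c *\<^sub>C \<Lambda> x) \<and>
     (\<forall>x\<in>M. \<forall>y\<in>M. cinner (\<Lambda> x) (\<Lambda> y) = \<tau> (adj y o\<^sub>L x)) \<and>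
     closure (\<Lambda> ` M) = UNIV"

definition left_mult :: "('a::chilbert_space \<Rightarrow>\<^sub>L 'a) set \<Rightarrow> (('a \<Rightarrow>\<^sub>L 'a) \<Rightarrow> 'b::chilbert_space)
    \<Rightarrow> ('a \<Rightarrow>\<^sub>L 'a) \<Rightarrow> ('b \<Rightarrow>\<^sub>L 'b)" where
  "left_mult M \<Lambda> x = (THE T. T \<in> bops \<and> (\<forall>y\<in>M. blinfun_apply T (\<Lambda> y) = \<Lambda> (x o\<^sub>L y)))"


section \<open>Unbounded operators and one-parameter groups\<close>

text \<open>An unbounded operator is represented by its graph.\<close>

definition op_graph :: "('b::chilbert_space \<times> 'b) set \<Rightarrow> bool" where
  "op_graph G \<longleftrightarrow> single_valued G \<and> (0, 0) \<in> G \<and>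
     (\<forall>x y x' y'. (x, y) \<in> G \<longrightarrow> (x', y') \<in> G \<longrightarrow> (x + x', y + y') \<in> G) \<and>
     (\<forall>c x y. (x, y) \<in> G \<longrightarrow> (c *\<^sub>C x, c *\<^sub>C y) \<in> G)"

definition adjoint_graph :: "('b::chilbert_space \<times> 'b) set \<Rightarrow> ('b \<times> 'b) set" where
  "adjoint_graph G = {(u, v). \<forall>(x, y)\<in>G. cinner y u = cinner x v}"

definition selfadjoint :: "('b::chilbert_space \<times> 'b) set \<Rightarrow> bool" where
  "selfadjoint G \<longleftrightarrow> op_graph G \<and> closure (Domain G) = UNIV \<and> adjoint_graph G = G"

text \<open>
  \<open>is_unitary_exp A U\<close> says that \<open>U t\<close> is the exponential of \<open>i t A\<close>: \<open>U\<close> is the strongly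
  continuous unitary group with infinitesimal generator \<open>i A\<close>, domains included. By Stone's
  theorem there is exactly one such \<open>U\<close> for each selfadjoint \<open>A\<close>.
\<close>

definition is_unitary_exp :: "('b::chilbert_space \<times> 'b) set \<Rightarrow> (real \<Rightarrow> ('b \<Rightarrow>\<^sub>L 'b)) \<Rightarrow> bool" where
  "is_unitary_exp A U \<longleftrightarrow>
     (\<forall>t. U t \<in> bops \<and> adj (U t) o\<^sub>L U t = id_blinfun \<and> U t o\<^sub>L adj (U t) = id_blinfun) \<and>
     U 0 = id_blinfun \<and> (\<forall>s t. U (s + t) = U s o\<^sub>L U t) \<and>
     (\<forall>x. continuous_on UNIV (\<lambda>t. blinfun_apply (U t) x)) \<and>
     (\<forall>x y. (x, y) \<in> A \<longleftrightarrow>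
        ((\<lambda>t. (blinfun_apply (U t) x - x) /\<^sub>R t) \<longlongrightarrow> \<i> *\<^sub>C y) (at 0))"

definition star_automorphism ::
    "('b::chilbert_space \<Rightarrow>\<^sub>L 'b) set \<Rightarrow> (('b \<Rightarrow>\<^sub>L 'b) \<Rightarrow> ('b \<Rightarrow>\<^sub>L 'b)) \<Rightarrow> bool" where
  "star_automorphism N \<alpha> \<longleftrightarrow> bij_betw \<alpha> N N \<and>
     (\<forall>x\<in>N. \<forall>y\<in>N. \<alpha> (x + y) = \<alpha> x + \<alpha> y \<and> \<alpha> (x o\<^sub>L y) = \<alpha> x o\<^sub>L \<alpha> y) \<and>
     (\<forall>c. \<forall>x\<in>N. \<alpha> (op_scale c x) = op_scale c (\<alpha> x)) \<and>
     (\<forall>x\<in>N. \<alpha> (adj x) = adj (\<alpha> x))"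

definition one_parameter_automorphism_group ::
    "('b::chilbert_space \<Rightarrow>\<^sub>L 'b) set \<Rightarrow> (real \<Rightarrow> ('b \<Rightarrow>\<^sub>L 'b) \<Rightarrow> ('b \<Rightarrow>\<^sub>L 'b)) \<Rightarrow> bool" where
  "one_parameter_automorphism_group N \<alpha> \<longleftrightarrow>
     (\<forall>t. star_automorphism N (\<alpha> t)) \<and>
     (\<forall>x\<in>N. \<alpha> 0 x = x) \<and>
     (\<forall>s t. \<forall>x\<in>N. \<alpha> (s + t) x = \<alpha> s (\<alpha> t x)) \<and>
     (\<forall>x\<in>N. \<forall>v. continuous_on UNIV (\<lambda>t. blinfun_apply (\<alpha> t x) v))"

text \<open>
  For an operator \<open>D\<close> in \<open>L\<^sup>2(M, \<tau>)\<close> with graph \<open>D\<close>. As an algebra of operators on \<open>L\<^sup>2(M, \<tau>)\<close>,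
  \<open>M\<close> is \<open>left_mult M \<Lambda> ` M\<close>.
\<close>

definition exponentiates_to_automorphisms ::
    "('a::chilbert_space \<Rightarrow>\<^sub>L 'a) set \<Rightarrow> (('a \<Rightarrow>\<^sub>L 'a) \<Rightarrow> 'b::chilbert_space) \<Rightarrow> ('b \<times> 'b) set \<Rightarrow> bool"
  where
  "exponentiates_to_automorphisms M \<Lambda> D \<longleftrightarrow>
     (let H = {(x, (- \<i>) *\<^sub>C y) | x y. (x, y) \<in> D} in
        selfadjoint (closure H) \<and>
        (\<exists>U. is_unitary_exp (closure H) U \<and>
           one_parameter_automorphism_group (left_mult M \<Lambda> ` M)
             (\<lambda>t x. U t o\<^sub>L x o\<^sub>L U (- t))))"


section \<open>Noncommutative polynomials and power series\<close>

text \<open>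
  The variables are indexed by a finite type \<open>'n\<close>. A monomial is a word, and a formal power series
  is its family of coefficients.
\<close>

type_synonym 'n ncseries = "'n list \<Rightarrow> complex"

definition nc_monom :: "'n list \<Rightarrow> 'n ncseries" where
  "nc_monom w = (\<lambda>v. if v = w then 1 else 0)"

definition nc_mult :: "'n ncseries \<Rightarrow> 'n ncseries \<Rightarrow> 'n ncseries" where
  "nc_mult f g = (\<lambda>v. \<Sum>i\<le>length v. f (take i v) * g (drop i v))"

definition nc_polys :: "'n ncseries set" where
  "nc_polys = {P. finite {w. P w \<noteq> 0}}"

definition nc_conv :: "real \<Rightarrow> 'n ncseries set" where
  "nc_conv R' = {c. (\<lambda>w. cmod (c w) * R' ^ length w) summable_on UNIV}"

definition nc_conv_gt :: "real \<Rightarrow> 'n ncseries set" where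
  "nc_conv_gt R = (\<Union>R'\<in>{R<..}. nc_conv R')"

definition cyclic_deriv_word :: "'n \<Rightarrow> 'n list \<Rightarrow> 'n ncseries" where
  "cyclic_deriv_word j w =
     (\<lambda>v. \<Sum>k | k < length w \<and> w ! k = j. nc_monom (drop (Suc k) w @ take k w) v)"

definition cyclic_deriv :: "'n \<Rightarrow> 'n ncseries \<Rightarrow> 'n ncseries" where
  "cyclic_deriv j P = (\<lambda>v. \<Sum>w | P w \<noteq> 0. P w * cyclic_deriv_word j w v)"

definition nc_derivation_word :: "('n \<Rightarrow> 'n ncseries) \<Rightarrow> 'n list \<Rightarrow> 'n ncseries" where
  "nc_derivation_word K w =
     (\<lambda>v. \<Sum>k<length w.
        nc_mult (nc_mult (nc_monom (take k w)) (K (w ! k))) (nc_monom (drop (Suc k) w)) v)"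

text \<open>
  For each word \<open>v\<close> and finite \<open>'n\<close> only finitely many terms of the sum are nonzero, since \<open>v\<close>
  contributes only to words \<open>w\<close> with \<open>length w \<le> length v + 1\<close>.
\<close>

definition nc_derivation :: "('n \<Rightarrow> 'n ncseries) \<Rightarrow> 'n ncseries \<Rightarrow> 'n ncseries" where
  "nc_derivation K c = (\<lambda>v. \<Sum>\<^sub>\<infinity>w. c w * nc_derivation_word K w v)"

definition word_op :: "('n \<Rightarrow> ('a::chilbert_space \<Rightarrow>\<^sub>L 'a)) \<Rightarrow> 'n list \<Rightarrow> ('a \<Rightarrow>\<^sub>L 'a)" where
  "word_op Y w = foldr (\<lambda>j T. Y j o\<^sub>L T) w id_blinfun"

definition nc_eval :: "('n \<Rightarrow> ('a::chilbert_space \<Rightarrow>\<^sub>L 'a)) \<Rightarrow> 'n ncseries \<Rightarrow> ('a \<Rightarrow>\<^sub>L 'a)" where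
  "nc_eval Y c = (\<Sum>\<^sub>\<infinity>w. op_scale (c w) (word_op Y w))"

definition trace_preserving :: "(('a::chilbert_space \<Rightarrow>\<^sub>L 'a) \<Rightarrow> complex)
    \<Rightarrow> ('n::finite \<Rightarrow> ('a \<Rightarrow>\<^sub>L 'a)) \<Rightarrow> ('n \<Rightarrow> ('a \<Rightarrow>\<^sub>L 'a)) \<Rightarrow> bool" where
  "trace_preserving \<tau> Y K \<longleftrightarrow>
     (\<forall>P\<in>nc_polys. (\<Sum>j\<in>UNIV. \<tau> (nc_eval Y (cyclic_deriv j P) o\<^sub>L K j)) = 0)"

definition nc_eval_inv :: "real \<Rightarrow> ('n \<Rightarrow> ('a::chilbert_space \<Rightarrow>\<^sub>L 'a)) \<Rightarrow> ('a \<Rightarrow>\<^sub>L 'a) \<Rightarrow> 'n ncseries" where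
  "nc_eval_inv R Y = the_inv_into (nc_conv_gt R) (nc_eval Y)"

definition D_eps :: "real \<Rightarrow> ('n \<Rightarrow> ('a::chilbert_space \<Rightarrow>\<^sub>L 'a)) \<Rightarrow> ('n \<Rightarrow> ('a \<Rightarrow>\<^sub>L 'a))
    \<Rightarrow> ('a \<Rightarrow>\<^sub>L 'a) \<Rightarrow> ('a \<Rightarrow>\<^sub>L 'a)" where
  "D_eps R Y K = nc_eval Y \<circ> nc_derivation (\<lambda>j. nc_eval_inv R Y (K j)) \<circ> nc_eval_inv R Y"

definition D_eps_graph :: "real \<Rightarrow> ('n \<Rightarrow> ('a::chilbert_space \<Rightarrow>\<^sub>L 'a)) \<Rightarrow> ('n \<Rightarrow> ('a \<Rightarrow>\<^sub>L 'a))
    \<Rightarrow> (('a \<Rightarrow>\<^sub>L 'a) \<Rightarrow> 'b::chilbert_space) \<Rightarrow> ('b \<times> 'b) set" where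
  "D_eps_graph R Y K \<Lambda> = (\<lambda>a. (\<Lambda> a, \<Lambda> (D_eps R Y K a))) ` (nc_eval Y ` nc_conv_gt R)"

end

theory Submission imports Defs begin

text \<open>
  Put \<open>D = D\<^sub>K\<close> and let \<open>R1 > R\<close> be such that all \<open>K\<^sub>j\<close> converge on radius \<open>R1\<close>. Shrinking the
  radius of convergence from \<open>\<rho>'\<close> to \<open>\<rho>\<close> costs \<open>D\<close> a factor \<open>B / (\<rho>' - \<rho>)\<close>, so the iterates \<open>D\<^sup>n\<close>
  grow on words like \<open>n!\<close> times a geometric factor that is the same for all words. Since \<open>K\<close> is
  selfadjoint and trace-preserving, \<open>D\<close> is skew-symmetric in \<open>L\<^sup>2\<close>, hence the exponential series
  \<open>\<Sum> t\<^sup>n D\<^sup>n / n!\<close> defines isometries of \<open>L\<^sup>2\<close> for small \<open>t\<close>, which extend to a unitary group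
  \<open>U\<close>. If \<open>u\<close> is orthogonal to the range of \<open>D - 1\<close> or of \<open>D + 1\<close>, then
  \<open>\<langle>U t x, u\<rangle>\<close> is \<open>exp t\<close> or \<open>exp (- t)\<close> times \<open>\<langle>x, u\<rangle>\<close> for all \<open>x\<close> in a dense subspace and all \<open>t\<close>
  below a bound that does not depend on \<open>x\<close>; as \<open>U t\<close> is isometric, \<open>u = 0\<close>, which gives
  selfadjointness. By the Leibniz rule \<open>U t Y\<^sub>j = Z\<^sub>j(t) U t\<close> with \<open>Z\<^sub>j(t)\<close> a norm
  convergent series in \<open>M\<close>; therefore \<open>U t M U (- t)\<close> lies in the bicommutant of \<open>M\<close> on \<open>L\<^sup>2\<close>. That
  this bicommutant is \<open>M\<close> itself, and that the algebra of the \<open>Y\<^sub>j\<close> is dense in \<open>L\<^sup>2\<close>, follow from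
  normality of the trace, which produces enough intertwiners between the action of \<open>M\<close> on \<open>L\<^sup>2\<close>
  and its given action.
\<close>

section \<open>Complex Hilbert spaces\<close>

text \<open>\<open>D c\<close> need not converge on the radius of \<open>c\<close>, so
  \<open>n\<close> applications must share the gap \<open>R1 - R\<close> in equal steps. Only this
  gap and the bound \<open>B\<close> on \<open>K\<close> enter the resulting growth rate, hence one
  time bound \<open>r0\<close> serves all words. The second obstacle is that \<open>L2\<close> is
  known only through \<open>\<Lambda>\<close>: even the boundedness of left multiplication has to be
  derived. There, and again for the bicommutant, a symmetric operator whose powers obey a crude
  bound \<open>C * r ^ m\<close> is shown to obey the sharp bound \<open>r\<close> by repeated
  Cauchy-Schwarz; this takes the place of square roots of positive operators. Commutation relations
  pass between the two spaces by sandwiching an operator between an intertwiner and the adjoint of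
  another one.\<close>

lemma cinner_add_right: "cinner x (y + z) = cinner x y + cinner x z"
  by (metis cinner_add_left cinner_commute complex_cnj_add)

lemma cinner_scaleC_right: "cinner x (a *\<^sub>C y) = cnj a * cinner x y"
  by (metis cinner_commute cinner_scaleC_left complex_cnj_mult)

lemma scaleC_one [simp]: "1 *\<^sub>C (x::'a::chilbert_space) = x"
  using scaleR_eq_scaleC[of 1 x] by simp

lemma scaleC_zero_left [simp]: "0 *\<^sub>C (x::'a::chilbert_space) = 0"
  using scaleR_eq_scaleC[of 0 x] by simp

lemma scaleC_zero_right [simp]: "c *\<^sub>C (0::'a::chilbert_space) = 0"
  using scaleC_add_right[of c 0 "0::'a"] by simp

lemma scaleC_minus_right: "c *\<^sub>C (- x) = - (c *\<^sub>C (x::'a::chilbert_space))"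
  using scaleC_add_right[of c x "-x"] by (simp add: eq_neg_iff_add_eq_0 add.commute)

lemma scaleC_minus_left: "(- c) *\<^sub>C x = - (c *\<^sub>C (x::'a::chilbert_space))"
  using scaleC_add_left[of c "-c" x] by (simp add: eq_neg_iff_add_eq_0 add.commute)

lemma scaleC_diff_right: "c *\<^sub>C (x - y) = c *\<^sub>C x - c *\<^sub>C (y::'a::chilbert_space)"
  using scaleC_add_right[of c x "-y"] by (simp add: scaleC_minus_right)

lemma scaleC_scaleR: "c *\<^sub>C (r *\<^sub>R x) = r *\<^sub>R (c *\<^sub>C (x::'a::chilbert_space))"
  by (simp add: scaleR_eq_scaleC scaleC_scaleC mult.commute)

lemma cinner_zero_left [simp]: "cinner 0 x = 0"
  using cinner_scaleC_left[of 0 0 x] by simp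

lemma cinner_zero_right [simp]: "cinner x 0 = 0"
  using cinner_scaleC_right[of x 0 0] by simp

lemma cinner_minus_left: "cinner (- x) y = - cinner x y"
  using cinner_scaleC_left[of "-1" x y] by (simp add: scaleC_minus_left)

lemma cinner_minus_right: "cinner x (- y) = - cinner x y"
  using cinner_scaleC_right[of x "-1" y] by (simp add: scaleC_minus_left)

lemma cinner_diff_left: "cinner (x - y) z = cinner x z - cinner y z"
  using cinner_add_left[of x "-y" z] by (simp add: cinner_minus_left)

lemma cinner_diff_right: "cinner x (y - z) = cinner x y - cinner x z"
  using cinner_add_right[of x y "-z"] by (simp add: cinner_minus_right)

lemma cinner_scaleR_left: "cinner (r *\<^sub>R x) y = complex_of_real r * cinner x y"
  by (simp add: scaleR_eq_scaleC cinner_scaleC_left)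

lemma cinner_scaleR_right: "cinner x (r *\<^sub>R y) = complex_of_real r * cinner x y"
  by (simp add: scaleR_eq_scaleC cinner_scaleC_right)

lemma cinner_self: "cinner x x = complex_of_real ((norm x)\<^sup>2)"
proof -
  have "Im (cinner x x) = 0"
    using arg_cong[OF cinner_commute[of x x], of Im] by simp
  moreover have "Re (cinner x x) = (norm x)\<^sup>2"
    by (metis inner_eq_Re_cinner power2_norm_eq_inner)
  ultimately show ?thesis by (simp add: complex_eq_iff)
qed

text \<open>Facts about the real inner product (projections, adjoints, polarization) become complex
  ones through this formula, complex-linearity supplying the second component.\<close>

lemma cinner_eq_Complex: "cinner x y = Complex (inner x y) (inner x (\<i> *\<^sub>C y))"
  by (simp add: inner_eq_Re_cinner cinner_scaleC_right complex_eq_iff)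

lemma norm_scaleC [simp]: "norm (c *\<^sub>C x) = cmod c * norm (x::'a::chilbert_space)"
proof -
  have "complex_of_real ((norm (c *\<^sub>C x))\<^sup>2) = complex_of_real ((cmod c * norm x)\<^sup>2)"
    unfolding cinner_self[symmetric] cinner_scaleC_left cinner_scaleC_right
    by (simp add: cinner_self power_mult_distrib mult.assoc[symmetric] complex_norm_square[unfolded of_real_power] mult.commute)
  then show ?thesis by (metis of_real_eq_iff power2_eq_iff_nonneg norm_ge_zero mult_nonneg_nonneg)
qed

text \<open>The unimodular factor \<open>c\<close> rotates \<open>cinner x y\<close> onto the
  positive real axis, where the real Cauchy-Schwarz inequality applies.\<close>

lemma norm_cinner_le: "cmod (cinner x y) \<le> norm x * norm y"
proof (cases "cinner x y = 0")
  case False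
  define c where "c = cnj (cinner x y) / cmod (cinner x y)"
  have "cmod c = 1" using False by (simp add: c_def norm_divide)
  have "c * cinner x y = complex_of_real (cmod (cinner x y))"
    using False by (simp add: c_def complex_norm_square[symmetric] power2_eq_square mult.commute)
  then have "cmod (cinner x y) = inner (c *\<^sub>C x) y"
    by (simp add: inner_eq_Re_cinner cinner_scaleC_left)
  also have "\<dots> \<le> norm (c *\<^sub>C x) * norm y" by (rule norm_cauchy_schwarz)
  finally show ?thesis using \<open>cmod c = 1\<close> by simp
qed simp

lemma bounded_linear_scaleC: "bounded_linear (\<lambda>x::'a::chilbert_space. c *\<^sub>C x)"
  by (rule bounded_linear_intro[where K="cmod c"])
    (auto simp: scaleC_add_right scaleC_scaleR mult.commute)

lemma bounded_bilinear_cinner: "bounded_bilinear (cinner :: 'a::chilbert_space \<Rightarrow> 'a \<Rightarrow> complex)"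
  by (rule bounded_bilinear.intro)
    (auto simp: cinner_add_left cinner_add_right cinner_scaleR_left cinner_scaleR_right
      scaleR_conv_of_real norm_cinner_le intro!: exI[of _ 1])

lemmas bounded_linear_cinner_left = bounded_bilinear.bounded_linear_left[OF bounded_bilinear_cinner]
lemmas bounded_linear_cinner_right = bounded_bilinear.bounded_linear_right[OF bounded_bilinear_cinner]
lemma cinner_self_eq_0: "cinner x x = 0 \<longleftrightarrow> x = (0::'a::chilbert_space)"
  by (simp add: cinner_self)

lemma cinner_eqI:
  assumes "\<And>z. cinner x z = cinner y z" shows "x = y"
proof -
  have "cinner (x - y) (x - y) = 0" by (simp add: cinner_diff_left assms)
  then show ?thesis by (simp add: cinner_self_eq_0)
qed

lemma cinner_eqI_right:
  assumes "\<And>z. cinner z x = cinner z y" shows "x = y"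
  by (rule cinner_eqI) (metis assms cinner_commute)

section \<open>Complex-linear subspaces, projections and bounded extensions\<close>

definition csubspace :: "'a::chilbert_space set \<Rightarrow> bool" where
  "csubspace X \<longleftrightarrow> 0 \<in> X \<and> (\<forall>x\<in>X. \<forall>y\<in>X. x + y \<in> X) \<and> (\<forall>c. \<forall>x\<in>X. c *\<^sub>C x \<in> X)"

lemma csubspaceD:
  assumes "csubspace X"
  shows "0 \<in> X" "x \<in> X \<Longrightarrow> y \<in> X \<Longrightarrow> x + y \<in> X" "x \<in> X \<Longrightarrow> c *\<^sub>C x \<in> X"
  using assms by (auto simp: csubspace_def)

lemma csubspace_imp_subspace: "csubspace X \<Longrightarrow> subspace X"
  unfolding subspace_def by (auto simp: csubspace_def scaleR_eq_scaleC)

lemma csubspace_diff: "csubspace X \<Longrightarrow> x \<in> X \<Longrightarrow> y \<in> X \<Longrightarrow> x - y \<in> X"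
  using csubspace_imp_subspace subspace_diff by blast

lemma csubspace_closure:
  assumes "csubspace X" shows "csubspace (closure X)"
  unfolding csubspace_def
proof (intro conjI ballI allI)
  show "0 \<in> closure X" using assms closure_subset by (auto simp: csubspace_def)
  fix x assume "x \<in> closure X"
  then obtain f where f: "\<And>n. f n \<in> X" "f \<longlonglongrightarrow> x" by (auto simp: closure_sequential)
  { fix y assume "y \<in> closure X"
    then obtain g where g: "\<And>n. g n \<in> X" "g \<longlonglongrightarrow> y" by (auto simp: closure_sequential)
    show "x + y \<in> closure X"
      unfolding closure_sequential using tendsto_add[OF f(2) g(2)] f(1) g(1) assms
      by (intro exI[of _ "\<lambda>n. f n + g n"]) (auto simp: csubspace_def) }
  fix c
  show "c *\<^sub>C x \<in> closure X"
    unfolding closure_sequential using bounded_linear.tendsto[OF bounded_linear_scaleC f(2)] f(1) assms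
    by (intro exI[of _ "\<lambda>n. c *\<^sub>C f n"]) (auto simp: csubspace_def)
qed

text \<open>A minimizing sequence is Cauchy by the parallelogram identity \<open>par\<close>, and
  its limit is the nearest point. The real form is kept because the Riesz representation below also
  rests on it.\<close>

lemma orthogonal_projection_exists:
  fixes S :: "'a::{real_inner,complete_space} set"
  assumes "subspace S" "closed S"
  shows "\<exists>p\<in>S. \<forall>y\<in>S. inner (x - p) y = 0"
proof -
  define d where "d = (INF y\<in>S. (norm (x - y))\<^sup>2)"
  have "S \<noteq> {}" using assms(1) subspace_0 by blast
  have bdd: "bdd_below ((\<lambda>y. (norm (x - y))\<^sup>2) ` S)" by (rule bdd_belowI[of _ 0]) auto
  have dle: "d \<le> (norm (x - y))\<^sup>2" if "y \<in> S" for y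
    unfolding d_def by (rule cINF_lower[OF bdd that])
  have "\<exists>y\<in>S. (norm (x - y))\<^sup>2 < d + 1 / Suc n" for n
    using cINF_less_iff[OF \<open>S \<noteq> {}\<close> bdd, of "d + 1 / Suc n"] by (simp add: d_def)
  then obtain f where fS: "f n \<in> S" and f: "(norm (x - f n))\<^sup>2 < d + 1 / Suc n" for n by metis
  have par: "(norm (u - v))\<^sup>2 = 2 * (norm (x - u))\<^sup>2 + 2 * (norm (x - v))\<^sup>2 - 4 * (norm (x - (1/2) *\<^sub>R (u + v)))\<^sup>2" for u v
    by (simp add: power2_norm_eq_inner inner_diff_left inner_diff_right inner_add_left inner_add_right inner_commute algebra_simps)
  have half: "(1/2) *\<^sub>R (u + v) \<in> S" if "u \<in> S" "v \<in> S" for u v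
    using assms(1) that by (simp add: subspace_add subspace_scale)
  have fmn: "(norm (f m - f n))\<^sup>2 \<le> 4 / Suc N" if "m \<ge> N" "n \<ge> N" for m n N
  proof -
    have "(norm (f m - f n))\<^sup>2 \<le> 2 * (d + 1 / Suc m) + 2 * (d + 1 / Suc n) - 4 * d"
    proof -
      have "a \<le> 2 * (d + p) + 2 * (d + q) - 4 * d"
        if "a = 2 * b + 2 * c - 4 * e" "b < d + p" "c < d + q" "d \<le> e" for a b c e p q :: real
        using that by (smt (verit))
      from this[OF par f f dle[OF half[OF fS fS]]] show ?thesis .
    qed
    also have "\<dots> = 2 / Suc m + 2 / Suc n" by simp
    also have "\<dots> \<le> 2 / Suc N + 2 / Suc N" using that by (intro add_mono divide_left_mono) auto
    finally show ?thesis by simp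
  qed
  have "Cauchy f"
  proof (rule metric_CauchyI)
    fix e :: real assume "e > 0"
    then obtain N :: nat where N: "4 / e\<^sup>2 < Suc N" by (metis reals_Archimedean2 less_trans of_nat_Suc lessI of_nat_less_iff)
    have "4 / Suc N < e\<^sup>2" using N \<open>e > 0\<close> by (simp add: field_simps)
    then have "dist (f m) (f n) < e" if "m \<ge> N" "n \<ge> N" for m n
      using fmn[OF that] \<open>e > 0\<close> by (metis dist_norm le_less_trans power2_less_imp_less less_imp_le)
    then show "\<exists>M. \<forall>m\<ge>M. \<forall>n\<ge>M. dist (f m) (f n) < e" by blast
  qed
  then obtain p where p: "f \<longlonglongrightarrow> p" using Cauchy_convergent convergent_def by blast
  have pS: "p \<in> S" using closed_sequentially[OF assms(2) _ p] fS by blast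
  have "(\<lambda>n. (norm (x - f n))\<^sup>2) \<longlonglongrightarrow> (norm (x - p))\<^sup>2" by (intro tendsto_intros p)
  moreover have "(\<lambda>n. d + 1 / Suc n) \<longlonglongrightarrow> d + 0" by (intro tendsto_add tendsto_const) (use LIMSEQ_inverse_real_of_nat in \<open>simp add: field_simps\<close>)
  ultimately have "(norm (x - p))\<^sup>2 \<le> d + 0"
    by (rule LIMSEQ_le) (use f less_imp_le in blast)
  then have pd: "(norm (x - p))\<^sup>2 \<le> d" by simp
  have "inner (x - p) y = 0" if y: "y \<in> S" for y
  proof (rule ccontr)
    assume ne: "inner (x - p) y \<noteq> 0"
    then have y0: "inner y y > 0" by (metis inner_eq_zero_iff inner_gt_zero_iff inner_zero_right)
    \<comment> \<open>The best step along \<open>y\<close>: it would lower the squared distance by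
      \<open>(inner (x - p) y)\<^sup>2 / inner y y\<close>, below the infimum.\<close>
    define a where "a = inner (x - p) y / inner y y"
    have "p + a *\<^sub>R y \<in> S" using assms(1) pS y by (simp add: subspace_add subspace_scale)
    then have "(norm (x - p))\<^sup>2 \<le> (norm (x - (p + a *\<^sub>R y)))\<^sup>2" using pd dle[of "p + a *\<^sub>R y"] by linarith
    also have "x - (p + a *\<^sub>R y) = (x - p) - a *\<^sub>R y" by simp
    also have "(norm ((x - p) - a *\<^sub>R y))\<^sup>2 = (norm (x - p))\<^sup>2 - 2 * a * inner (x - p) y + a\<^sup>2 * inner y y"
      by (simp only: power2_norm_eq_inner inner_diff_left[of "x - p"] inner_diff_right[of _ "x - p"] inner_scaleR_left inner_scaleR_right inner_commute[of y "x - p"])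
        (simp add: power2_eq_square algebra_simps)
    also have "\<dots> = (norm (x - p))\<^sup>2 - (inner (x - p) y)\<^sup>2 / inner y y"
      using y0 by (simp add: a_def power2_eq_square field_simps)
    finally show False using y0 ne by (simp add: divide_le_0_iff)
  qed
  then show ?thesis using pS by blast
qed

lemma riesz_representation:
  fixes g :: "'a::{real_inner,complete_space} \<Rightarrow> real"
  assumes "bounded_linear g"
  shows "\<exists>v. \<forall>x. g x = inner x v"
proof (cases "\<forall>x. g x = 0")
  case False
  then obtain x0 where x0: "g x0 \<noteq> 0" by blast
  interpret g: bounded_linear g by fact
  let ?S = "{x. g x = 0}"
  have "subspace ?S" by (auto simp: subspace_def g.add g.scaleR)
  moreover have "closed ?S" by (intro closed_Collect_eq continuous_intros g.continuous_on)
  ultimately obtain p where p: "g p = 0" "\<And>y. g y = 0 \<Longrightarrow> inner (x0 - p) y = 0"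
    using orthogonal_projection_exists[of ?S x0] by auto
  define z where "z = x0 - p"
  have gz: "g z \<noteq> 0" using x0 p by (simp add: z_def g.diff)
  then have zz: "inner z z \<noteq> 0" by (metis g.zero inner_eq_zero_iff)
  show ?thesis
  proof (intro exI allI)
    fix x
    have "g (x - (g x / g z) *\<^sub>R z) = 0" using gz by (simp add: g.diff g.scaleR)
    from p(2)[OF this] have "inner z x = (g x / g z) * inner z z"
      unfolding z_def[symmetric] by (simp add: inner_diff_right)
    then show "g x = inner x ((g z / inner z z) *\<^sub>R z)"
      using gz zz by (simp add: inner_commute)
  qed
qed (auto intro!: exI[of _ 0])

text \<open>\<open>bops\<close> speaks of one space only; the intertwiners from \<open>L2\<close> to
  the given space need complex-linearity across two spaces.\<close>

definition clinear_op :: "('a::chilbert_space \<Rightarrow>\<^sub>L 'b::chilbert_space) \<Rightarrow> bool" where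
  "clinear_op T \<longleftrightarrow> (\<forall>c x. blinfun_apply T (c *\<^sub>C x) = c *\<^sub>C blinfun_apply T x)"

lemma clinear_opD: "clinear_op T \<Longrightarrow> blinfun_apply T (c *\<^sub>C x) = c *\<^sub>C blinfun_apply T x"
  by (simp add: clinear_op_def)

lemma bops_iff: "T \<in> bops \<longleftrightarrow> clinear_op T"
  by (simp add: bops_def clinear_op_def)

lemma clinear_op_compose: "clinear_op S \<Longrightarrow> clinear_op T \<Longrightarrow> clinear_op (S o\<^sub>L T)"
  by (simp add: clinear_op_def)

lemma clinear_op_plus: "clinear_op S \<Longrightarrow> clinear_op T \<Longrightarrow> clinear_op (S + T)"
  by (simp add: clinear_op_def blinfun.add_left scaleC_add_right)

lemma clinear_op_minus: "clinear_op S \<Longrightarrow> clinear_op T \<Longrightarrow> clinear_op (S - T)"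
  by (simp add: clinear_op_def blinfun.diff_left scaleC_diff_right)

lemma clinear_op_id [simp]: "clinear_op id_blinfun"
  by (simp add: clinear_op_def)

text \<open>The real projection onto a complex subspace is automatically complex: the residual is
  orthogonal to \<open>\<i> *\<^sub>C y\<close> as well as to \<open>y\<close>, and uniqueness of
  the decomposition gives linearity.\<close>

lemma orthogonal_projection_op:
  fixes S :: "'a::chilbert_space set"
  assumes S: "csubspace S" "closed S"
  obtains P where "clinear_op P" "\<And>x. blinfun_apply P x \<in> S" "\<And>x y. y \<in> S \<Longrightarrow> cinner (x - blinfun_apply P x) y = 0"
    "\<And>y. y \<in> S \<Longrightarrow> blinfun_apply P y = y" "\<And>x. norm (blinfun_apply P x) \<le> norm x"
    "\<And>x y. cinner (blinfun_apply P x) y = cinner x (blinfun_apply P y)"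
proof -
  obtain p where pS: "p x \<in> S" and p0: "y \<in> S \<Longrightarrow> inner (x - p x) y = 0" for x y
    using orthogonal_projection_exists[OF csubspace_imp_subspace[OF S(1)] S(2)] by metis
  have p: "cinner (x - p x) y = 0" if "y \<in> S" for x y
    using that csubspaceD(3)[OF S(1)] by (simp add: cinner_eq_Complex p0 complex_eq_iff)
  have uniq: "p x = q" if "q \<in> S" "\<And>y. y \<in> S \<Longrightarrow> cinner (x - q) y = 0" for x q
  proof -
    have "p x - q \<in> S" using csubspace_diff[OF S(1)] pS that by blast
    then have "cinner (x - q) (p x - q) - cinner (x - p x) (p x - q) = 0" using that p by simp
    then have "cinner (p x - q) (p x - q) = 0" by (simp add: cinner_diff_left)
    then show ?thesis by (simp add: cinner_self_eq_0)
  qed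
  have add: "p (x + y) = p x + p y" for x y
    by (rule uniq) (use pS csubspaceD(2)[OF S(1)] p in \<open>auto simp: add_diff_add cinner_add_left\<close>)
  have scl: "p (c *\<^sub>C x) = c *\<^sub>C p x" for c x
    by (rule uniq) (use pS csubspaceD(3)[OF S(1)] p in \<open>auto simp: scaleC_diff_right[symmetric] cinner_scaleC_left\<close>)
  have nrm: "norm (p x) \<le> norm x" for x
  proof -
    have "cinner (p x) (p x) = cinner x (p x)" using p[OF pS, of x x] by (simp add: cinner_diff_left)
    then have "(norm (p x))\<^sup>2 = cmod (cinner x (p x))" by (metis cinner_self norm_of_real abs_of_nonneg zero_le_power2)
    then have "norm (p x) * norm (p x) \<le> norm x * norm (p x)" using norm_cinner_le[of x "p x"] by (simp add: power2_eq_square)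
    then show ?thesis by (metis mult_right_le_imp_le norm_ge_zero order_le_less)
  qed
  have bl: "bounded_linear p"
    by (rule bounded_linear_intro[where K=1]) (auto simp: add scl scaleR_eq_scaleC nrm)
  have app: "blinfun_apply (Blinfun p) = p" by (rule bounded_linear_Blinfun_apply[OF bl])
  have sym: "cinner (p x) y = cinner x (p y)" for x y
  proof -
    have "cinner (p x) (y - p y) = 0" using p[OF pS, of y x] by (metis cinner_commute complex_cnj_zero)
    moreover have "cinner (x - p x) (p y) = 0" using p[OF pS] .
    ultimately show ?thesis by (simp add: cinner_diff_left cinner_diff_right)
  qed
  show thesis
    by (rule that[of "Blinfun p"]) (auto simp: app clinear_op_def scl pS p nrm sym intro: uniq)
qed

lemma closure_eq_UNIV_iff_orthogonal:
  fixes X :: "'a::chilbert_space set"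
  assumes "csubspace X"
  shows "closure X = UNIV \<longleftrightarrow> (\<forall>v. (\<forall>x\<in>X. cinner x v = 0) \<longrightarrow> v = 0)"
proof
  assume d: "closure X = UNIV"
  show "\<forall>v. (\<forall>x\<in>X. cinner x v = 0) \<longrightarrow> v = 0"
  proof (intro allI impI)
    fix v assume v: "\<forall>x\<in>X. cinner x v = 0"
    have "closed {x. cinner x v = 0}"
      by (intro closed_Collect_eq bounded_linear.continuous_on[OF bounded_linear_cinner_left] continuous_intros)
    then have "closure X \<subseteq> {x. cinner x v = 0}" using v by (intro closure_minimal) auto
    then have "cinner v v = 0" using d by auto
    then show "v = 0" by (simp add: cinner_self_eq_0)
  qed
next
  assume o: "\<forall>v. (\<forall>x\<in>X. cinner x v = 0) \<longrightarrow> v = 0"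
  obtain P where P: "\<And>x. blinfun_apply P x \<in> closure X" "\<And>x y. y \<in> closure X \<Longrightarrow> cinner (x - blinfun_apply P x) y = 0"
    using orthogonal_projection_op[OF csubspace_closure[OF assms] closed_closure] by metis
  have "x \<in> closure X" for x
  proof -
    have "x - blinfun_apply P x = 0"
      using o P(2) closure_subset by (metis cinner_commute complex_cnj_zero subsetD)
    then show ?thesis using P(1)[of x] by simp
  qed
  then show "closure X = UNIV" by auto
qed

text \<open>The continuous extension to the closure is precomposed with the orthogonal projection.
  That it vanishes on the orthogonal complement of \<open>X\<close> is recorded because the
  construction of intertwiners exploits it; \<open>\<bar>C\<bar>\<close> spares a sign condition on
  \<open>C\<close>.\<close>

lemma bounded_extension:
  fixes X :: "'a::chilbert_space set" and f :: "'a \<Rightarrow> 'b::chilbert_space"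
  assumes X: "csubspace X"
    and add: "\<And>x y. x \<in> X \<Longrightarrow> y \<in> X \<Longrightarrow> f (x + y) = f x + f y"
    and scl: "\<And>c x. x \<in> X \<Longrightarrow> f (c *\<^sub>C x) = c *\<^sub>C f x"
    and bnd: "\<And>x. x \<in> X \<Longrightarrow> norm (f x) \<le> C * norm x"
  obtains T where "clinear_op T" "\<And>x. x \<in> X \<Longrightarrow> blinfun_apply T x = f x"
    "\<And>z. (\<And>x. x \<in> X \<Longrightarrow> cinner z x = 0) \<Longrightarrow> blinfun_apply T z = 0"
    "\<And>x. norm (blinfun_apply T x) \<le> \<bar>C\<bar> * norm x"
proof -
  have diff: "f (x - y) = f x - f y" if "x \<in> X" "y \<in> X" for x y
  proof -
    have "f ((x - y) + y) = f (x - y) + f y" using that csubspace_diff[OF X] by (intro add) auto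
    then show ?thesis by simp
  qed
  have bnd': "norm (f x) \<le> \<bar>C\<bar> * norm x" if "x \<in> X" for x
    using bnd[OF that] by (smt (verit) mult_right_mono norm_ge_zero)
  have "\<bar>C\<bar>-lipschitz_on X f"
    by (rule lipschitz_onI) (auto simp: dist_norm diff[symmetric] csubspace_diff[OF X] intro!: bnd')
  then have "uniformly_continuous_on X f" by (rule lipschitz_on_uniformly_continuous)
  then obtain g where g: "uniformly_continuous_on (closure X) g" "\<And>x. x \<in> X \<Longrightarrow> f x = g x"
    using uniformly_continuous_on_extension_on_closure by metis
  have cont: "continuous_on (closure X) g" using g(1) by (rule uniformly_continuous_imp_continuous)
  have lim: "(\<lambda>n. f (u n)) \<longlonglongrightarrow> g x" if "\<And>n. u n \<in> X" "u \<longlonglongrightarrow> x" for u x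
  proof -
    have "x \<in> closure X" using that closure_sequential by blast
    then have "(\<lambda>n. g (u n)) \<longlonglongrightarrow> g x"
      by (rule continuous_on_tendsto_compose[OF cont that(2)])
        (intro always_eventually allI subsetD[OF closure_subset that(1)])
    then show ?thesis using g(2) that by simp
  qed
  have cX: "csubspace (closure X)" by (rule csubspace_closure[OF X])
  have gadd: "g (x + y) = g x + g y" if xy: "x \<in> closure X" "y \<in> closure X" for x y
  proof -
    obtain u v where u: "\<And>n. u n \<in> X" "u \<longlonglongrightarrow> x" and v: "\<And>n. v n \<in> X" "v \<longlonglongrightarrow> y"
      using xy unfolding closure_sequential by blast
    have "(\<lambda>n. f (u n + v n)) \<longlonglongrightarrow> g (x + y)"
      by (rule lim) (use u v csubspaceD[OF X] in \<open>auto intro: tendsto_add\<close>)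
    moreover have "(\<lambda>n. f (u n + v n)) \<longlonglongrightarrow> g x + g y"
      using tendsto_add[OF lim[OF u] lim[OF v]] by (simp add: add u(1) v(1))
    ultimately show ?thesis by (rule LIMSEQ_unique)
  qed
  have gscl: "g (c *\<^sub>C x) = c *\<^sub>C g x" if xy: "x \<in> closure X" for c x
  proof -
    obtain u where u: "\<And>n. u n \<in> X" "u \<longlonglongrightarrow> x" using xy unfolding closure_sequential by blast
    have "(\<lambda>n. f (c *\<^sub>C u n)) \<longlonglongrightarrow> g (c *\<^sub>C x)"
      by (rule lim) (use u csubspaceD[OF X] in \<open>auto intro: bounded_linear.tendsto[OF bounded_linear_scaleC]\<close>)
    moreover have "(\<lambda>n. f (c *\<^sub>C u n)) \<longlonglongrightarrow> c *\<^sub>C g x"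
      using bounded_linear.tendsto[OF bounded_linear_scaleC lim[OF u]] by (simp add: scl u(1))
    ultimately show ?thesis by (rule LIMSEQ_unique)
  qed
  have gbnd: "norm (g x) \<le> \<bar>C\<bar> * norm x" if xy: "x \<in> closure X" for x
  proof -
    obtain u where u: "\<And>n. u n \<in> X" "u \<longlonglongrightarrow> x" using xy unfolding closure_sequential by blast
    show ?thesis
      by (rule LIMSEQ_le[OF tendsto_norm[OF lim[OF u]] tendsto_mult_left[OF tendsto_norm[OF u(2)]]])
        (intro exI[of _ 0] allI impI bnd' u(1))
  qed
  obtain P where P: "clinear_op P" "\<And>x. blinfun_apply P x \<in> closure X" "\<And>x y. y \<in> closure X \<Longrightarrow> cinner (x - blinfun_apply P x) y = 0"
    "\<And>y. y \<in> closure X \<Longrightarrow> blinfun_apply P y = y" "\<And>x. norm (blinfun_apply P x) \<le> norm x"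
    "\<And>x y. cinner (blinfun_apply P x) y = cinner x (blinfun_apply P y)"
    using orthogonal_projection_op[OF cX closed_closure] by metis
  let ?T = "\<lambda>x. g (blinfun_apply P x)"
  have Tb: "norm (?T x) \<le> \<bar>C\<bar> * norm x" for x
    by (rule order_trans[OF gbnd[OF P(2)] mult_left_mono[OF P(5)]]) simp
  have "bounded_linear ?T"
  proof (rule bounded_linear_intro[where K="\<bar>C\<bar>"])
    show "?T (r *\<^sub>R x) = r *\<^sub>R ?T x" for r x
      by (simp only: scaleR_eq_scaleC clinear_opD[OF P(1)] gscl[OF P(2)])
    show "norm (?T x) \<le> norm x * \<bar>C\<bar>" for x
      using Tb[of x] by (simp only: mult.commute)
  qed (simp only: blinfun.add_right gadd[OF P(2) P(2)])
  then have app: "blinfun_apply (Blinfun ?T) = ?T" by (rule bounded_linear_Blinfun_apply)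
  have T0: "?T z = 0" if "\<And>x. x \<in> X \<Longrightarrow> cinner z x = 0" for z
  proof -
    have "closed {x. cinner z x = 0}"
      by (intro closed_Collect_eq bounded_linear.continuous_on[OF bounded_linear_cinner_right] continuous_intros)
    then have "closure X \<subseteq> {x. cinner z x = 0}" using that by (intro closure_minimal) auto
    then have "cinner z (blinfun_apply P (blinfun_apply P z)) = 0" using P(2)[of "blinfun_apply P z"] by blast
    then have "cinner (blinfun_apply P z) (blinfun_apply P z) = 0" by (simp only: P(6))
    then have "blinfun_apply P z = 0" by (simp add: cinner_self_eq_0)
    then show ?thesis using gscl[OF csubspaceD(1)[OF cX], of 0] by simp
  qed
  show thesis
  proof (rule that[of "Blinfun ?T"])
    show "clinear_op (Blinfun ?T)" by (simp add: clinear_op_def app clinear_opD[OF P(1)] gscl P(2))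
    show "blinfun_apply (Blinfun ?T) x = f x" if "x \<in> X" for x
      using that closure_subset[of X] by (auto simp: app P(4) g(2))
    show "blinfun_apply (Blinfun ?T) z = 0" if "\<And>x. x \<in> X \<Longrightarrow> cinner z x = 0" for z
      unfolding app by (rule T0[OF that])
    show "norm (blinfun_apply (Blinfun ?T) x) \<le> \<bar>C\<bar> * norm x" for x
      unfolding app by (rule Tb)
  qed
qed

lemma clinear_op_eq_on_dense:
  fixes S T :: "'a::chilbert_space \<Rightarrow>\<^sub>L 'b::chilbert_space"
  assumes "closure X = UNIV" "\<And>x. x \<in> X \<Longrightarrow> blinfun_apply S x = blinfun_apply T x"
  shows "S = T"
proof (rule blinfun_eqI)
  fix x
  have "closed {x. blinfun_apply S x = blinfun_apply T x}"
    by (intro closed_Collect_eq continuous_intros)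
  then have "closure X \<subseteq> {x. blinfun_apply S x = blinfun_apply T x}"
    by (intro closure_minimal) (auto simp only: assms(2))
  then show "blinfun_apply S x = blinfun_apply T x" unfolding assms(1) by blast
qed

section \<open>Adjoints\<close>

text \<open>Adjoint between two possibly different spaces, which \<open>adj\<close> does not cover.
  It is chosen through the real inner product, where Riesz gives existence for every bounded
  real-linear map; for complex-linear maps it is the usual adjoint.\<close>

definition hadj :: "('a::chilbert_space \<Rightarrow>\<^sub>L 'b::chilbert_space) \<Rightarrow> ('b \<Rightarrow>\<^sub>L 'a)" where
  "hadj T = (SOME S. \<forall>x y. inner (blinfun_apply T x) y = inner x (blinfun_apply S y))"

lemma inner_hadj:
  fixes T :: "'a::chilbert_space \<Rightarrow>\<^sub>L 'b::chilbert_space"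
  shows "inner (blinfun_apply T x) y = inner x (blinfun_apply (hadj T) y)"
proof -
  have "\<exists>v. \<forall>x. inner (blinfun_apply T x) y = inner x v" for y
    by (rule riesz_representation)
      (intro bounded_linear_intros)
  then obtain s where s: "\<And>x y. inner (blinfun_apply T x) y = inner x (s y)" by metis
  have ext: "u = v" if "\<And>x. inner x u = inner x v" for u v :: 'a
  proof -
    have "inner (u - v) (u - v) = 0" using that[of "u - v"] by (simp add: inner_diff_right)
    then show ?thesis by simp
  qed
  have "bounded_linear s"
  proof (rule bounded_linear_intro[where K="norm T"])
    show "s (x + y) = s x + s y" for x y by (rule ext) (simp add: s[symmetric] inner_add_right[of _ x y] inner_add_right[of _ "s x"])
    show "s (r *\<^sub>R x) = r *\<^sub>R s x" for r x by (rule ext) (simp add: s[symmetric])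
    fix y
    have "norm (s y) * norm (s y) = inner (blinfun_apply T (s y)) y"
      by (simp add: s power2_norm_eq_inner[symmetric] power2_eq_square)
    also have "\<dots> \<le> norm (blinfun_apply T (s y)) * norm y" by (rule norm_cauchy_schwarz)
    also have "\<dots> \<le> (norm T * norm (s y)) * norm y"
      by (intro mult_right_mono norm_blinfun) auto
    finally have "norm (s y) * norm (s y) \<le> (norm y * norm T) * norm (s y)" by (simp add: mult_ac)
    then show "norm (s y) \<le> norm y * norm T"
      by (metis mult_right_le_imp_le norm_ge_zero order_le_less mult_nonneg_nonneg)
  qed
  then have "\<exists>S. \<forall>x y. inner (blinfun_apply T x) y = inner x (blinfun_apply S y)"
    by (intro exI[of _ "Blinfun s"]) (simp add: bounded_linear_Blinfun_apply s)
  then show ?thesis unfolding hadj_def by (rule someI2_ex) blast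
qed

lemma inner_scaleC_ii: "inner (\<i> *\<^sub>C x) y = - inner x (\<i> *\<^sub>C y)"
  by (simp add: inner_eq_Re_cinner cinner_scaleC_left cinner_scaleC_right)

lemma cinner_hadj:
  assumes "clinear_op T"
  shows "cinner (blinfun_apply T x) y = cinner x (blinfun_apply (hadj T) y)"
proof -
  have "inner (blinfun_apply T x) (\<i> *\<^sub>C y) = - inner (\<i> *\<^sub>C blinfun_apply T x) y"
    by (simp add: inner_scaleC_ii)
  also have "\<dots> = - inner (\<i> *\<^sub>C x) (blinfun_apply (hadj T) y)"
    by (simp add: inner_hadj clinear_opD[OF assms, symmetric])
  also have "\<dots> = inner x (\<i> *\<^sub>C blinfun_apply (hadj T) y)" by (simp add: inner_scaleC_ii)
  finally show ?thesis by (simp add: cinner_eq_Complex inner_hadj)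
qed

lemma cinner_hadj_left:
  assumes "clinear_op T"
  shows "cinner (blinfun_apply (hadj T) y) x = cinner y (blinfun_apply T x)"
  by (metis cinner_hadj[OF assms] cinner_commute)

lemma clinear_op_hadj: "clinear_op T \<Longrightarrow> clinear_op (hadj T)"
  unfolding clinear_op_def[of "hadj T"]
  by (rule allI, rule allI, rule cinner_eqI) (simp add: cinner_hadj_left cinner_scaleC_left)

lemma hadj_unique:
  assumes "clinear_op T" "\<And>x y. cinner (blinfun_apply T x) y = cinner x (blinfun_apply S y)"
  shows "hadj T = S"
  by (rule blinfun_eqI, rule cinner_eqI_right) (metis assms cinner_hadj)

lemma adj_eq_hadj:
  assumes "clinear_op T" shows "adj T = hadj T"
  unfolding adj_def
  by (rule the_equality) (use assms in \<open>auto simp: cinner_hadj intro: hadj_unique[symmetric]\<close>)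

lemma hadj_hadj: "clinear_op T \<Longrightarrow> hadj (hadj T) = T"
  by (intro hadj_unique clinear_op_hadj) (auto simp: cinner_hadj_left)

lemma hadj_compose: "clinear_op S \<Longrightarrow> clinear_op T \<Longrightarrow> hadj (S o\<^sub>L T) = hadj T o\<^sub>L hadj S"
  by (intro hadj_unique clinear_op_compose) (auto simp: cinner_hadj)

lemma hadj_plus: "clinear_op S \<Longrightarrow> clinear_op T \<Longrightarrow> hadj (S + T) = hadj S + hadj T"
  by (intro hadj_unique clinear_op_plus)
    (auto simp: cinner_hadj blinfun.add_left cinner_add_left cinner_add_right)

lemma norm_hadj_le: "norm (hadj T) \<le> norm T"
proof (rule norm_blinfun_bound)
  fix y
  let ?s = "blinfun_apply (hadj T) y"
  have "norm ?s * norm ?s = inner (blinfun_apply T ?s) y"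
    by (simp add: inner_hadj power2_norm_eq_inner[symmetric] power2_eq_square)
  also have "\<dots> \<le> norm (blinfun_apply T ?s) * norm y" by (rule norm_cauchy_schwarz)
  also have "\<dots> \<le> (norm T * norm ?s) * norm y" by (intro mult_right_mono norm_blinfun) auto
  finally have "norm ?s * norm ?s \<le> (norm T * norm y) * norm ?s" by (simp add: mult_ac)
  then show "norm ?s \<le> norm T * norm y"
    by (metis mult_right_le_imp_le norm_ge_zero order_le_less mult_nonneg_nonneg)
qed simp

lemma bounded_linear_scaleC_blinfun:
  "bounded_linear (\<lambda>x. c *\<^sub>C blinfun_apply (T :: 'a::chilbert_space \<Rightarrow>\<^sub>L 'a) x)"
  by (rule bounded_linear_compose[OF bounded_linear_scaleC blinfun.bounded_linear_right])

lemma op_scale_apply [simp]: "blinfun_apply (op_scale c T) x = c *\<^sub>C blinfun_apply T x"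
  by (simp add: op_scale_def bounded_linear_Blinfun_apply bounded_linear_scaleC_blinfun)

lemma clinear_op_scale: "clinear_op T \<Longrightarrow> clinear_op (op_scale c T)"
  by (simp add: clinear_op_def scaleC_scaleC mult.commute)

lemma hadj_id [simp]: "hadj id_blinfun = id_blinfun"
  by (intro hadj_unique) auto

section \<open>The Hilbert space of square-summable sequences\<close>

text \<open>Ultraweak functionals are \<open>T \<mapsto> cinner (ell2_map T f) g\<close> with
  \<open>f\<close>, \<open>g\<close> in this Hilbert space, so that normality of the trace becomes a
  statement about vectors of the amplification.\<close>

definition l2_seqs :: "(nat \<Rightarrow> 'a::chilbert_space) set" where
  "l2_seqs = {f. (\<lambda>k. (norm (f k))\<^sup>2) summable_on UNIV}"

lemma l2_product_bound: "norm a * norm b \<le> (norm a)\<^sup>2 + (norm b)\<^sup>2"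
proof -
  have "0 \<le> norm a * norm b" by simp
  then show ?thesis using sum_squares_bound[of "norm a" "norm b"] unfolding mult.assoc by linarith
qed

lemma l2_add:
  assumes "f \<in> l2_seqs" "g \<in> l2_seqs" shows "(\<lambda>k. f k + g k) \<in> l2_seqs"
proof -
  have "(\<lambda>k. 3 * ((norm (f k))\<^sup>2 + (norm (g k))\<^sup>2)) summable_on UNIV"
    using assms by (intro summable_on_cmult_right summable_on_add) (auto simp: l2_seqs_def)
  moreover have "(norm (f k + g k))\<^sup>2 \<le> 3 * ((norm (f k))\<^sup>2 + (norm (g k))\<^sup>2)" for k
  proof -
    have "(norm (f k + g k))\<^sup>2 \<le> (norm (f k) + norm (g k))\<^sup>2"
      by (intro power_mono norm_triangle_ineq) auto
    also have "\<dots> \<le> 3 * ((norm (f k))\<^sup>2 + (norm (g k))\<^sup>2)"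
      using l2_product_bound[of "f k" "g k"] by (simp add: power2_sum)
    finally show ?thesis .
  qed
  ultimately show ?thesis unfolding l2_seqs_def mem_Collect_eq
    by (rule summable_on_comparison_test) auto
qed

lemma l2_scaleC:
  assumes "f \<in> l2_seqs" shows "(\<lambda>k. c *\<^sub>C f k) \<in> l2_seqs"
  using assms unfolding l2_seqs_def by (auto simp: power_mult_distrib intro!: summable_on_cmult_right)

typedef (overloaded) ('a::chilbert_space) ell2 = "l2_seqs :: (nat \<Rightarrow> 'a) set"
  morphisms ell2_nth Abs_ell2
  by (rule exI[of _ "\<lambda>_. 0"]) (simp add: l2_seqs_def)

setup_lifting type_definition_ell2

lemma ell2_summable: "(\<lambda>k. (norm (ell2_nth f k))\<^sup>2) summable_on UNIV"
  using ell2_nth[of f] by (simp add: l2_seqs_def)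

lemma ell2_cinner_abs_summable:
  "(\<lambda>k. cmod (cinner (ell2_nth f k) (ell2_nth g k))) summable_on UNIV"
proof -
  have "(\<lambda>k. (norm (ell2_nth f k))\<^sup>2 + (norm (ell2_nth g k))\<^sup>2) summable_on UNIV"
    by (intro summable_on_add ell2_summable)
  then show ?thesis
    by (rule summable_on_comparison_test) (auto intro: order_trans[OF norm_cinner_le l2_product_bound])
qed

lemma ell2_cinner_summable:
  "(\<lambda>k. cinner (ell2_nth f k) (ell2_nth g k)) summable_on UNIV"
  using ell2_cinner_abs_summable by (rule abs_summable_summable)

instantiation ell2 :: (chilbert_space) real_vector
begin

lift_definition zero_ell2 :: "'a ell2" is "\<lambda>_. 0" by (simp add: l2_seqs_def)
lift_definition plus_ell2 :: "'a ell2 \<Rightarrow> 'a ell2 \<Rightarrow> 'a ell2" is "\<lambda>f g k. f k + g k" by (rule l2_add)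
lift_definition uminus_ell2 :: "'a ell2 \<Rightarrow> 'a ell2" is "\<lambda>f k. - f k" by (simp add: l2_seqs_def)
lift_definition minus_ell2 :: "'a ell2 \<Rightarrow> 'a ell2 \<Rightarrow> 'a ell2" is "\<lambda>f g k. f k - g k"
  using l2_add[OF _ l2_scaleC[of _ "-1"]] by (fastforce simp: scaleC_minus_left)
lift_definition scaleR_ell2 :: "real \<Rightarrow> 'a ell2 \<Rightarrow> 'a ell2" is "\<lambda>r f k. r *\<^sub>R f k"
  by (simp add: scaleR_eq_scaleC l2_scaleC)

instance
proof
  fix f g h :: "'a ell2" and r s :: real
  show "f - g = f + - g" by transfer simp
  show "f + g + h = f + (g + h)" by transfer (simp add: add.assoc)
  show "f + g = g + f" by transfer (simp add: add.commute)
  show "0 + f = f" by transfer simp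
  show "- f + f = 0" by transfer simp
  show "r *\<^sub>R (f + g) = r *\<^sub>R f + r *\<^sub>R g" by transfer (simp add: scaleR_add_right)
  show "(r + s) *\<^sub>R f = r *\<^sub>R f + s *\<^sub>R f" by transfer (simp add: scaleR_add_left)
  show "r *\<^sub>R s *\<^sub>R f = (r * s) *\<^sub>R f" by transfer simp
  show "1 *\<^sub>R f = f" by transfer simp
qed

end

instantiation ell2 :: (chilbert_space) real_inner
begin

definition inner_ell2 :: "'a ell2 \<Rightarrow> 'a ell2 \<Rightarrow> real" where
  "inner_ell2 f g = Re (\<Sum>\<^sub>\<infinity>k. cinner (ell2_nth f k) (ell2_nth g k))"
definition norm_ell2 :: "'a ell2 \<Rightarrow> real" where "norm_ell2 f = sqrt (inner f f)"
definition sgn_ell2 :: "'a ell2 \<Rightarrow> 'a ell2" where "sgn_ell2 f = f /\<^sub>R norm f"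
definition dist_ell2 :: "'a ell2 \<Rightarrow> 'a ell2 \<Rightarrow> real" where "dist_ell2 f g = norm (f - g)"
definition uniformity_ell2 :: "('a ell2 \<times> 'a ell2) filter" where
  "uniformity_ell2 = (INF e\<in>{0 <..}. principal {(x, y). dist x y < e})"
definition open_ell2 :: "'a ell2 set \<Rightarrow> bool" where
  "open_ell2 U = (\<forall>x\<in>U. eventually (\<lambda>(x', y). x' = x \<longrightarrow> y \<in> U) uniformity)"

lemma inner_ell2_alt: "inner f g = (\<Sum>\<^sub>\<infinity>k. inner (ell2_nth f k) (ell2_nth g k))"
  unfolding inner_ell2_def inner_eq_Re_cinner by (rule infsum_Re[symmetric, OF ell2_cinner_summable])

lemma ell2_inner_summable: "(\<lambda>k. inner (ell2_nth f k) (ell2_nth g k)) summable_on UNIV"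
  unfolding inner_eq_Re_cinner by (rule summable_on_Re[OF ell2_cinner_summable])

instance
proof
  fix f g h :: "'a ell2" and r s :: real
  show "sgn f = f /\<^sub>R norm f" by (rule sgn_ell2_def)
  show "dist f g = norm (f - g)" by (rule dist_ell2_def)
  show "(uniformity :: ('a ell2 \<times> 'a ell2) filter) = (INF e\<in>{0 <..}. principal {(x, y). dist x y < e})"
    by (rule uniformity_ell2_def)
  show "open U = (\<forall>x\<in>U. eventually (\<lambda>(x', y). x' = x \<longrightarrow> y \<in> U) uniformity)" for U :: "'a ell2 set"
    by (rule open_ell2_def)
  show "inner f g = inner g f" unfolding inner_ell2_alt by (simp add: inner_commute)
  show "inner (f + g) h = inner f h + inner g h"
    unfolding inner_ell2_alt plus_ell2.rep_eq inner_add_left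
    by (intro infsum_add ell2_inner_summable)
  show "inner (r *\<^sub>R f) g = r * inner f g"
    unfolding inner_ell2_alt scaleR_ell2.rep_eq inner_scaleR_left
    by (rule infsum_cmult_right[OF ell2_inner_summable])
  show "0 \<le> inner f f" unfolding inner_ell2_alt by (intro infsum_nonneg) simp
  show "inner f f = 0 \<longleftrightarrow> f = 0"
  proof
    assume "inner f f = 0"
    then have "inner (ell2_nth f k) (ell2_nth f k) = 0" for k
      unfolding inner_ell2_alt
      by (intro nonneg_infsum_le_0D[where A=UNIV]) (auto intro: ell2_inner_summable)
    then have "ell2_nth f k = 0" for k by simp
    then show "f = 0" by transfer auto
  next
    assume "f = 0"
    then show "inner f f = 0" unfolding inner_ell2_alt by (simp add: zero_ell2.rep_eq)
  qed
  show "norm f = sqrt (inner f f)" by (rule norm_ell2_def)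
qed

end

lemma norm_ell2_square: "(norm (f :: 'a::chilbert_space ell2))\<^sup>2 = (\<Sum>\<^sub>\<infinity>k. (norm (ell2_nth f k))\<^sup>2)"
  by (simp add: power2_norm_eq_inner inner_ell2_alt)

lemma norm_ell2_nth_le: "norm (ell2_nth f k) \<le> norm (f :: 'a::chilbert_space ell2)"
proof -
  have "(\<Sum>i\<in>{k}. (norm (ell2_nth f i))\<^sup>2) \<le> (norm f)\<^sup>2"
    unfolding norm_ell2_square by (rule finite_sum_le_infsum[OF ell2_summable]) auto
  then have "(norm (ell2_nth f k))\<^sup>2 \<le> (norm f)\<^sup>2" by simp
  then show ?thesis by (rule power2_le_imp_le) simp
qed

lemma ell2_nth_minus: "ell2_nth (f - g) k = ell2_nth f k - ell2_nth g k"
  by (simp only: diff_conv_add_uminus plus_ell2.rep_eq uminus_ell2.rep_eq)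

lemma l2_seqs_bounded:
  assumes "\<And>F. finite F \<Longrightarrow> (\<Sum>k\<in>F. (norm (f k))\<^sup>2) \<le> C"
  shows "f \<in> l2_seqs"
  unfolding l2_seqs_def mem_Collect_eq
  by (rule nonneg_bdd_above_summable_on) (auto intro!: bdd_aboveI[of _ C] assms)

lemma ell2_sum_le: "finite F \<Longrightarrow> (\<Sum>k\<in>F. (norm (ell2_nth f k))\<^sup>2) \<le> (norm (f :: 'a::chilbert_space ell2))\<^sup>2"
  unfolding norm_ell2_square by (rule finite_sum_le_infsum[OF ell2_summable]) auto

instance ell2 :: (chilbert_space) complete_space
proof
  fix X :: "nat \<Rightarrow> 'a ell2" assume C: "Cauchy X"
  have "Cauchy (\<lambda>n. ell2_nth (X n) k)" for k
  proof (rule metric_CauchyI)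
    fix e :: real assume "e > 0"
    then obtain N where "\<forall>m\<ge>N. \<forall>n\<ge>N. dist (X m) (X n) < e" using C metric_CauchyD by blast
    then show "\<exists>N. \<forall>m\<ge>N. \<forall>n\<ge>N. dist (ell2_nth (X m) k) (ell2_nth (X n) k) < e"
      by (metis dist_norm ell2_nth_minus norm_ell2_nth_le order_le_less_trans)
  qed
  then have "\<exists>l. (\<lambda>n. ell2_nth (X n) k) \<longlonglongrightarrow> l" for k using Cauchy_convergent convergent_def by blast
  then obtain l where l: "\<And>k. (\<lambda>n. ell2_nth (X n) k) \<longlonglongrightarrow> l k" by metis
  have est: "(\<Sum>k\<in>F. (norm (ell2_nth (X m) k - l k))\<^sup>2) \<le> e\<^sup>2"
    if "finite F" "\<And>n. n \<ge> N \<Longrightarrow> norm (X m - X n) \<le> e" "e \<ge> 0" for F m N e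
  proof (rule LIMSEQ_le_const2)
    show "(\<lambda>n. \<Sum>k\<in>F. (norm (ell2_nth (X m) k - ell2_nth (X n) k))\<^sup>2)
        \<longlonglongrightarrow> (\<Sum>k\<in>F. (norm (ell2_nth (X m) k - l k))\<^sup>2)"
      by (intro tendsto_intros l)
    have "(\<Sum>k\<in>F. (norm (ell2_nth (X m) k - ell2_nth (X n) k))\<^sup>2) \<le> e\<^sup>2" if "n \<ge> N" for n
      using ell2_sum_le[OF \<open>finite F\<close>, of "X m - X n"] that \<open>\<And>n. n \<ge> N \<Longrightarrow> norm (X m - X n) \<le> e\<close>[of n]
      by (simp add: ell2_nth_minus) (meson norm_ge_zero order_trans power_mono)
    then show "\<exists>N. \<forall>n\<ge>N. (\<Sum>k\<in>F. (norm (ell2_nth (X m) k - ell2_nth (X n) k))\<^sup>2) \<le> e\<^sup>2" by blast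
  qed
  obtain N1 where N1: "\<forall>m\<ge>N1. \<forall>n\<ge>N1. dist (X m) (X n) < 1" using C metric_CauchyD zero_less_one by blast
  \<comment> \<open>Square summability of the coordinatewise limit is reached through its difference
    from one member of the sequence, whose partial sums \<open>est\<close> bounds.\<close>
  have dl: "(\<lambda>k. ell2_nth (X N1) k - l k) \<in> l2_seqs"
    by (rule l2_seqs_bounded[where C="1\<^sup>2"], rule est[of _ N1]) (use N1 in \<open>auto simp: dist_norm less_imp_le\<close>)
  have "l \<in> l2_seqs"
    using l2_add[OF ell2_nth[of "X N1"] l2_scaleC[OF dl, of "-1"]] by (simp add: scaleC_minus_left)
  then have L: "ell2_nth (Abs_ell2 l) = l" by (rule Abs_ell2_inverse)
  have "X \<longlonglongrightarrow> Abs_ell2 l"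
  proof (rule metric_LIMSEQ_I)
    fix e :: real assume "e > 0"
    then obtain N where N: "\<forall>m\<ge>N. \<forall>n\<ge>N. dist (X m) (X n) < e / 2" using C metric_CauchyD half_gt_zero by blast
    have "dist (X m) (Abs_ell2 l) < e" if "m \<ge> N" for m
    proof -
      have "(norm (X m - Abs_ell2 l))\<^sup>2 \<le> (e/2)\<^sup>2"
        unfolding norm_ell2_square
        by (rule infsum_le_finite_sums[OF ell2_summable], simp only: ell2_nth_minus L, rule est[of _ N])
          (use N that \<open>e > 0\<close> in \<open>auto simp: dist_norm less_imp_le\<close>)
      then have "norm (X m - Abs_ell2 l) \<le> e/2" by (rule power2_le_imp_le) (use \<open>e > 0\<close> in simp)
      then show ?thesis using \<open>e > 0\<close> by (simp add: dist_norm)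
    qed
    then show "\<exists>N. \<forall>m\<ge>N. dist (X m) (Abs_ell2 l) < e" by blast
  qed
  then show "convergent X" by (rule convergentI)
qed

instantiation ell2 :: (chilbert_space) chilbert_space
begin

lift_definition scaleC_ell2 :: "complex \<Rightarrow> 'a ell2 \<Rightarrow> 'a ell2" is "\<lambda>c f k. c *\<^sub>C f k"
  by (rule l2_scaleC)
definition cinner_ell2 :: "'a ell2 \<Rightarrow> 'a ell2 \<Rightarrow> complex" where
  "cinner_ell2 f g = (\<Sum>\<^sub>\<infinity>k. cinner (ell2_nth f k) (ell2_nth g k))"

instance
proof
  fix f g h :: "'a ell2" and a b :: complex and r :: real
  show "a *\<^sub>C (f + g) = a *\<^sub>C f + a *\<^sub>C g" by transfer (simp add: scaleC_add_right)
  show "(a + b) *\<^sub>C f = a *\<^sub>C f + b *\<^sub>C f" by transfer (simp add: scaleC_add_left)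
  show "a *\<^sub>C b *\<^sub>C f = (a * b) *\<^sub>C f" by transfer (simp add: scaleC_scaleC)
  show "r *\<^sub>R f = complex_of_real r *\<^sub>C f" by transfer (simp add: scaleR_eq_scaleC)
  show "cinner f g = cnj (cinner g f)"
    unfolding cinner_ell2_def infsum_cnj[symmetric] by (simp flip: cinner_commute)
  show "cinner (f + g) h = cinner f h + cinner g h"
    unfolding cinner_ell2_def plus_ell2.rep_eq cinner_add_left
    by (intro infsum_add ell2_cinner_summable)
  show "cinner (a *\<^sub>C f) g = a * cinner f g"
    unfolding cinner_ell2_def scaleC_ell2.rep_eq cinner_scaleC_left
    by (rule infsum_cmult_right[OF ell2_cinner_summable])
  show "inner f g = Re (cinner f g)" by (simp add: inner_ell2_def cinner_ell2_def)
qed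

end

lemma square_summable_iff: "square_summable f \<longleftrightarrow> f \<in> l2_seqs"
  unfolding square_summable_def l2_seqs_def mem_Collect_eq
  by (subst summable_on_UNIV_nonneg_real_iff) auto

lemma l2_seqs_blinfun:
  assumes "f \<in> l2_seqs" shows "(\<lambda>k. blinfun_apply T (f k)) \<in> l2_seqs"
proof -
  have "(\<lambda>k. (norm T)\<^sup>2 * (norm (f k))\<^sup>2) summable_on UNIV"
    using assms by (intro summable_on_cmult_right) (auto simp: l2_seqs_def)
  then show ?thesis unfolding l2_seqs_def mem_Collect_eq
    by (rule summable_on_comparison_test)
      (auto simp: norm_blinfun power_mono power_mult_distrib[symmetric])
qed

text \<open>The amplification of \<open>T\<close>, that is, \<open>T\<close> tensored with the
  identity on scalar sequences.\<close>

lift_definition ell2_map :: "('a::chilbert_space \<Rightarrow>\<^sub>L 'a) \<Rightarrow> 'a ell2 \<Rightarrow> 'a ell2" is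
  "\<lambda>T f k. blinfun_apply T (f k)" by (rule l2_seqs_blinfun)

lemma ell2_eqI: "(\<And>k. ell2_nth f k = ell2_nth g k) \<Longrightarrow> f = g"
  by transfer auto

lemma norm_ell2_map_le: "norm (ell2_map T f) \<le> norm T * norm f"
proof -
  have "(norm (ell2_map T f))\<^sup>2 \<le> (\<Sum>\<^sub>\<infinity>k. (norm T)\<^sup>2 * (norm (ell2_nth f k))\<^sup>2)"
    unfolding norm_ell2_square
    by (intro infsum_mono ell2_summable summable_on_cmult_right)
      (simp add: ell2_map.rep_eq norm_blinfun power_mono flip: power_mult_distrib)
  also have "\<dots> = (norm T * norm f)\<^sup>2"
    by (simp add: power_mult_distrib norm_ell2_square infsum_cmult_right[OF ell2_summable])
  finally show ?thesis by (rule power2_le_imp_le) simp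
qed

lemma ell2_map_simps:
  "ell2_map (S + T) f = ell2_map S f + ell2_map T f"
  "ell2_map T (f + g) = ell2_map T f + ell2_map T g"
  "ell2_map (op_scale c T) f = c *\<^sub>C ell2_map T f"
  "ell2_map (S o\<^sub>L T) f = ell2_map S (ell2_map T f)"
  by (auto intro!: ell2_eqI simp: ell2_map.rep_eq plus_ell2.rep_eq scaleC_ell2.rep_eq blinfun.add_left blinfun.add_right)

lemma ell2_map_scaleC: "clinear_op T \<Longrightarrow> ell2_map T (c *\<^sub>C f) = c *\<^sub>C ell2_map T f"
  by (auto intro!: ell2_eqI simp: ell2_map.rep_eq scaleC_ell2.rep_eq clinear_opD)

lemma cinner_ell2_map:
  "clinear_op T \<Longrightarrow> cinner (ell2_map T f) g = cinner f (ell2_map (hadj T) g)"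
  by (simp add: cinner_ell2_def ell2_map.rep_eq cinner_hadj)

definition ell2_proj :: "nat \<Rightarrow> 'a::chilbert_space ell2 \<Rightarrow>\<^sub>L 'a" where
  "ell2_proj k = Blinfun (\<lambda>f. ell2_nth f k)"

lemma ell2_proj_apply [simp]: "blinfun_apply (ell2_proj k) f = ell2_nth f k"
  unfolding ell2_proj_def
  by (subst bounded_linear_Blinfun_apply)
    (auto intro!: bounded_linear_intro[where K=1] simp: plus_ell2.rep_eq scaleR_ell2.rep_eq norm_ell2_nth_le)

text \<open>Interleaving two sequences along the bijection between \<open>nat\<close> and
  \<open>nat + nat\<close> adds the squared norms under every \<open>T\<close> at once; in this way
  finitely many vectors can be replaced by one.\<close>

lemma ell2_merge:
  "\<exists>h :: 'a::chilbert_space ell2. \<forall>T. (norm (ell2_map T h))\<^sup>2 = (norm (ell2_map T f))\<^sup>2 + (norm (ell2_map T g))\<^sup>2"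
proof -
  define h where "h k = (case sum_decode k of Inl i \<Rightarrow> ell2_nth f i | Inr j \<Rightarrow> ell2_nth g j)" for k
  have key: "((\<lambda>k. (norm (blinfun_apply T (h k)))\<^sup>2) has_sum (norm (ell2_map T f))\<^sup>2 + (norm (ell2_map T g))\<^sup>2) UNIV" for T :: "'a \<Rightarrow>\<^sub>L 'a"
  proof -
    let ?u = "\<lambda>s. (norm (blinfun_apply T (case s of Inl i \<Rightarrow> ell2_nth f i | Inr j \<Rightarrow> ell2_nth g j)))\<^sup>2"
    have hs: "((\<lambda>k. (norm (ell2_nth x k))\<^sup>2) has_sum (norm x)\<^sup>2) UNIV" for x :: "'a ell2"
      unfolding norm_ell2_square using ell2_summable by (rule has_sum_infsum)
    have "(?u has_sum (norm (ell2_map T f))\<^sup>2) (range Inl)"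
      by (subst has_sum_reindex) (use hs[of "ell2_map T f"] in \<open>auto simp: o_def ell2_map.rep_eq\<close>)
    moreover have "(?u has_sum (norm (ell2_map T g))\<^sup>2) (range Inr)"
      by (subst has_sum_reindex) (use hs[of "ell2_map T g"] in \<open>auto simp: o_def ell2_map.rep_eq\<close>)
    ultimately have "(?u has_sum (norm (ell2_map T f))\<^sup>2 + (norm (ell2_map T g))\<^sup>2) (range Inl \<union> range Inr)"
      by (rule has_sum_Un_disjoint) auto
    then have "(?u has_sum (norm (ell2_map T f))\<^sup>2 + (norm (ell2_map T g))\<^sup>2) UNIV"
      by (simp flip: UNIV_sum)
    then have "((\<lambda>k. ?u (sum_decode k)) has_sum (norm (ell2_map T f))\<^sup>2 + (norm (ell2_map T g))\<^sup>2) UNIV"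
      by (subst has_sum_reindex_bij_betw[OF bij_sum_decode])
    then show ?thesis by (simp add: h_def)
  qed
  have "h \<in> l2_seqs"
    using has_sum_imp_summable[OF key[of id_blinfun]] by (simp add: l2_seqs_def)
  then have "ell2_nth (Abs_ell2 h) = h" by (rule Abs_ell2_inverse)
  then show ?thesis
    using key by (intro exI[of _ "Abs_ell2 h"]) (auto simp: norm_ell2_square[of "ell2_map _ (Abs_ell2 h)"] ell2_map.rep_eq intro!: infsumI)
qed

section \<open>Double series\<close>

text \<open>Fubini: absolute summability along the diagonals \<open>k + n = N\<close> is unordered
  summability over all pairs, so the rows may be summed first. It serves both the group law and the
  product rule for the flow.\<close>

lemma double_series_diagonal:
  fixes f :: "nat \<Rightarrow> nat \<Rightarrow> 'c::banach"
  assumes "summable (\<lambda>N. \<Sum>k\<le>N. norm (f k (N - k)))"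
  shows "(\<lambda>m. \<Sum>n. f m n) sums (\<Sum>N. \<Sum>k\<le>N. f k (N - k))"
    and "summable (\<lambda>n. norm (f m n))"
proof -
  let ?S = "Sigma UNIV (\<lambda>N::nat. {..N})"
  let ?g = "\<lambda>(N, k). f k (N - k)"
  have abs: "(\<lambda>p. norm (?g p)) summable_on ?S"
    by (rule Infinite_Sum.abs_summable_on_Sigma_iff[THEN iffD2])
      (use assms in \<open>auto simp: abs_of_nonneg sum_nonneg intro!: norm_summable_imp_summable_on\<close>)
  have bij: "(\<lambda>p. norm (?g p)) summable_on ?S \<longleftrightarrow> (\<lambda>p. norm (case p of (m, n) \<Rightarrow> f m n)) summable_on (UNIV \<times> UNIV)"
    by (rule summable_on_reindex_bij_witness[of _ "\<lambda>(m, n). (m + n, m)" "\<lambda>(N, k). (k, N - k)"]) auto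
  have absF: "(\<lambda>p. norm (case p of (m, n) \<Rightarrow> f m n)) summable_on (UNIV \<times> UNIV)"
    using abs bij by blast
  then have row: "(\<lambda>n. norm (f m n)) summable_on UNIV" for m
    using Infinite_Sum.abs_summable_on_Sigma_iff[THEN iffD1] by fastforce
  then show rows: "summable (\<lambda>n. norm (f m n))" for m by (rule summable_on_imp_summable)
  have infrow: "infsum (f m) UNIV = (\<Sum>n. f m n)" for m
    using norm_summable_imp_has_sum[OF rows summable_sums[OF summable_norm_cancel[OF rows]]] by (rule infsumI)
  have eq: "infsum ?g ?S = (\<Sum>\<^sub>\<infinity>p\<in>UNIV \<times> UNIV. case p of (m, n) \<Rightarrow> f m n)"
    by (rule infsum_reindex_bij_witness[of _ "\<lambda>(m, n). (m + n, m)" "\<lambda>(N, k). (k, N - k)"]) auto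
  have sF: "(\<lambda>(m, n). f m n) summable_on (UNIV \<times> UNIV)" using absF by (rule abs_summable_summable)
  have sg: "(\<lambda>(N, k). f k (N - k)) summable_on ?S" using abs by (rule abs_summable_summable)
  have "((\<lambda>m. infsum (f m) UNIV) has_sum infsum (\<lambda>(m, n). f m n) (UNIV \<times> UNIV)) UNIV"
    using summable_on_Sigma_banach[OF sF] infsum_Sigma'_banach[OF sF] by (simp add: has_sum_iff)
  then have 1: "(\<lambda>m. \<Sum>n. f m n) sums infsum (\<lambda>(m, n). f m n) (UNIV \<times> UNIV)"
    unfolding infrow by (rule has_sum_imp_sums)
  have "((\<lambda>N. \<Sum>k\<le>N. f k (N - k)) has_sum infsum ?g ?S) UNIV"
    using summable_on_Sigma_banach[OF sg] infsum_Sigma'_banach[OF sg] by (simp add: has_sum_iff)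
  then have "(\<lambda>N. \<Sum>k\<le>N. f k (N - k)) sums infsum ?g ?S" by (rule has_sum_imp_sums)
  then show "(\<lambda>m. \<Sum>n. f m n) sums (\<Sum>N. \<Sum>k\<le>N. f k (N - k))"
    using 1 eq by (simp add: sums_iff)
qed

text \<open>By the binomial theorem the diagonals of the double series carry
  \<open>(s + t) ^ N / fact N\<close>. This is the law
  \<open>exp (t D) exp (s D) = exp ((s + t) D)\<close>, used with \<open>z N\<close> equal to
  \<open>D ^^ N\<close> at a vector or to a matrix coefficient of it.\<close>

lemma exp_double_series:
  fixes z :: "nat \<Rightarrow> 'c::banach"
  assumes "summable (\<lambda>N. (\<bar>s\<bar> + \<bar>t\<bar>) ^ N / fact N * norm (z N))"
  shows "(\<lambda>m. (t ^ m / fact m) *\<^sub>R (\<Sum>n. (s ^ n / fact n) *\<^sub>R z (n + m))) sums (\<Sum>N. ((s + t) ^ N / fact N) *\<^sub>R z N)"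
proof -
  let ?f = "\<lambda>m n. (t ^ m / fact m * (s ^ n / fact n)) *\<^sub>R z (n + m)"
  have bin: "(\<Sum>k\<le>N. a ^ k / fact k * (b ^ (N - k) / fact (N - k))) = (b + a) ^ N / fact N" for a b :: real and N
  proof -
    have "(a + b) ^ N = (\<Sum>k\<le>N. fact N * (a ^ k / fact k * (b ^ (N - k) / fact (N - k))))"
      unfolding binomial_ring by (intro sum.cong) (auto simp: binomial_fact)
    also have "\<dots> = fact N * (\<Sum>k\<le>N. a ^ k / fact k * (b ^ (N - k) / fact (N - k)))"
      by (simp only: sum_distrib_left)
    finally show ?thesis by (simp add: add.commute)
  qed
  have d: "(\<Sum>k\<le>N. ?f k (N - k)) = ((s + t) ^ N / fact N) *\<^sub>R z N" for N
  proof -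
    have "(\<Sum>k\<le>N. ?f k (N - k)) = (\<Sum>k\<le>N. (t ^ k / fact k * (s ^ (N - k) / fact (N - k))) *\<^sub>R z N)"
      by (intro sum.cong) auto
    then show ?thesis by (simp only: bin scaleR_sum_left[symmetric])
  qed
  have n: "(\<Sum>k\<le>N. norm (?f k (N - k))) = (\<bar>s\<bar> + \<bar>t\<bar>) ^ N / fact N * norm (z N)" for N
  proof -
    have "(\<Sum>k\<le>N. norm (?f k (N - k))) = (\<Sum>k\<le>N. (\<bar>t\<bar> ^ k / fact k * (\<bar>s\<bar> ^ (N - k) / fact (N - k))) * norm (z N))"
      by (intro sum.cong) (auto simp: abs_mult power_abs)
    then show ?thesis by (simp only: bin sum_distrib_right[symmetric])
  qed
  have sm: "summable (\<lambda>N. \<Sum>k\<le>N. norm (?f k (N - k)))" unfolding n by (rule assms)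
  have "(\<Sum>n. ?f m n) = (t ^ m / fact m) *\<^sub>R (\<Sum>n. (s ^ n / fact n) *\<^sub>R z (n + m))" for m
  \<comment> \<open>For \<open>t = 0\<close> and \<open>m > 0\<close> nothing is known about the
    convergence of the row, but it is multiplied by zero on both sides; otherwise dividing by
    \<open>t ^ m\<close> recovers its summability.\<close>
  proof (cases "t ^ m = 0")
    case False
    have "summable (\<lambda>n. ?f m n)" by (rule summable_norm_cancel[OF double_series_diagonal(2)[OF sm]])
    then have "summable (\<lambda>n. (fact m / t ^ m) *\<^sub>R ?f m n)" by (rule summable_scaleR_right)
    moreover have "fact m / t ^ m * (t ^ m / fact m * c) = c" for c :: real using False by (simp del: power_eq_0_iff)
    ultimately have "summable (\<lambda>n. (s ^ n / fact n) *\<^sub>R z (n + m))" by (simp only: scaleR_scaleR)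
    then show ?thesis by (simp only: suminf_scaleR_right scaleR_scaleR)
  next
    case True
    have "?f m n = 0" for n by (simp only: True div_0 mult_zero_left scaleR_zero_left)
    then show ?thesis by (simp only: True div_0 scaleR_zero_left suminf_zero)
  qed
  then show ?thesis using double_series_diagonal(1)[OF sm] by (simp only: d)
qed

section \<open>One-parameter groups generated by analytic vectors\<close>

lemma funpow_commute_comp:
  assumes "f \<circ> g = g \<circ> f" shows "(f \<circ> g) ^^ n = f ^^ n \<circ> g ^^ n"
proof (induction n)
  case (Suc n)
  have "g \<circ> f ^^ n = f ^^ n \<circ> g"
  proof (induction n)
    case (Suc n)
    have "g \<circ> (f \<circ> f ^^ n) = f \<circ> (g \<circ> f ^^ n)" using assms by (metis comp_assoc)
    then show ?case by (simp only: Suc funpow.simps comp_assoc)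
  qed simp
  then have "f \<circ> g \<circ> (f ^^ n \<circ> g ^^ n) = f \<circ> f ^^ n \<circ> (g \<circ> g ^^ n)"
    by (metis comp_assoc)
  then show ?case by (simp only: Suc funpow.simps comp_assoc)
qed simp

text \<open>\<open>U t\<close> is \<open>W (t / N) ^^ N\<close> for any \<open>N\<close> with
  \<open>\<bar>t\<bar> \<le> N * h\<close>; two choices are compared through their common refinement
  \<open>N * M\<close>. The last conclusion, that every \<open>U t\<close> is an iterate of a local
  operator, lets linearity and isometry pass to \<open>U\<close>.\<close>

lemma local_group_extension:
  fixes W :: "real \<Rightarrow> 'x \<Rightarrow> 'x"
  assumes h: "h > 0" and W0: "W 0 = id"
    and W: "\<And>s t. \<bar>s\<bar> \<le> h \<Longrightarrow> \<bar>t\<bar> \<le> h \<Longrightarrow> \<bar>s + t\<bar> \<le> h \<Longrightarrow> W (s + t) = W s \<circ> W t"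
  obtains U where "\<And>s t. U (s + t) = U s \<circ> U t" "\<And>t. \<bar>t\<bar> \<le> h \<Longrightarrow> U t = W t"
    "\<And>t. \<exists>N s. \<bar>s\<bar> \<le> h \<and> U t = W s ^^ N"
proof -
  have A: "W (real m * s) = W s ^^ m" if "\<bar>real m * s\<bar> \<le> h" for m s
    using that
  proof (induction m)
    case (Suc m)
    have le: "\<bar>real m * s\<bar> \<le> h" "\<bar>s\<bar> \<le> h"
    proof -
      have "\<bar>real m * s\<bar> \<le> \<bar>real (Suc m) * s\<bar>" by (simp add: abs_mult mult_right_mono)
      then show "\<bar>real m * s\<bar> \<le> h" using Suc.prems by linarith
      have "1 * \<bar>s\<bar> \<le> real (Suc m) * \<bar>s\<bar>" by (intro mult_right_mono) auto
      then show "\<bar>s\<bar> \<le> h" using Suc.prems by (simp add: abs_mult)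
    qed
    have "real (Suc m) * s = s + real m * s" by (simp add: algebra_simps)
    then show ?case using W[of s "real m * s"] le Suc by simp
  qed (simp add: W0)
  have ok: "\<bar>t / real N\<bar> \<le> h" if "N > 0" "\<bar>t\<bar> \<le> real N * h" for t N
    using that by (simp add: field_simps)
  have B: "W (t / real N) ^^ N = W (t / real (N * M)) ^^ (N * M)" if "N > 0" "M > 0" "\<bar>t\<bar> \<le> real N * h" for t N M
  proof -
    have "t / real N = real M * (t / real (N * M))" using that by (simp add: field_simps)
    then have "W (t / real N) = W (t / real (N * M)) ^^ M" using A ok[of N t] that by metis
    then show ?thesis by (simp only: funpow_mult mult.commute)
  qed
  \<comment> \<open>The added one keeps the number of steps positive at
    \<open>t = 0\<close>.\<close>
  define n where "n t = nat \<lceil>\<bar>t\<bar> / h\<rceil> + 1" for t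
  have n: "n t > 0" "\<bar>t\<bar> \<le> real (n t) * h" for t
  proof -
    have "\<bar>t\<bar> / h \<le> real (n t)" unfolding n_def using h by (simp add: le_nat_iff) linarith
    then show "\<bar>t\<bar> \<le> real (n t) * h" using h by (simp add: field_simps)
  qed (simp add: n_def)
  define U where "U t = W (t / real (n t)) ^^ n t" for t
  have Ueq: "U t = W (t / real N) ^^ N" if "N > 0" "\<bar>t\<bar> \<le> real N * h" for t N
    using B[OF n(1) that(1) n(2)] B[OF that(1) n(1) that(2)] by (simp only: U_def mult.commute)
  show thesis
  proof (rule that[of U])
    fix s t
    define N where "N = n (\<bar>s\<bar> + \<bar>t\<bar>)"
    have N: "N > 0" "\<bar>s\<bar> + \<bar>t\<bar> \<le> real N * h" using n[of "\<bar>s\<bar> + \<bar>t\<bar>"] by (auto simp: N_def)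
    have b: "\<bar>s / real N\<bar> \<le> h" "\<bar>t / real N\<bar> \<le> h" "\<bar>s / real N + t / real N\<bar> \<le> h"
      using N ok[of N s] ok[of N t] ok[of N "s + t"] by (auto simp: add_divide_distrib)
    have "W (s / real N) \<circ> W (t / real N) = W (t / real N) \<circ> W (s / real N)"
      using W[OF b] W[of "t / real N" "s / real N"] b by (simp add: add.commute)
    then have "(W (s / real N) \<circ> W (t / real N)) ^^ N = W (s / real N) ^^ N \<circ> W (t / real N) ^^ N"
      by (rule funpow_commute_comp)
    then show "U (s + t) = U s \<circ> U t"
      using Ueq[of N s] Ueq[of N t] Ueq[of N "s + t"] N W[OF b] by (simp add: add_divide_distrib)
  next
    show "U t = W t" if "\<bar>t\<bar> \<le> h" for t using Ueq[of 1 t] that by simp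
    show "\<exists>N s. \<bar>s\<bar> \<le> h \<and> U t = W s ^^ N" for t unfolding U_def using ok[OF n, of t] by blast
  qed
qed

lemma isometry_cinner:
  assumes T: "clinear_op T" and n: "\<And>x. norm (blinfun_apply T x) = norm x"
  shows "cinner (blinfun_apply T x) (blinfun_apply T y) = cinner x y"
proof -
  have pol: "inner u v = ((norm (u + v))\<^sup>2 - (norm u)\<^sup>2 - (norm v)\<^sup>2) / 2" for u v :: "'z::real_inner"
    by (simp add: power2_norm_eq_inner inner_add_left inner_add_right inner_commute)
  have "inner (blinfun_apply T x) (blinfun_apply T y) = inner x y" for x y
    unfolding pol by (simp only: blinfun.add_right[symmetric] n)
  then show ?thesis by (simp add: cinner_eq_Complex flip: clinear_opD[OF T])
qed

lemma tendsto_dense_isometry: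
  fixes X :: "real \<Rightarrow> 'b::chilbert_space \<Rightarrow>\<^sub>L 'b"
  assumes iso: "\<And>t x. norm (blinfun_apply (X t) x) = norm x"
    and E: "closure E = UNIV" "\<And>x. x \<in> E \<Longrightarrow> ((\<lambda>t. blinfun_apply (X t) x) \<longlongrightarrow> x) (at 0)"
  shows "((\<lambda>t. blinfun_apply (X t) x) \<longlongrightarrow> x) (at 0)"
proof (rule tendstoI)
  fix e :: real assume "e > 0"
  have "x \<in> closure E" using E by simp
  then obtain y where y: "y \<in> E" "dist y x < e / 3" using \<open>e > 0\<close> closure_approachable[of x E] by (metis divide_pos_pos zero_less_numeral)
  have "\<forall>\<^sub>F t in at 0. dist (blinfun_apply (X t) y) y < e / 3"
    using tendstoD[OF E(2)[OF y(1)], of "e/3"] \<open>e > 0\<close> by simp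
  then show "\<forall>\<^sub>F t in at 0. dist (blinfun_apply (X t) x) x < e"
  proof eventually_elim
    case (elim t)
    have "dist (blinfun_apply (X t) x) (blinfun_apply (X t) y) = dist x y"
      by (simp add: dist_norm iso flip: blinfun.diff_right)
    then show ?case using elim y(2) dist_triangle[of "blinfun_apply (X t) x" x "blinfun_apply (X t) y"]
      dist_triangle[of "blinfun_apply (X t) y" x y] by (simp add: dist_commute)
  qed
qed

text \<open>The radius \<open>r\<close> is common to all vectors of \<open>E\<close>. This is more
  than analyticity of each vector and is what allows the exponential series to define operators on a
  fixed time interval.\<close>

locale analytic_skew =
  fixes E :: "'b::chilbert_space set" and D :: "'b \<Rightarrow> 'b" and r :: real
  assumes E: "csubspace E" and dense: "closure E = UNIV"
    and DE: "x \<in> E \<Longrightarrow> D x \<in> E"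
    and D_add: "x \<in> E \<Longrightarrow> y \<in> E \<Longrightarrow> D (x + y) = D x + D y"
    and D_scaleC: "x \<in> E \<Longrightarrow> D (c *\<^sub>C x) = c *\<^sub>C D x"
    and skew: "x \<in> E \<Longrightarrow> y \<in> E \<Longrightarrow> cinner (D x) y = - cinner x (D y)"
    and r: "r > 0"
    and analytic: "x \<in> E \<Longrightarrow> 0 \<le> \<rho> \<Longrightarrow> \<rho> < r \<Longrightarrow> summable (\<lambda>n. \<rho> ^ n / fact n * norm ((D ^^ n) x))"
begin

definition expD :: "real \<Rightarrow> 'b \<Rightarrow> 'b" where
  "expD t x = (\<Sum>n. (t ^ n / fact n) *\<^sub>R (D ^^ n) x)"

lemma DnE: "x \<in> E \<Longrightarrow> (D ^^ n) x \<in> E"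
  by (induction n) (auto intro: DE)

lemma Dn_add: "x \<in> E \<Longrightarrow> y \<in> E \<Longrightarrow> (D ^^ n) (x + y) = (D ^^ n) x + (D ^^ n) y"
  by (induction n) (simp_all add: D_add DnE)

lemma Dn_scaleC: "x \<in> E \<Longrightarrow> (D ^^ n) (c *\<^sub>C x) = c *\<^sub>C (D ^^ n) x"
  by (induction n) (simp_all add: D_scaleC DnE)

lemma exp_summable:
  assumes "x \<in> E" "\<bar>t\<bar> < r"
  shows "summable (\<lambda>n. norm ((t ^ n / fact n) *\<^sub>R (D ^^ n) x))" "summable (\<lambda>n. (t ^ n / fact n) *\<^sub>R (D ^^ n) x)"
proof -
  show "summable (\<lambda>n. norm ((t ^ n / fact n) *\<^sub>R (D ^^ n) x))"
    using analytic[OF assms(1) _ assms(2)] by (simp add: power_abs)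
  then show "summable (\<lambda>n. (t ^ n / fact n) *\<^sub>R (D ^^ n) x)" by (rule summable_norm_cancel)
qed

lemma exp_sums: "x \<in> E \<Longrightarrow> \<bar>t\<bar> < r \<Longrightarrow> (\<lambda>n. (t ^ n / fact n) *\<^sub>R (D ^^ n) x) sums expD t x"
  unfolding expD_def by (intro summable_sums exp_summable)

lemma expD_add: "x \<in> E \<Longrightarrow> y \<in> E \<Longrightarrow> \<bar>t\<bar> < r \<Longrightarrow> expD t (x + y) = expD t x + expD t y"
  by (rule sums_unique2[OF exp_sums])
    (use sums_add[OF exp_sums exp_sums, of x t y t] in \<open>auto simp: Dn_add scaleR_add_right csubspaceD[OF E]\<close>)

lemma expD_scaleC: "x \<in> E \<Longrightarrow> \<bar>t\<bar> < r \<Longrightarrow> expD t (c *\<^sub>C x) = c *\<^sub>C expD t x"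
  by (rule sums_unique2[OF exp_sums])
    (use bounded_linear.sums[OF bounded_linear_scaleC exp_sums, of x t c] in \<open>auto simp: Dn_scaleC scaleC_scaleR csubspaceD[OF E]\<close>)

lemma skew_power:
  assumes "x \<in> E" "y \<in> E"
  shows "cinner ((D ^^ n) x) ((D ^^ m) y) = (-1) ^ m * cinner ((D ^^ (n + m)) x) y"
  using assms(2)
proof (induction m arbitrary: y)
  case (Suc m)
  have "cinner ((D ^^ n) x) ((D ^^ Suc m) y) = (-1) ^ m * cinner ((D ^^ (n + m)) x) (D y)"
    using Suc.IH[OF DE[OF Suc.prems]] by (simp add: funpow_swap1)
  also have "cinner ((D ^^ (n + m)) x) (D y) = - cinner (D ((D ^^ (n + m)) x)) y"
    using skew[OF DnE[OF assms(1)] Suc.prems] by simp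
  finally show ?case by simp
qed simp

text \<open>Expanding both exponentials and moving every power of \<open>D\<close> onto
  \<open>x\<close> changes the sign of \<open>t\<close> in one factor, so the double series is that
  of \<open>exp ((t - t) D)\<close> and only the term \<open>N = 0\<close> survives. Absolute
  convergence involves the weight \<open>2 * \<bar>t\<bar>\<close>, hence the bound
  \<open>r / 2\<close>.\<close>

lemma cinner_expD:
  assumes x: "x \<in> E" and y: "y \<in> E" and t: "\<bar>t\<bar> < r / 2"
  shows "cinner (expD t x) (expD t y) = cinner x y"
proof -
  have t': "\<bar>t\<bar> < r" using t r by simp
  let ?z = "\<lambda>N. cinner ((D ^^ N) x) y"
  have inn: "cinner (expD t x) ((D ^^ m) y) = (-1) ^ m * (\<Sum>n. (t ^ n / fact n) *\<^sub>R ?z (n + m))" for m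
  proof -
    have "(\<lambda>n. cinner ((t ^ n / fact n) *\<^sub>R (D ^^ n) x) ((D ^^ m) y)) sums cinner (expD t x) ((D ^^ m) y)"
      by (rule bounded_linear.sums[OF bounded_linear_cinner_left exp_sums[OF x t']])
    then have "(\<lambda>n. (-1) ^ m * ((t ^ n / fact n) *\<^sub>R ?z (n + m))) sums cinner (expD t x) ((D ^^ m) y)"
      by (simp add: cinner_scaleR_left skew_power[OF x y] scaleR_conv_of_real mult_ac)
    then have "(\<lambda>n. (-1) ^ m * ((-1) ^ m * ((t ^ n / fact n) *\<^sub>R ?z (n + m)))) sums ((-1) ^ m * cinner (expD t x) ((D ^^ m) y))"
      by (rule sums_mult)
    then have "(\<lambda>n. (t ^ n / fact n) *\<^sub>R ?z (n + m)) sums ((-1) ^ m * cinner (expD t x) ((D ^^ m) y))"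
      by (simp add: mult.assoc[symmetric] flip: power_add mult_2)
    then show ?thesis by (simp add: sums_iff mult.assoc[symmetric] flip: power_add mult_2)
  qed
  have sm: "summable (\<lambda>N. (\<bar>t\<bar> + \<bar>-t\<bar>) ^ N / fact N * norm (?z N))"
  proof (rule summable_comparison_test')
    show "summable (\<lambda>N. ((2 * \<bar>t\<bar>) ^ N / fact N * norm ((D ^^ N) x)) * norm y)"
      by (intro summable_mult2 analytic x) (use t in auto)
    show "norm ((\<bar>t\<bar> + \<bar>-t\<bar>) ^ N / fact N * norm (?z N)) \<le> ((2 * \<bar>t\<bar>) ^ N / fact N * norm ((D ^^ N) x)) * norm y" if "N \<ge> 0" for N
    proof -
      have "(2 * \<bar>t\<bar>) ^ N / fact N * norm (?z N) \<le> (2 * \<bar>t\<bar>) ^ N / fact N * (norm ((D ^^ N) x) * norm y)"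
        by (intro mult_left_mono norm_cinner_le) auto
      then show ?thesis by (simp add: mult.assoc abs_mult power_abs)
    qed
  qed
  have "(\<lambda>m. cinner (expD t x) ((t ^ m / fact m) *\<^sub>R (D ^^ m) y)) sums cinner (expD t x) (expD t y)"
    by (rule bounded_linear.sums[OF bounded_linear_cinner_right exp_sums[OF y t']])
  moreover have "cinner (expD t x) ((t ^ m / fact m) *\<^sub>R (D ^^ m) y)
      = ((-t) ^ m / fact m) *\<^sub>R (\<Sum>n. (t ^ n / fact n) *\<^sub>R ?z (n + m))" for m
    by (simp add: cinner_scaleR_right inn scaleR_conv_of_real power_minus[of t])
  ultimately have "(\<lambda>m. ((-t) ^ m / fact m) *\<^sub>R (\<Sum>n. (t ^ n / fact n) *\<^sub>R ?z (n + m))) sums cinner (expD t x) (expD t y)"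
    by simp
  then have "cinner (expD t x) (expD t y) = (\<Sum>N. ((t + - t) ^ N / fact N) *\<^sub>R ?z N)"
    using exp_double_series[OF sm] by (rule sums_unique2)
  also have "(\<lambda>N. ((t + - t) ^ N / fact N) *\<^sub>R ?z N) = (\<lambda>N. if N = 0 then ?z 0 else 0)"
    by (auto simp: fun_eq_iff power_0_left)
  also have "(\<Sum>N. if N = 0 then ?z 0 else 0) = ?z 0"
    using sums_single[of 0 "\<lambda>_. ?z 0"] by (auto simp: sums_iff)
  finally show ?thesis by simp
qed

lemma norm_expD: "x \<in> E \<Longrightarrow> \<bar>t\<bar> < r / 2 \<Longrightarrow> norm (expD t x) = norm x"
  using cinner_expD[of x x t] unfolding cinner_self of_real_eq_iff by (simp add: power2_eq_iff_nonneg)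

lemma deficiency:
  assumes u: "\<And>x. x \<in> E \<Longrightarrow> cinner (D x) u = of_real l * cinner x u" and l: "\<bar>l\<bar> = 1"
  shows "u = 0"
proof -
  \<comment> \<open>The sign \<open>l\<close> makes the exponent \<open>t * l = r / 4\<close>
    positive for both deficiency spaces, so the coefficient grows in either case.\<close>
  define t where "t = l * (r / 4)"
  have t: "\<bar>t\<bar> < r / 2" "\<bar>t\<bar> < r" "t * l = r / 4"
    using r l by (auto simp: t_def abs_mult) (metis abs_mult_self_eq mult_1)
  have pw: "cinner ((D ^^ n) x) u = of_real l ^ n * cinner x u" if "x \<in> E" for x n
    by (induction n) (simp_all add: u DnE that)
  have ex: "cinner (expD t x) u = of_real (exp (t * l)) * cinner x u" if x: "x \<in> E" for x
  proof -
    have "(\<lambda>n. cinner ((t ^ n / fact n) *\<^sub>R (D ^^ n) x) u) sums cinner (expD t x) u"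
      by (rule bounded_linear.sums[OF bounded_linear_cinner_left exp_sums[OF x t(2)]])
    moreover have "cinner ((t ^ n / fact n) *\<^sub>R (D ^^ n) x) u = of_real ((t * l) ^ n /\<^sub>R fact n) * cinner x u" for n
      by (simp add: cinner_scaleR_left pw[OF x] power_mult_distrib field_simps)
    moreover have "(\<lambda>n. of_real ((t * l) ^ n /\<^sub>R fact n) * cinner x u) sums (of_real (exp (t * l)) * cinner x u)"
      by (intro sums_mult2 sums_of_real exp_converges)
    ultimately show ?thesis by (simp add: sums_iff)
  qed
  have "exp (r / 4) * cmod (cinner x u) \<le> norm x * norm u" if x: "x \<in> E" for x
  proof -
    have "exp (r / 4) * cmod (cinner x u) = cmod (cinner (expD t x) u)"
      using ex[OF x] t(3) by (simp add: norm_mult)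
    also have "\<dots> \<le> norm (expD t x) * norm u" by (rule norm_cinner_le)
    finally show ?thesis using norm_expD[OF x t(1)] by simp
  qed
  \<comment> \<open>Both sides are continuous in \<open>x\<close>, so the estimate extends from
    \<open>E\<close> to its closure and may be tested at \<open>u\<close> itself.\<close>
  then have "E \<subseteq> {x. exp (r / 4) * cmod (cinner x u) \<le> norm x * norm u}" by blast
  moreover have "closed {x. exp (r / 4) * cmod (cinner x u) \<le> norm x * norm u}"
    by (intro closed_Collect_le continuous_intros bounded_linear.continuous_on[OF bounded_linear_cinner_left])
  ultimately have "closure E \<subseteq> {x. exp (r / 4) * cmod (cinner x u) \<le> norm x * norm u}" by (rule closure_minimal)
  then have "exp (r / 4) * cmod (cinner u u) \<le> norm u * norm u" using dense by blast
  then have le: "exp (r / 4) * (norm u)\<^sup>2 \<le> (norm u)\<^sup>2" by (simp add: cinner_self power2_eq_square norm_mult)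
  have "exp (r / 4) > 1" using r by simp
  show "u = 0"
  proof (rule ccontr)
    assume "u \<noteq> 0"
    then have "1 * (norm u)\<^sup>2 < exp (r / 4) * (norm u)\<^sup>2" by (intro mult_strict_right_mono) (use r in auto)
    then show False using le by simp
  qed
qed

text \<open>The bound \<open>r / 4\<close> leaves room twice: isometry asks for
  \<open>\<bar>t\<bar> < r / 2\<close>, and composing two exponentials asks for
  \<open>\<bar>s\<bar> + \<bar>t\<bar> < r\<close>.\<close>

lemma local_unitary:
  assumes "\<bar>t\<bar> \<le> r / 4"
  shows "\<exists>T. clinear_op T \<and> (\<forall>x\<in>E. blinfun_apply T x = expD t x) \<and> (\<forall>x. norm (blinfun_apply T x) = norm x)"
proof -
  have t: "\<bar>t\<bar> < r / 2" "\<bar>t\<bar> < r" using assms r by auto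
  obtain T where T: "clinear_op T" "\<And>x. x \<in> E \<Longrightarrow> blinfun_apply T x = expD t x"
    by (rule bounded_extension[OF E, of "expD t" 1])
      (use expD_add expD_scaleC norm_expD t in auto)
  have "closed {x. norm (blinfun_apply T x) = norm x}"
    by (intro closed_Collect_eq continuous_intros)
  then have "closure E \<subseteq> {x. norm (blinfun_apply T x) = norm x}"
    using norm_expD[OF _ t(1)] T(2) by (intro closure_minimal) auto
  then have "norm (blinfun_apply T x) = norm x" for x using dense by blast
  then show ?thesis using T by blast
qed

definition locU :: "real \<Rightarrow> 'b \<Rightarrow>\<^sub>L 'b" where
  "locU t = (SOME T. clinear_op T \<and> (\<forall>x\<in>E. blinfun_apply T x = expD t x) \<and> (\<forall>x. norm (blinfun_apply T x) = norm x))"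

lemma locU:
  assumes "\<bar>t\<bar> \<le> r / 4"
  shows "clinear_op (locU t)" "x \<in> E \<Longrightarrow> blinfun_apply (locU t) x = expD t x" "norm (blinfun_apply (locU t) x) = norm x"
  using someI_ex[OF local_unitary[OF assms]] by (auto simp: locU_def)

lemma locU_add:
  assumes s: "\<bar>s\<bar> \<le> r / 4" and t: "\<bar>t\<bar> \<le> r / 4" and st: "\<bar>s + t\<bar> \<le> r / 4"
  shows "locU (s + t) = locU s o\<^sub>L locU t"
proof (rule clinear_op_eq_on_dense[OF dense])
  fix x assume x: "x \<in> E"
  have t': "\<bar>t\<bar> < r" using t r by simp
  have "(\<lambda>m. blinfun_apply (locU s) ((t ^ m / fact m) *\<^sub>R (D ^^ m) x)) sums blinfun_apply (locU s) (expD t x)"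
    by (rule bounded_linear.sums[OF blinfun.bounded_linear_right exp_sums[OF x t']])
  moreover have "blinfun_apply (locU s) ((t ^ m / fact m) *\<^sub>R (D ^^ m) x)
     = (t ^ m / fact m) *\<^sub>R (\<Sum>n. (s ^ n / fact n) *\<^sub>R (D ^^ (n + m)) x)" for m
    by (simp add: blinfun.scaleR_right locU(2)[OF s DnE[OF x]] expD_def funpow_add)
  ultimately have "(\<lambda>m. (t ^ m / fact m) *\<^sub>R (\<Sum>n. (s ^ n / fact n) *\<^sub>R (D ^^ (n + m)) x)) sums blinfun_apply (locU s) (expD t x)"
    by simp
  moreover have "(\<lambda>m. (t ^ m / fact m) *\<^sub>R (\<Sum>n. (s ^ n / fact n) *\<^sub>R (D ^^ (n + m)) x)) sums expD (s + t) x"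
    unfolding expD_def by (rule exp_double_series, rule analytic[OF x]) (use s t r in auto)
  ultimately have "blinfun_apply (locU s) (expD t x) = expD (s + t) x" by (rule sums_unique2)
  then show "blinfun_apply (locU (s + t)) x = blinfun_apply (locU s o\<^sub>L locU t) x"
    by (simp add: locU(2)[OF st x] locU(2)[OF t x])
qed

lemma expD_0: "expD 0 x = x"
proof -
  have "(\<lambda>n. (0 ^ n / fact n) *\<^sub>R (D ^^ n) x) = (\<lambda>n. if n = 0 then x else 0)"
    by (auto simp: fun_eq_iff power_0_left)
  then show ?thesis unfolding expD_def
    using sums_single[of 0 "\<lambda>_. x"] by (auto simp: sums_iff)
qed

text \<open>For \<open>\<bar>t\<bar> \<le> \<rho>\<close> each term from \<open>n = 2\<close> on is
  at most \<open>(t / \<rho>)\<^sup>2\<close> times the bound for the term at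
  \<open>\<rho> = r / 2\<close>. The estimate yields both strong continuity at zero and the
  derivative \<open>D x\<close>.\<close>

lemma expD_quadratic:
  assumes x: "x \<in> E"
  shows "\<exists>C. \<forall>t. \<bar>t\<bar> \<le> r / 4 \<longrightarrow> norm (expD t x - x - t *\<^sub>R D x) \<le> C * t\<^sup>2"
proof -
  define \<rho> where "\<rho> = r / 2"
  have \<rho>: "\<rho> > 0" "\<rho> < r" using r by (auto simp: \<rho>_def)
  let ?a = "\<lambda>n. \<rho> ^ n / fact n * norm ((D ^^ n) x)"
  have sa: "summable ?a" by (rule analytic[OF x]) (use \<rho> in auto)
  have sa2: "summable (\<lambda>n. ?a (n + 2))" by (rule summable_iff_shift[THEN iffD2, OF sa])
  have "norm (expD t x - x - t *\<^sub>R D x) \<le> (\<Sum>n. ?a (n + 2)) / \<rho>\<^sup>2 * t\<^sup>2" if t: "\<bar>t\<bar> \<le> r / 4" for t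
  proof -
    have t': "\<bar>t\<bar> < r" "\<bar>t\<bar> \<le> \<rho>" using t r by (auto simp: \<rho>_def)
    let ?f = "\<lambda>n. (t ^ n / fact n) *\<^sub>R (D ^^ n) x"
    have "expD t x = (\<Sum>n. ?f (n + 2)) + (\<Sum>n<2. ?f n)"
      unfolding expD_def by (rule suminf_split_initial_segment[OF exp_summable(2)[OF x t'(1)]])
    also have "(\<Sum>n<2. ?f n) = x + t *\<^sub>R D x" by (simp add: eval_nat_numeral)
    finally have "expD t x - x - t *\<^sub>R D x = (\<Sum>n. ?f (n + 2))" by simp
    also have "norm \<dots> \<le> (\<Sum>n. (t\<^sup>2 / \<rho>\<^sup>2) * ?a (n + 2))"
    proof (rule norm_suminf_le)
      show "norm (?f (n + 2)) \<le> (t\<^sup>2 / \<rho>\<^sup>2) * ?a (n + 2)" for n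
      proof -
        have "\<bar>t\<bar> ^ (n + 2) \<le> t\<^sup>2 * \<rho> ^ n"
        proof -
          have "\<bar>t\<bar> ^ (n + 2) = t\<^sup>2 * \<bar>t\<bar> ^ n" by (simp add: power_add power2_eq_square)
          then show ?thesis using mult_left_mono[OF power_mono[OF t'(2), of n], of "t\<^sup>2"] by (simp only: abs_ge_zero zero_le_power2 simp_thms)
        qed
        also have "\<dots> = t\<^sup>2 / \<rho>\<^sup>2 * \<rho> ^ (n + 2)" using \<rho> by (simp add: power_add power2_eq_square)
        finally have "\<bar>t\<bar> ^ (n + 2) * (norm ((D ^^ (n+2)) x) / fact (n + 2)) \<le> t\<^sup>2 / \<rho>\<^sup>2 * \<rho> ^ (n + 2) * (norm ((D ^^ (n+2)) x) / fact (n + 2))"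
          by (rule mult_right_mono) simp
        then show ?thesis
          by (simp only: norm_scaleR real_norm_def abs_divide power_abs abs_of_nonneg[OF fact_ge_zero] times_divide_eq_left times_divide_eq_right)
      qed
      show "summable (\<lambda>n. (t\<^sup>2 / \<rho>\<^sup>2) * ?a (n + 2))" by (rule summable_mult[OF sa2])
    qed
    also have "\<dots> = (t\<^sup>2 / \<rho>\<^sup>2) * (\<Sum>n. ?a (n + 2))" by (rule suminf_mult[OF sa2])
    finally show ?thesis by (simp add: mult.commute)
  qed
  then show ?thesis by blast
qed

text \<open>Isometry is inherited from the local operators; the group law makes
  \<open>U (- t)\<close> a two-sided inverse, which for an isometry is the adjoint.\<close>

lemma unitary_group:
  obtains U where "\<And>t. clinear_op (U t)" "\<And>t x. norm (blinfun_apply (U t) x) = norm x"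
    "\<And>t. hadj (U t) = U (- t)" "U 0 = id_blinfun" "\<And>s t. U (s + t) = U s o\<^sub>L U t"
    "\<And>x t. x \<in> E \<Longrightarrow> \<bar>t\<bar> \<le> r / 4 \<Longrightarrow> blinfun_apply (U t) x = expD t x"
proof -
  have locU0: "locU 0 = id_blinfun"
    by (rule clinear_op_eq_on_dense[OF dense]) (use r in \<open>simp add: locU(2) expD_0\<close>)
  obtain V where V: "\<And>s t. V (s + t) = V s \<circ> V t" "\<And>t. \<bar>t\<bar> \<le> r/4 \<Longrightarrow> V t = blinfun_apply (locU t)"
    "\<And>t. \<exists>N s. \<bar>s\<bar> \<le> r/4 \<and> V t = blinfun_apply (locU s) ^^ N"
  proof (rule local_group_extension[of "r/4" "\<lambda>t. blinfun_apply (locU t)"])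
    show "blinfun_apply (locU (s + t)) = blinfun_apply (locU s) \<circ> blinfun_apply (locU t)"
      if "\<bar>s\<bar> \<le> r/4" "\<bar>t\<bar> \<le> r/4" "\<bar>s + t\<bar> \<le> r/4" for s t
      by (simp add: fun_eq_iff locU_add[OF that])
  qed (use r locU0 in \<open>auto simp: fun_eq_iff\<close>)
  have pw: "\<exists>T. clinear_op T \<and> (\<forall>x. norm (blinfun_apply T x) = norm x) \<and> blinfun_apply T = blinfun_apply (locU s) ^^ N"
    if s: "\<bar>s\<bar> \<le> r / 4" for s N
  proof (induction N)
    case 0
    show ?case by (rule exI[of _ id_blinfun]) auto
  next
    case (Suc N)
    then obtain T where "clinear_op T" "\<forall>x. norm (blinfun_apply T x) = norm x" "blinfun_apply T = blinfun_apply (locU s) ^^ N"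
      by blast
    then show ?case
      by (intro exI[of _ "locU s o\<^sub>L T"]) (auto simp: clinear_op_compose locU[OF s] fun_eq_iff)
  qed
  have "\<exists>T. clinear_op T \<and> (\<forall>x. norm (blinfun_apply T x) = norm x) \<and> blinfun_apply T = V t" for t
    using V(3)[of t] pw by metis
  then obtain U where U: "\<And>t. clinear_op (U t)" "\<And>t x. norm (blinfun_apply (U t) x) = norm x"
    "\<And>t. blinfun_apply (U t) = V t" by metis
  have U0: "U 0 = id_blinfun"
    using r \<open>locU 0 = id_blinfun\<close> by (intro blinfun_eqI) (simp add: U V(2))
  have Uadd: "U (s + t) = U s o\<^sub>L U t" for s t
    by (rule blinfun_eqI) (simp add: U V(1))
  have inv: "blinfun_apply (U t) (blinfun_apply (U (-t)) x) = x" for t x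
    using Uadd[of t "-t"] U0 by (metis add.right_inverse blinfun_apply_blinfun_compose blinfun_apply_id_blinfun id_apply)
  have "hadj (U t) = U (- t)" for t
  proof (rule hadj_unique[OF U(1)])
    show "cinner (blinfun_apply (U t) x) y = cinner x (blinfun_apply (U (- t)) y)" for x y
      using isometry_cinner[OF U(1,2), of t x "blinfun_apply (U (-t)) y"] by (simp only: inv)
  qed
  then show thesis
    using that[of U] U U0 Uadd V(2) locU(2) by auto
qed

end

section \<open>The generator of the unitary group and essential selfadjointness\<close>

locale analytic_skew_group = analytic_skew E D r for E D and r :: real +
  fixes U :: "real \<Rightarrow> 'a::chilbert_space \<Rightarrow>\<^sub>L 'a"
  assumes U_clinear: "clinear_op (U t)" and U_norm: "norm (blinfun_apply (U t) x) = norm x"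
    and U_adj: "hadj (U t) = U (- t)" and U_0: "U 0 = id_blinfun"
    and U_add: "U (s + t) = U s o\<^sub>L U t"
    and U_E: "x \<in> E \<Longrightarrow> \<bar>t\<bar> \<le> r / 4 \<Longrightarrow> blinfun_apply (U t) x = expD t x"
begin

lemma U_tendsto_0: "((\<lambda>t. blinfun_apply (U t) x) \<longlongrightarrow> x) (at 0)"
proof (rule tendsto_dense_isometry[OF U_norm dense])
  fix x assume x: "x \<in> E"
  obtain C where C: "\<And>t. \<bar>t\<bar> \<le> r / 4 \<Longrightarrow> norm (expD t x - x - t *\<^sub>R D x) \<le> C * t\<^sup>2"
    using expD_quadratic[OF x] by blast
  have "((\<lambda>t. blinfun_apply (U t) x - x - t *\<^sub>R D x) \<longlongrightarrow> 0) (at 0)"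
  proof (rule Lim_null_comparison)
    have "\<forall>\<^sub>F t in at 0. \<bar>t\<bar> < r / 4"
      using r by (auto simp: eventually_at dist_norm intro!: exI[of _ "r/4"])
    then show "\<forall>\<^sub>F t in at 0. norm (blinfun_apply (U t) x - x - t *\<^sub>R D x) \<le> C * t\<^sup>2"
      by eventually_elim (simp add: U_E[OF x] C)
    have "((\<lambda>t. C * t\<^sup>2) \<longlongrightarrow> C * 0\<^sup>2) (at 0)" by (intro tendsto_intros)
    then show "((\<lambda>t. C * t\<^sup>2) \<longlongrightarrow> 0) (at 0)" by simp
  qed
  moreover have "((\<lambda>t. x + t *\<^sub>R D x) \<longlongrightarrow> x + 0 *\<^sub>R D x) (at 0)" by (intro tendsto_intros)
  ultimately have "((\<lambda>t. (blinfun_apply (U t) x - x - t *\<^sub>R D x) + (x + t *\<^sub>R D x)) \<longlongrightarrow> 0 + (x + 0 *\<^sub>R D x)) (at 0)"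
    by (rule tendsto_add)
  then show "((\<lambda>t. blinfun_apply (U t) x) \<longlongrightarrow> x) (at 0)" by simp
qed

lemma U_continuous: "continuous_on UNIV (\<lambda>t. blinfun_apply (U t) x)"
  unfolding continuous_on_def
proof
  fix t :: real
  have "((\<lambda>s. blinfun_apply (U t) (blinfun_apply (U s) x)) \<longlongrightarrow> blinfun_apply (U t) x) (at 0)"
    by (rule bounded_linear.tendsto[OF blinfun.bounded_linear_right U_tendsto_0])
  then have "((\<lambda>s. blinfun_apply (U (s + t)) x) \<longlongrightarrow> blinfun_apply (U t) x) (at 0)"
    by (simp add: U_add[symmetric] add.commute flip: blinfun_apply_blinfun_compose)
  then show "((\<lambda>t. blinfun_apply (U t) x) \<longlongrightarrow> blinfun_apply (U t) x) (at t)"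
    by (subst at_to_0) (simp add: filterlim_filtermap)
qed

lemma U_quotient:
  assumes x: "x \<in> E"
  shows "((\<lambda>t. (blinfun_apply (U t) x - x) /\<^sub>R t) \<longlongrightarrow> D x) (at 0)"
proof -
  obtain C where C: "\<And>t. \<bar>t\<bar> \<le> r / 4 \<Longrightarrow> norm (expD t x - x - t *\<^sub>R D x) \<le> C * t\<^sup>2"
    using expD_quadratic[OF x] by blast
  have "((\<lambda>t. (blinfun_apply (U t) x - x) /\<^sub>R t - D x) \<longlongrightarrow> 0) (at 0)"
  proof (rule Lim_null_comparison)
    have "\<forall>\<^sub>F t in at 0. t \<noteq> 0 \<and> \<bar>t\<bar> < r / 4"
      using r by (auto simp: eventually_at dist_norm intro!: exI[of _ "r/4"])
    then show "\<forall>\<^sub>F t in at 0. norm ((blinfun_apply (U t) x - x) /\<^sub>R t - D x) \<le> C * \<bar>t\<bar>"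
    proof eventually_elim
      case (elim t)
      have "(blinfun_apply (U t) x - x) /\<^sub>R t - D x = (expD t x - x - t *\<^sub>R D x) /\<^sub>R t"
        using elim by (simp add: U_E[OF x] scaleR_diff_right)
      then have "norm ((blinfun_apply (U t) x - x) /\<^sub>R t - D x) = norm (expD t x - x - t *\<^sub>R D x) / \<bar>t\<bar>"
        by (simp add: divide_inverse mult.commute)
      also have "\<dots> \<le> C * t\<^sup>2 / \<bar>t\<bar>" using elim C[of t] by (intro divide_right_mono) auto
      also have "\<dots> = C * \<bar>t\<bar>" using elim by (simp add: power2_eq_square field_simps abs_if)
      finally show ?case .
    qed
    have "((\<lambda>t. C * \<bar>t\<bar>) \<longlongrightarrow> C * \<bar>0\<bar>) (at (0::real))" by (intro tendsto_intros)
    then show "((\<lambda>t. C * \<bar>t\<bar>) \<longlongrightarrow> 0) (at (0::real))" by simp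
  qed
  then show ?thesis by (rule LIM_zero_cancel)
qed

lemma U_derivative:
  assumes x: "x \<in> E"
  shows "((\<lambda>t. blinfun_apply (U t) x) has_vector_derivative blinfun_apply (U t) (D x)) (at t)"
proof -
  have "((\<lambda>s. blinfun_apply (U t) ((blinfun_apply (U s) x - x) /\<^sub>R s)) \<longlongrightarrow> blinfun_apply (U t) (D x)) (at 0)"
    by (rule bounded_linear.tendsto[OF blinfun.bounded_linear_right U_quotient[OF x]])
  then have "((\<lambda>s. (blinfun_apply (U (t + s)) x - blinfun_apply (U t) x) /\<^sub>R s) \<longlongrightarrow> blinfun_apply (U t) (D x)) (at 0)"
    by (simp add: U_add blinfun.diff_right blinfun.scaleR_right)
  then have "((\<lambda>s. norm ((blinfun_apply (U (t + s)) x - blinfun_apply (U t) x) /\<^sub>R s - blinfun_apply (U t) (D x))) \<longlongrightarrow> 0) (at 0)"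
    by (intro tendsto_norm_zero LIM_zero)
  moreover have "norm ((blinfun_apply (U (t + s)) x - blinfun_apply (U t) x) /\<^sub>R s - blinfun_apply (U t) (D x))
      = norm (blinfun_apply (U (t + s)) x - blinfun_apply (U t) x - s *\<^sub>R blinfun_apply (U t) (D x)) / norm s" if "s \<noteq> 0" for s
  proof -
    have "(blinfun_apply (U (t + s)) x - blinfun_apply (U t) x) /\<^sub>R s - blinfun_apply (U t) (D x)
        = (blinfun_apply (U (t + s)) x - blinfun_apply (U t) x - s *\<^sub>R blinfun_apply (U t) (D x)) /\<^sub>R s"
      using that by (simp add: scaleR_diff_right)
    then show ?thesis by (simp add: divide_inverse mult.commute)
  qed
  then have "\<forall>\<^sub>F s in at 0. norm ((blinfun_apply (U (t + s)) x - blinfun_apply (U t) x) /\<^sub>R s - blinfun_apply (U t) (D x))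
      = norm (blinfun_apply (U (t + s)) x - blinfun_apply (U t) x - s *\<^sub>R blinfun_apply (U t) (D x)) / norm s"
    by (simp add: eventually_at_filter)
  ultimately have "((\<lambda>s. norm (blinfun_apply (U (t + s)) x - blinfun_apply (U t) x - s *\<^sub>R blinfun_apply (U t) (D x)) / norm s) \<longlongrightarrow> 0) (at 0)"
    by (rule Lim_transform_eventually)
  then show ?thesis
    unfolding has_vector_derivative_def has_derivative_at by (auto intro: bounded_linear_scaleR_left)
qed

text \<open>Mean value inequality for \<open>s \<mapsto> U s x - s D x\<close>, whose derivative is
  \<open>U s (D x) - D x\<close>. The bound sees \<open>x\<close> only through \<open>D x\<close>,
  which lets it survive limits in the graph norm.\<close>

lemma U_increment:
  assumes x: "x \<in> E" and B: "\<And>s. \<bar>s\<bar> \<le> \<bar>t\<bar> \<Longrightarrow> norm (blinfun_apply (U s) (D x) - D x) \<le> B"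
  shows "norm (blinfun_apply (U t) x - x - t *\<^sub>R D x) \<le> B * \<bar>t\<bar>"
proof -
  let ?g = "\<lambda>s. blinfun_apply (U s) x - s *\<^sub>R D x"
  have "norm (?g t - ?g 0) \<le> B * norm (t - 0)"
  proof (rule differentiable_bound[where S="cball 0 \<bar>t\<bar>"])
    show "(?g has_derivative (\<lambda>h. h *\<^sub>R (blinfun_apply (U s) (D x) - D x))) (at s within cball 0 \<bar>t\<bar>)"
      if "s \<in> cball 0 \<bar>t\<bar>" for s
    proof -
      have "(?g has_vector_derivative (blinfun_apply (U s) (D x) - D x)) (at s)"
        by (intro has_vector_derivative_diff U_derivative[OF x]) (auto intro!: derivative_eq_intros)
      then show ?thesis unfolding has_vector_derivative_def by (rule has_derivative_at_withinI)
    qed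
    show "onorm (\<lambda>h. h *\<^sub>R (blinfun_apply (U s) (D x) - D x)) \<le> B" if "s \<in> cball 0 \<bar>t\<bar>" for s
    proof (rule onorm_le)
      show "norm (h *\<^sub>R (blinfun_apply (U s) (D x) - D x)) \<le> B * norm h" for h
        using mult_right_mono[OF B, of s "\<bar>h\<bar>"] that by (simp add: mult.commute)
    qed
  qed auto
  then show ?thesis by (simp add: U_0 algebra_simps)
qed

definition H0 :: "('a \<times> 'a) set" where "H0 = (\<lambda>x. (x, (- \<i>) *\<^sub>C D x)) ` E"

text \<open>Along a sequence converging in the graph, \<open>U_increment\<close> controls the
  difference quotients by the oscillation of \<open>U\<close> on the limit \<open>z\<close> of
  \<open>D (a n)\<close>, up to \<open>2 * norm (D (a n) - z)\<close> because \<open>U\<close> is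
  isometric. Letting \<open>n\<close> tend to infinity for fixed \<open>t\<close> removes the
  error.\<close>

lemma closure_H0_generator:
  assumes "(x, y) \<in> closure H0"
  shows "((\<lambda>t. (blinfun_apply (U t) x - x) /\<^sub>R t) \<longlongrightarrow> \<i> *\<^sub>C y) (at 0)"
proof -
  obtain p where p: "\<And>n. p n \<in> H0" "p \<longlonglongrightarrow> (x, y)" using assms unfolding closure_sequential by blast
  define a where "a n = fst (p n)" for n
  have a: "a n \<in> E" "p n = (a n, (- \<i>) *\<^sub>C D (a n))" for n
    using p(1)[of n] by (auto simp: a_def H0_def)
  have ax: "a \<longlonglongrightarrow> x" using tendsto_fst[OF p(2)] by (simp add: a(2))
  define z where "z = \<i> *\<^sub>C y"
  have "(\<lambda>n. (- \<i>) *\<^sub>C D (a n)) \<longlonglongrightarrow> y" using tendsto_snd[OF p(2)] by (simp add: a(2))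
  then have "(\<lambda>n. \<i> *\<^sub>C (- \<i>) *\<^sub>C D (a n)) \<longlonglongrightarrow> z"
    unfolding z_def by (rule bounded_linear.tendsto[OF bounded_linear_scaleC])
  then have Dz: "(\<lambda>n. D (a n)) \<longlonglongrightarrow> z" by (simp add: scaleC_scaleC)
  have "((\<lambda>t. (blinfun_apply (U t) x - x) /\<^sub>R t - z) \<longlongrightarrow> 0) (at 0)"
  proof (rule tendstoI)
    fix e :: real assume e: "e > 0"
    then obtain d where d: "d > 0" "\<And>s. s \<noteq> 0 \<Longrightarrow> dist s 0 < d \<Longrightarrow> dist (blinfun_apply (U s) z) z < e / 2"
      using tendstoD[OF U_tendsto_0[of z], of "e/2"] unfolding eventually_at by (metis half_gt_zero UNIV_I)
    have ds: "norm (blinfun_apply (U s) z - z) \<le> e / 2" if "\<bar>s\<bar> < d" for s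
      using d(2)[of s] that e by (cases "s = 0") (auto simp: U_0 dist_norm)
    have "norm (blinfun_apply (U t) x - x - t *\<^sub>R z) \<le> (e / 2) * \<bar>t\<bar>" if t: "\<bar>t\<bar> < d" for t
    proof (rule LIMSEQ_le)
      show "(\<lambda>n. norm (blinfun_apply (U t) (a n) - a n - t *\<^sub>R D (a n))) \<longlonglongrightarrow> norm (blinfun_apply (U t) x - x - t *\<^sub>R z)"
        by (intro tendsto_intros ax Dz)
      have "(\<lambda>n. (e / 2 + 2 * norm (D (a n) - z)) * \<bar>t\<bar>) \<longlonglongrightarrow> (e / 2 + 2 * norm (z - z)) * \<bar>t\<bar>"
        by (intro tendsto_intros Dz)
      then show "(\<lambda>n. (e / 2 + 2 * norm (D (a n) - z)) * \<bar>t\<bar>) \<longlonglongrightarrow> e / 2 * \<bar>t\<bar>" by simp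
      show "\<exists>N. \<forall>n\<ge>N. norm (blinfun_apply (U t) (a n) - a n - t *\<^sub>R D (a n)) \<le> (e / 2 + 2 * norm (D (a n) - z)) * \<bar>t\<bar>"
      proof (intro exI[of _ 0] allI impI U_increment a)
        fix n s assume s: "\<bar>s\<bar> \<le> \<bar>t\<bar>"
        let ?w = "D (a n) - z"
        have "blinfun_apply (U s) (D (a n)) - D (a n) = (blinfun_apply (U s) z - z) + blinfun_apply (U s) ?w - ?w"
          by (simp add: blinfun.diff_right)
        also have "norm \<dots> \<le> norm (blinfun_apply (U s) z - z) + norm (blinfun_apply (U s) ?w) + norm ?w"
          by (meson norm_triangle_ineq norm_triangle_ineq4 add_right_mono order_trans)
        also have "\<dots> \<le> e / 2 + 2 * norm ?w" using ds[of s] s t by (simp add: U_norm)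
        finally show "norm (blinfun_apply (U s) (D (a n)) - D (a n)) \<le> e / 2 + 2 * norm ?w" .
      qed
    qed
    note inc = this
    have "\<forall>\<^sub>F t in at 0. t \<noteq> 0 \<and> \<bar>t\<bar> < d"
      using d(1) by (auto simp: eventually_at dist_norm intro!: exI[of _ d])
    then show "\<forall>\<^sub>F t in at 0. dist ((blinfun_apply (U t) x - x) /\<^sub>R t - z) 0 < e"
    proof eventually_elim
      case (elim t)
      have "(blinfun_apply (U t) x - x) /\<^sub>R t - z = (blinfun_apply (U t) x - x - t *\<^sub>R z) /\<^sub>R t"
        using elim by (simp add: scaleR_diff_right)
      then have "norm ((blinfun_apply (U t) x - x) /\<^sub>R t - z) = norm (blinfun_apply (U t) x - x - t *\<^sub>R z) / \<bar>t\<bar>"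
        by (simp add: divide_inverse mult.commute)
      also have "\<dots> \<le> (e / 2) * \<bar>t\<bar> / \<bar>t\<bar>" using elim by (intro divide_right_mono inc) auto
      also have "\<dots> < e" using elim e by simp
      finally show ?case by simp
    qed
  qed
  then show ?thesis unfolding z_def by (rule LIM_zero_cancel)
qed

lemma adjoint_H0_iff:
  "(u, v) \<in> adjoint_graph H0 \<longleftrightarrow> (\<forall>x\<in>E. cinner (D x) u = \<i> * cinner x v)"
proof -
  have "cinner ((- \<i>) *\<^sub>C D x) u = cinner x v \<longleftrightarrow> cinner (D x) u = \<i> * cinner x v" for x
  proof -
    have "-\<i> * w = w' \<longleftrightarrow> w = \<i> * w'" for w w' :: complex
      by (auto simp flip: mult.assoc)
    then show ?thesis by (simp add: cinner_scaleC_left)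
  qed
  then show ?thesis by (auto simp: adjoint_graph_def H0_def)
qed

text \<open>Since the adjoint of \<open>U t\<close> is \<open>U (- t)\<close>, testing the
  difference quotient of \<open>x\<close> against \<open>a\<close> in \<open>E\<close> equals
  testing \<open>x\<close> against minus the quotient of \<open>a\<close> at \<open>- t\<close>,
  whose limit is known.\<close>

lemma generator_adjoint_H0:
  assumes "((\<lambda>t. (blinfun_apply (U t) x - x) /\<^sub>R t) \<longlongrightarrow> \<i> *\<^sub>C y) (at 0)"
  shows "(x, y) \<in> adjoint_graph H0"
  unfolding adjoint_H0_iff
proof
  fix a assume a: "a \<in> E"
  have l1: "((\<lambda>t. cinner ((blinfun_apply (U t) x - x) /\<^sub>R t) a) \<longlongrightarrow> cinner (\<i> *\<^sub>C y) a) (at 0)"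
    by (rule bounded_linear.tendsto[OF bounded_linear_cinner_left assms])
  have "((\<lambda>t. (blinfun_apply (U (-t)) a - a) /\<^sub>R (-t)) \<longlongrightarrow> D a) (at 0)"
  proof (rule filterlim_compose[OF U_quotient[OF a]])
    have "((\<lambda>t. - t) \<longlongrightarrow> - 0) (at (0::real))" by (intro tendsto_intros)
    then show "filterlim (\<lambda>t. - t) (at 0) (at (0::real))"
      by (auto simp: filterlim_at eventually_at_filter)
  qed
  then have "((\<lambda>t. cinner x (- ((blinfun_apply (U (-t)) a - a) /\<^sub>R (-t)))) \<longlongrightarrow> cinner x (- D a)) (at 0)"
    by (intro bounded_linear.tendsto[OF bounded_linear_cinner_right] tendsto_minus)
  moreover have "cinner x (- ((blinfun_apply (U (-t)) a - a) /\<^sub>R (-t))) = cinner ((blinfun_apply (U t) x - x) /\<^sub>R t) a" for t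
    by (simp add: cinner_scaleR_left cinner_scaleR_right cinner_diff_left cinner_diff_right cinner_hadj[OF U_clinear] U_adj)
  ultimately have "((\<lambda>t. cinner ((blinfun_apply (U t) x - x) /\<^sub>R t) a) \<longlongrightarrow> cinner x (- D a)) (at 0)" by simp
  then have "cinner (\<i> *\<^sub>C y) a = cinner x (- D a)" by (rule tendsto_unique[OF _ l1, rotated]) simp
  then have "\<i> * cinner y a = - cinner x (D a)" by (simp add: cinner_scaleC_left cinner_minus_right)
  then have "cnj (\<i> * cinner y a) = - cnj (cinner x (D a))" by simp
  then have "- \<i> * cinner a y = - cinner (D a) x" by (simp flip: cinner_commute)
  then show "cinner (D a) x = \<i> * cinner a y" by simp
qed

lemma closed_adjoint_graph:
  fixes G :: "('a \<times> 'a) set"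
  shows "closed (adjoint_graph G)"
proof -
  have "adjoint_graph G = (\<Inter>p\<in>G. {q. cinner (snd p) (fst q) = cinner (fst p) (snd q)})"
    by (fastforce simp: adjoint_graph_def)
  moreover have "closed {q. cinner (snd p) (fst q) = cinner (fst p) (snd q)}" for p :: "'a \<times> 'a"
    by (intro closed_Collect_eq bounded_linear.continuous_on[OF bounded_linear_cinner_right] continuous_intros)
  ultimately show ?thesis by (simp add: closed_INT)
qed

lemma closure_H0_le_adjoint: "closure H0 \<subseteq> adjoint_graph H0"
proof (rule closure_minimal[OF _ closed_adjoint_graph], rule subsetI)
  fix p assume "p \<in> H0"
  then obtain x where x: "x \<in> E" "p = (x, (- \<i>) *\<^sub>C D x)" by (auto simp: H0_def)
  show "p \<in> adjoint_graph H0"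
    unfolding x(2) adjoint_H0_iff
    using skew[OF _ x(1)] by (simp add: cinner_scaleC_right)
qed

text \<open>The range of \<open>1 - D\<close> is dense by \<open>deficiency\<close> with sign 1, and
  \<open>1 - D\<close> is bounded below because \<open>D x\<close> is orthogonal to \<open>x\<close>
  in the real sense. So \<open>u - \<i> v\<close> is approximated by \<open>a n - D (a n)\<close>
  with \<open>a\<close> Cauchy, which produces a graph point \<open>(x0, y0)\<close> of the closure;
  the rest \<open>u - x0\<close> is annihilated by \<open>deficiency\<close> with sign -1.\<close>

lemma adjoint_H0_le_closure: "adjoint_graph H0 \<subseteq> closure H0"
proof (rule subrelI)
  fix u v assume uv: "(u, v) \<in> adjoint_graph H0"
  let ?R = "(\<lambda>x. x - D x) ` E"
  have cR: "csubspace ?R"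
    unfolding csubspace_def
  proof (intro conjI ballI allI)
    have "D 0 = 0" using D_scaleC[of 0 0] csubspaceD(1)[OF E] by simp
    then have "0 = 0 - D 0" by simp
    then show "0 \<in> ?R" using csubspaceD(1)[OF E] by (rule image_eqI)
    show "p + q \<in> ?R" if "p \<in> ?R" "q \<in> ?R" for p q
    proof -
      obtain x y where "x \<in> E" "y \<in> E" "p = x - D x" "q = y - D y" using \<open>p \<in> ?R\<close> \<open>q \<in> ?R\<close> by blast
      then show ?thesis by (intro image_eqI[of _ _ "x + y"]) (auto simp: D_add csubspaceD[OF E])
    qed
    show "c *\<^sub>C p \<in> ?R" if "p \<in> ?R" for c p
    proof -
      obtain x where "x \<in> E" "p = x - D x" using \<open>p \<in> ?R\<close> by blast
      then show ?thesis by (intro image_eqI[of _ _ "c *\<^sub>C x"]) (auto simp: D_scaleC scaleC_diff_right csubspaceD[OF E])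
    qed
  qed
  have "closure ?R = UNIV"
    unfolding closure_eq_UNIV_iff_orthogonal[OF cR]
  proof (intro allI impI)
    fix w assume w: "\<forall>x\<in>?R. cinner x w = 0"
    show "w = 0"
      by (rule deficiency[of _ 1]) (use w in \<open>auto simp: cinner_diff_left\<close>)
  qed
  then have "u - \<i> *\<^sub>C v \<in> closure ?R" by simp
  then obtain q where q: "\<And>n. q n \<in> ?R" "q \<longlonglongrightarrow> u - \<i> *\<^sub>C v" unfolding closure_sequential by blast
  then have "\<forall>n. \<exists>x\<in>E. q n = x - D x" by blast
  then obtain a where a: "\<And>n. a n \<in> E" "\<And>n. q n = a n - D (a n)" by metis
  have nrm: "(norm (x - D x))\<^sup>2 = (norm x)\<^sup>2 + (norm (D x))\<^sup>2" if "x \<in> E" for x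
  proof -
    have "Re (cinner (D x) x) = - Re (cinner x (D x))" using skew[OF that that] by simp
    then have "inner (D x) x = 0" unfolding inner_eq_Re_cinner[symmetric] by (simp add: inner_commute)
    then show ?thesis by (simp add: power2_norm_eq_inner inner_diff_left inner_diff_right inner_commute)
  qed
  have D_diff: "D (x - y) = D x - D y" if "x \<in> E" "y \<in> E" for x y
    using D_add[of "x - y" y] csubspace_diff[OF E that] that by simp
  have le: "norm (a m - a n) \<le> norm (q m - q n)" for m n
  proof (rule power2_le_imp_le)
    have "q m - q n = (a m - a n) - D (a m - a n)" by (simp add: a D_diff)
    then show "(norm (a m - a n))\<^sup>2 \<le> (norm (q m - q n))\<^sup>2"
      using nrm[OF csubspace_diff[OF E a(1) a(1)], of m n] by simp
  qed simp
  have "Cauchy q" using q(2) by (rule LIMSEQ_imp_Cauchy)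
  then have "Cauchy a" unfolding Cauchy_def dist_norm using le by (meson le_less_trans)
  then obtain x0 where x0: "a \<longlonglongrightarrow> x0" using Cauchy_convergent convergent_def by blast
  have "(\<lambda>n. a n - q n) \<longlonglongrightarrow> x0 - (u - \<i> *\<^sub>C v)" by (intro tendsto_diff x0 q)
  then have Dl: "(\<lambda>n. D (a n)) \<longlonglongrightarrow> x0 - (u - \<i> *\<^sub>C v)" by (simp add: a)
  define y0 where "y0 = (- \<i>) *\<^sub>C (x0 - (u - \<i> *\<^sub>C v))"
  have "(\<lambda>n. (a n, (- \<i>) *\<^sub>C D (a n))) \<longlonglongrightarrow> (x0, y0)"
    unfolding y0_def by (intro tendsto_Pair x0 bounded_linear.tendsto[OF bounded_linear_scaleC] Dl)
  then have cl: "(x0, y0) \<in> closure H0"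
    unfolding closure_sequential using a(1) by (intro exI[of _ "\<lambda>n. (a n, (- \<i>) *\<^sub>C D (a n))"]) (auto simp: H0_def)
  then have "(x0, y0) \<in> adjoint_graph H0" using closure_H0_le_adjoint by blast
  then have d: "cinner (D x) (u - x0) = \<i> * cinner x (v - y0)" if "x \<in> E" for x
    using uv that unfolding adjoint_H0_iff by (simp add: cinner_diff_right right_diff_distrib)
  have vy: "v - y0 = (- \<i>) *\<^sub>C (u - x0)"
    by (simp add: y0_def scaleC_diff_right scaleC_minus_left scaleC_scaleC)
  have "u - x0 = 0"
    by (rule deficiency[of _ "-1"]) (auto simp: d vy cinner_scaleC_right)
  then have "u = x0" "v = y0" using vy by auto
  then show "(u, v) \<in> closure H0" using cl by simp
qed

text \<open>\<open>H\<close> may have a larger domain than \<open>E\<close>, on which no exponential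
  series is available. Symmetry gives \<open>H \<subseteq> adjoint_graph H \<subseteq> adjoint_graph
  H0 = closure H0\<close>, so the closures coincide.\<close>

theorem closure_selfadjoint_and_generates:
  fixes H :: "('a \<times> 'a) set"
  assumes H0H: "\<And>x. x \<in> E \<Longrightarrow> (x, (- \<i>) *\<^sub>C D x) \<in> H"
    and sym: "\<And>x y x' y'. (x, y) \<in> H \<Longrightarrow> (x', y') \<in> H \<Longrightarrow> cinner y x' = cinner x y'"
  shows "selfadjoint (closure H)" "is_unitary_exp (closure H) U"
proof -
  have sub: "H0 \<subseteq> H" using H0H by (auto simp: H0_def)
  have anti: "adjoint_graph B \<subseteq> adjoint_graph A" if "A \<subseteq> B" for A B :: "('a \<times> 'a) set"
    using that by (auto simp: adjoint_graph_def)
  have HadjH: "H \<subseteq> adjoint_graph H" using sym by (auto simp: adjoint_graph_def)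
  then have "H \<subseteq> adjoint_graph H0" using anti[OF sub] by blast
  then have "closure H \<subseteq> adjoint_graph H0" by (rule closure_minimal[OF _ closed_adjoint_graph])
  then have cl: "closure H = closure H0" "adjoint_graph H0 = closure H0"
    using adjoint_H0_le_closure closure_H0_le_adjoint closure_mono[OF sub] by auto
  have adj_cl: "adjoint_graph (closure H0) = adjoint_graph H0"
  proof
    show "adjoint_graph (closure H0) \<subseteq> adjoint_graph H0" by (rule anti[OF closure_subset])
    show "adjoint_graph H0 \<subseteq> adjoint_graph (closure H0)"
    proof (rule subrelI)
      fix u v assume uv: "(u, v) \<in> adjoint_graph H0"
      have "closed {q. cinner (snd q) u = cinner (fst q) v}"
        by (intro closed_Collect_eq bounded_linear.continuous_on[OF bounded_linear_cinner_left] continuous_intros)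
      then have "closure H0 \<subseteq> {q. cinner (snd q) u = cinner (fst q) v}"
        using uv by (intro closure_minimal) (auto simp: adjoint_graph_def)
      then show "(u, v) \<in> adjoint_graph (closure H0)" by (auto simp: adjoint_graph_def)
    qed
  qed
  have gen: "(x, y) \<in> closure H \<longleftrightarrow> ((\<lambda>t. (blinfun_apply (U t) x - x) /\<^sub>R t) \<longlongrightarrow> \<i> *\<^sub>C y) (at 0)" for x y
    using closure_H0_generator generator_adjoint_H0 cl by blast
  have mem: "(x, y) \<in> closure H \<longleftrightarrow> (\<forall>a\<in>E. cinner (D a) x = \<i> * cinner a y)" for x y
    by (simp add: cl adjoint_H0_iff flip: cl(2))
  have "op_graph (closure H)"
    unfolding op_graph_def
  proof (intro conjI allI impI)
    show "single_valued (closure H)"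
    proof (rule single_valuedI)
      fix x y z assume "(x, y) \<in> closure H" "(x, z) \<in> closure H"
      then have "\<i> *\<^sub>C y = \<i> *\<^sub>C z" unfolding gen by (rule tendsto_unique[rotated]) simp
      then have "(- \<i>) *\<^sub>C \<i> *\<^sub>C y = (- \<i>) *\<^sub>C \<i> *\<^sub>C z" by simp
      then show "y = z" by (simp add: scaleC_scaleC)
    qed
  qed (auto simp: mem cinner_add_right cinner_scaleC_right distrib_left)
  moreover have "closure (Domain (closure H)) = UNIV"
  proof -
    have "E \<subseteq> Domain (closure H)" using H0H closure_subset[of H] by blast
    then show ?thesis using dense closure_mono by blast
  qed
  ultimately show "selfadjoint (closure H)" by (simp add: selfadjoint_def cl adj_cl)
  have "adj (U t) o\<^sub>L U t = id_blinfun" "U t o\<^sub>L adj (U t) = id_blinfun" for t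
    using U_add[of t "-t"] U_add[of "-t" t] by (simp_all add: adj_eq_hadj[OF U_clinear] U_adj U_0)
  then show "is_unitary_exp (closure H) U"
    unfolding is_unitary_exp_def by (auto simp: bops_iff U_clinear U_0 U_add U_continuous gen)
qed

end

section \<open>Commutants\<close>

lemma blinfun_compose_assoc: "(R o\<^sub>L S) o\<^sub>L T = R o\<^sub>L (S o\<^sub>L T)"
  by (rule blinfun_eqI) simp

lemma commutantD: "T \<in> commutant S \<Longrightarrow> clinear_op T" "T \<in> commutant S \<Longrightarrow> A \<in> S \<Longrightarrow> T o\<^sub>L A = A o\<^sub>L T"
  by (auto simp: commutant_def bops_iff)

lemma commutantI: "clinear_op T \<Longrightarrow> (\<And>A. A \<in> S \<Longrightarrow> T o\<^sub>L A = A o\<^sub>L T) \<Longrightarrow> T \<in> commutant S"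
  by (auto simp: commutant_def bops_iff)

lemma commutant_apply: "T \<in> commutant S \<Longrightarrow> A \<in> S \<Longrightarrow> blinfun_apply T (blinfun_apply A x) = blinfun_apply A (blinfun_apply T x)"
  by (metis commutantD(2) blinfun_apply_blinfun_compose)

lemma commutant_antimono: "S \<subseteq> S' \<Longrightarrow> commutant S' \<subseteq> commutant S"
  by (auto simp: commutant_def)

lemma double_commutant_subset: "(\<And>x. x \<in> S \<Longrightarrow> clinear_op x) \<Longrightarrow> S \<subseteq> commutant (commutant S)"
  by (auto intro!: commutantI simp: commutantD)

lemma triple_commutant:
  assumes "\<And>x. x \<in> S \<Longrightarrow> clinear_op x" shows "commutant (commutant (commutant S)) = commutant S"
  using double_commutant_subset[of "commutant S"] commutant_antimono[OF double_commutant_subset[OF assms]]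
  by (auto simp: commutantD)

lemma commutant_plus: "S \<in> commutant G \<Longrightarrow> T \<in> commutant G \<Longrightarrow> S + T \<in> commutant G"
  by (auto intro!: commutantI blinfun_eqI simp: clinear_op_plus commutantD(1) blinfun.add_left blinfun.add_right commutant_apply)

lemma commutant_compose: "S \<in> commutant G \<Longrightarrow> T \<in> commutant G \<Longrightarrow> S o\<^sub>L T \<in> commutant G"
  by (auto intro!: commutantI blinfun_eqI simp: clinear_op_compose commutantD(1) commutant_apply)

lemma commutant_scale: "(\<And>x. x \<in> G \<Longrightarrow> clinear_op x) \<Longrightarrow> S \<in> commutant G \<Longrightarrow> op_scale c S \<in> commutant G"
  by (auto intro!: commutantI blinfun_eqI simp: clinear_op_scale commutantD(1) commutant_apply clinear_opD)

lemma commutant_id: "id_blinfun \<in> commutant G"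
  by (auto intro!: commutantI blinfun_eqI)

lemma commutant_hadj:
  assumes G: "\<And>x. x \<in> G \<Longrightarrow> clinear_op x" "\<And>x. x \<in> G \<Longrightarrow> hadj x \<in> G" and S: "S \<in> commutant G"
  shows "hadj S \<in> commutant G"
proof (rule commutantI)
  have cS: "clinear_op S" using S by (rule commutantD)
  then show "clinear_op (hadj S)" by (rule clinear_op_hadj)
  fix A assume A: "A \<in> G"
  have "hadj (S o\<^sub>L hadj A) = hadj (hadj A o\<^sub>L S)" using commutantD(2)[OF S G(2)[OF A]] by simp
  then show "hadj S o\<^sub>L A = A o\<^sub>L hadj S"
    using G(1)[OF A] cS by (simp add: hadj_compose clinear_op_hadj hadj_hadj)
qed

text \<open>Because \<open>G\<close> is closed under adjoints, an invariant subspace has an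
  invariant orthogonal complement, and the projection respects the decomposition.\<close>

lemma projection_in_commutant:
  assumes X: "csubspace X" "closed X" and G: "\<And>x. x \<in> G \<Longrightarrow> clinear_op x" "\<And>x. x \<in> G \<Longrightarrow> hadj x \<in> G"
    and inv: "\<And>x v. x \<in> G \<Longrightarrow> v \<in> X \<Longrightarrow> blinfun_apply x v \<in> X"
  obtains P where "P \<in> commutant G" "\<And>x. blinfun_apply P x \<in> X" "\<And>x. x \<in> X \<Longrightarrow> blinfun_apply P x = x"
proof -
  obtain P where P: "clinear_op P" "\<And>x. blinfun_apply P x \<in> X" "\<And>x y. y \<in> X \<Longrightarrow> cinner (x - blinfun_apply P x) y = 0"
    "\<And>y. y \<in> X \<Longrightarrow> blinfun_apply P y = y" "\<And>x. norm (blinfun_apply P x) \<le> norm x"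
    "\<And>x y. cinner (blinfun_apply P x) y = cinner x (blinfun_apply P y)"
    using orthogonal_projection_op[OF X] by metis
  have "P o\<^sub>L A = A o\<^sub>L P" if A: "A \<in> G" for A
  proof (rule blinfun_eqI)
    fix v
    have "cinner (blinfun_apply A (v - blinfun_apply P v)) y = 0" if "y \<in> X" for y
      using P(3)[OF inv[OF G(2)[OF A] that]] by (simp add: cinner_hadj[OF G(1)[OF A]])
    then have "cinner (blinfun_apply P (blinfun_apply A (v - blinfun_apply P v))) z = 0" for z
      using P(2,6) by metis
    then have "blinfun_apply P (blinfun_apply A (v - blinfun_apply P v)) = 0"
      by (metis cinner_self_eq_0)
    then have "blinfun_apply P (blinfun_apply A v) = blinfun_apply P (blinfun_apply A (blinfun_apply P v))"
      by (simp add: blinfun.diff_right)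
    then show "blinfun_apply (P o\<^sub>L A) v = blinfun_apply (A o\<^sub>L P) v"
      using P(4)[OF inv[OF A P(2)]] by simp
  qed
  then show thesis using that[of P] P by (auto intro: commutantI)
qed

section \<open>Normality\<close>

text \<open>Induction over the generation of the topology from its subbase; the result replaces
  sequences and infinite sums by finitely many pairs of vectors in \<open>ell2\<close> and one
  tolerance.\<close>

lemma ultraweak_neighbourhood:
  assumes "openin ultraweak_topology O'" "T \<in> O'"
  shows "\<exists>F e. finite F \<and> e > 0 \<and>
    (\<forall>T'. (\<forall>(f, g)\<in>F. cmod (cinner (ell2_map T' f) g - cinner (ell2_map T f) g) < e) \<longrightarrow> T' \<in> O')"
proof -
  let ?S = "{{T :: 'a \<Rightarrow>\<^sub>L 'a. (\<Sum>k. cinner (blinfun_apply T (\<xi> k)) (\<eta> k)) \<in> V} | \<xi> \<eta> V.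
        square_summable \<xi> \<and> square_summable \<eta> \<and> open V}"
  let ?N = "\<lambda>O' T. \<exists>F e. finite F \<and> e > 0 \<and>
    (\<forall>T'. (\<forall>(f, g)\<in>F. cmod (cinner (ell2_map T' f) g - cinner (ell2_map T f) g) < e) \<longrightarrow> T' \<in> O')"
  have "generate_topology_on ?S O'"
    using assms(1) by (simp add: ultraweak_topology_def openin_topology_generated_by_iff)
  then have "\<forall>T\<in>O'. ?N O' T"
  proof (induction rule: generate_topology_on.induct)
    case (Int a b)
    show ?case
    proof
      fix T assume "T \<in> a \<inter> b"
      then have "?N a T" "?N b T" using Int.IH by blast+
      then obtain F e F' e' where
        F: "finite F" "e > 0" "\<forall>T'. (\<forall>(f, g)\<in>F. cmod (cinner (ell2_map T' f) g - cinner (ell2_map T f) g) < e) \<longrightarrow> T' \<in> a" and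
        F': "finite F'" "e' > 0" "\<forall>T'. (\<forall>(f, g)\<in>F'. cmod (cinner (ell2_map T' f) g - cinner (ell2_map T f) g) < e') \<longrightarrow> T' \<in> b"
        by (elim exE conjE)
      show "?N (a \<inter> b) T"
      proof (rule exI[of _ "F \<union> F'"], rule exI[of _ "min e e'"], intro conjI allI impI)
        fix T' assume "\<forall>(f, g)\<in>F \<union> F'. cmod (cinner (ell2_map T' f) g - cinner (ell2_map T f) g) < min e e'"
        then have "\<forall>(f, g)\<in>F. cmod (cinner (ell2_map T' f) g - cinner (ell2_map T f) g) < e"
          "\<forall>(f, g)\<in>F'. cmod (cinner (ell2_map T' f) g - cinner (ell2_map T f) g) < e'" by auto
        then show "T' \<in> a \<inter> b" using F(3) F'(3) by blast
      qed (use F F' in auto)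
    qed
  next
    case (UN K)
    show ?case
    proof
      fix T assume "T \<in> \<Union>K"
      then obtain k where k: "k \<in> K" "T \<in> k" by blast
      then have "?N k T" using UN.IH by blast
      then show "?N (\<Union>K) T" using k(1) by blast
    qed
  next
    case (Basis s)
    then obtain \<xi> \<eta> V where s: "s = {T. (\<Sum>k. cinner (blinfun_apply T (\<xi> k)) (\<eta> k)) \<in> V}"
      "square_summable \<xi>" "square_summable \<eta>" "open V" by blast
    define f where "f = Abs_ell2 \<xi>"
    define g where "g = Abs_ell2 \<eta>"
    have nth: "ell2_nth f = \<xi>" "ell2_nth g = \<eta>"
      using s by (simp_all add: f_def g_def Abs_ell2_inverse square_summable_iff)
    have sum: "(\<Sum>k. cinner (blinfun_apply T (\<xi> k)) (\<eta> k)) = cinner (ell2_map T f) g" for T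
    proof -
      have "((\<lambda>k. cinner (ell2_nth (ell2_map T f) k) (ell2_nth g k)) has_sum cinner (ell2_map T f) g) UNIV"
        unfolding cinner_ell2_def by (rule has_sum_infsum[OF ell2_cinner_summable])
      from has_sum_imp_sums[OF this] show ?thesis by (simp add: nth ell2_map.rep_eq sums_iff)
    qed
    show ?case
    proof
      fix T assume "T \<in> s"
      then have "cinner (ell2_map T f) g \<in> V" by (simp add: s sum)
      then obtain e where e: "e > 0" "\<And>y. dist y (cinner (ell2_map T f) g) < e \<Longrightarrow> y \<in> V"
        using s(4) unfolding open_dist by metis
      then show "?N s T"
        by (intro exI[of _ "{(f, g)}"] exI[of _ e]) (auto simp: s sum dist_norm)
    qed
  qed simp
  then show ?thesis using assms(2) by blast
qed

text \<open>A single vector \<open>h\<close> controls all the functionals of a basic neighbourhood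
  at operators \<open>hadj x o\<^sub>L x\<close>, since \<open>cinner (x f) (x g)\<close> is at most
  the sum of the two squared norms.\<close>

lemma ell2_dominate:
  assumes "finite (F :: ('a::chilbert_space ell2 \<times> 'a ell2) set)"
  shows "\<exists>h :: 'a ell2. \<forall>(f, g)\<in>F. \<forall>T. (norm (ell2_map T f))\<^sup>2 + (norm (ell2_map T g))\<^sup>2 \<le> (norm (ell2_map T h))\<^sup>2"
  using assms
proof (induction F)
  case (insert p F)
  then obtain h where h: "\<forall>(f, g)\<in>F. \<forall>T. (norm (ell2_map T f))\<^sup>2 + (norm (ell2_map T g))\<^sup>2 \<le> (norm (ell2_map T h))\<^sup>2" by blast
  obtain f g where p: "p = (f, g)" by (cases p)
  obtain k where k: "\<forall>T. (norm (ell2_map T k))\<^sup>2 = (norm (ell2_map T f))\<^sup>2 + (norm (ell2_map T g))\<^sup>2"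
    using ell2_merge by blast
  obtain l where l: "\<forall>T. (norm (ell2_map T l))\<^sup>2 = (norm (ell2_map T k))\<^sup>2 + (norm (ell2_map T h))\<^sup>2"
    using ell2_merge by blast
  have "(norm (ell2_map T f'))\<^sup>2 + (norm (ell2_map T g'))\<^sup>2 \<le> (norm (ell2_map T l))\<^sup>2"
    if "(f', g') \<in> insert p F" for f' g' T
  proof (cases "(f', g') \<in> F")
    case True
    then have "(norm (ell2_map T f'))\<^sup>2 + (norm (ell2_map T g'))\<^sup>2 \<le> (norm (ell2_map T h))\<^sup>2" using h by blast
    then show ?thesis using l[rule_format, of T] zero_le_power2[of "norm (ell2_map T k)"] by linarith
  next
    case False
    then have "f' = f" "g' = g" using that p by auto
    then show ?thesis using k[rule_format, of T] l[rule_format, of T] zero_le_power2[of "norm (ell2_map T h)"] by simp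
  qed
  then show ?case by blast
qed auto

text \<open>Meant for \<open>f m\<close> the norm of \<open>a ^ m\<close> applied to a vector, with
  \<open>a\<close> symmetric. Iterating the square inequality bounds the \<open>2 ^ k\<close>-th
  power of \<open>f 1 / f 0\<close> by \<open>f (2 ^ k) / f 0\<close>; after taking roots the
  constant \<open>C\<close> disappears in the limit.\<close>

lemma power_iteration_bound:
  fixes f :: "nat \<Rightarrow> real"
  assumes nn: "\<And>m. f m \<ge> 0" and sq: "\<And>m. (f m)\<^sup>2 \<le> f (2 * m) * f 0"
    and bd: "\<And>m. f m \<le> C * r ^ m" and r: "r \<ge> 0"
  shows "f 1 \<le> r * f 0"
proof (cases "f 0 = 0")
  case True
  then show ?thesis using sq[of 1] by simp
next
  case False
  then have f0: "f 0 > 0" using nn[of 0] by simp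
  define g where "g m = f m / f 0" for m
  have g0: "g m \<ge> 0" for m using nn f0 by (simp add: g_def)
  have g2: "(g m)\<^sup>2 \<le> g (2 * m)" for m
    using sq[of m] f0 by (simp add: g_def power2_eq_square field_simps)
  have gp: "g 1 ^ (2 ^ k) \<le> g (2 ^ k)" for k
  proof (induction k)
    case (Suc k)
    have "g 1 ^ (2 ^ Suc k) = (g 1 ^ (2 ^ k))\<^sup>2" by (simp add: power_mult[symmetric] mult.commute)
    also have "\<dots> \<le> (g (2 ^ k))\<^sup>2" using Suc g0 by (intro power_mono) auto
    also have "\<dots> \<le> g (2 ^ Suc k)" using g2 by simp
    finally show ?case .
  qed simp
  have gb: "g 1 ^ (2 ^ k) \<le> C / f 0 * r ^ (2 ^ k)" for k
  proof -
    have "g (2 ^ k) \<le> C * r ^ (2 ^ k) / f 0" unfolding g_def using bd f0 by (intro divide_right_mono) auto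
    then show ?thesis using gp[of k] by simp
  qed
  have "g 1 \<le> r"
  proof (rule ccontr)
    assume "\<not> g 1 \<le> r"
    then have gr: "g 1 > r" by simp
    show False
    proof (cases "r = 0")
      case True
      then show ?thesis using gb[of 0] gr by simp
    next
      case False
      then have rp: "r > 0" using r by simp
      then have q: "g 1 / r > 1" using gr by simp
      \<comment> \<open>If the ratio exceeded one, its powers would outgrow the fixed constant
        \<open>C / f 0\<close>.\<close>
      then obtain n where n: "C / f 0 < (g 1 / r) ^ n" using real_arch_pow by blast
      also have "\<dots> \<le> (g 1 / r) ^ (2 ^ n)" using q by (intro power_increasing) (auto intro: less_imp_le)
      also have "\<dots> \<le> C / f 0" using gb[of n] rp by (simp add: power_divide field_simps)
      finally show False by simp
    qed
  qed
  then show ?thesis using f0 by (simp add: g_def field_simps)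
qed

section \<open>The standard representation of a tracial von Neumann algebra\<close>

locale tracial_vN =
  fixes M :: "('a::chilbert_space \<Rightarrow>\<^sub>L 'a) set" and \<tau> :: "('a \<Rightarrow>\<^sub>L 'a) \<Rightarrow> complex"
    and \<Lambda> :: "('a \<Rightarrow>\<^sub>L 'a) \<Rightarrow> 'b::chilbert_space"
  assumes vN: "von_neumann_algebra M" and trace: "normal_faithful_trace_state M \<tau>"
    and L2: "is_L2_space M \<tau> \<Lambda>"
begin

lemma M_clinear: "x \<in> M \<Longrightarrow> clinear_op x"
  using vN by (auto simp: von_neumann_algebra_def bops_iff)

lemma M_double: "commutant (commutant M) = M"
  using vN by (simp add: von_neumann_algebra_def)

lemma M_hadj: "x \<in> M \<Longrightarrow> hadj x \<in> M"
  using vN M_clinear adj_eq_hadj by (metis von_neumann_algebra_def)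

lemma M_plus: "x \<in> M \<Longrightarrow> y \<in> M \<Longrightarrow> x + y \<in> M"
  and M_compose: "x \<in> M \<Longrightarrow> y \<in> M \<Longrightarrow> x o\<^sub>L y \<in> M"
  and M_scale: "x \<in> M \<Longrightarrow> op_scale c x \<in> M"
  and M_id: "id_blinfun \<in> M"
  using commutant_plus[of x "commutant M" y] commutant_compose[of x "commutant M" y]
    commutant_scale[of "commutant M" x c] commutant_id[of "commutant M"]
  by (simp_all add: M_double commutantD)

lemma M_minus: "x \<in> M \<Longrightarrow> y \<in> M \<Longrightarrow> x - y \<in> M"
proof -
  assume "x \<in> M" "y \<in> M"
  moreover have "x - y = x + op_scale (-1) y" by (rule blinfun_eqI) (simp add: blinfun.add_left blinfun.diff_left scaleC_minus_left)
  ultimately show ?thesis by (simp only: M_plus M_scale)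
qed

lemma M_zero: "0 \<in> M"
  using M_minus[OF M_id M_id] by simp

lemma M_sum: "(\<And>i. i \<in> A \<Longrightarrow> f i \<in> M) \<Longrightarrow> sum f A \<in> M"
  by (induction A rule: infinite_finite_induct) (auto simp: M_zero M_plus)

lemma M_closed: "closed M"
proof -
  have "M = (\<Inter>A\<in>commutant M. {T. T o\<^sub>L A = A o\<^sub>L T}) \<inter> (\<Inter>c. \<Inter>x. {T. blinfun_apply T (c *\<^sub>C x) = c *\<^sub>C blinfun_apply T x})"
  proof -
    have "T \<in> M \<longleftrightarrow> clinear_op T \<and> (\<forall>A\<in>commutant M. T o\<^sub>L A = A o\<^sub>L T)" for T
      using commutantD[of T "commutant M"] commutantI[of T "commutant M"] unfolding M_double by blast
    then show ?thesis by (auto simp: clinear_op_def)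
  qed
  moreover have "closed {T. T o\<^sub>L A = A o\<^sub>L T}" for A :: "'a \<Rightarrow>\<^sub>L 'a"
    by (intro closed_Collect_eq bounded_linear.continuous_on[OF bounded_bilinear.bounded_linear_left[OF bounded_bilinear_blinfun_compose]] bounded_linear.continuous_on[OF bounded_bilinear.bounded_linear_right[OF bounded_bilinear_blinfun_compose]] continuous_intros)
  moreover have "closed {T :: 'a \<Rightarrow>\<^sub>L 'a. blinfun_apply T (c *\<^sub>C x) = c *\<^sub>C blinfun_apply T x}" for c x
    by (intro closed_Collect_eq bounded_linear.continuous_on[OF bounded_linear_scaleC] bounded_linear.continuous_on[OF blinfun.bounded_linear_left] continuous_intros)
  ultimately show ?thesis by (metis (no_types, lifting) closed_INT closed_Int)
qed

lemma \<Lambda>_add: "x \<in> M \<Longrightarrow> y \<in> M \<Longrightarrow> \<Lambda> (x + y) = \<Lambda> x + \<Lambda> y"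
  and \<Lambda>_scale: "x \<in> M \<Longrightarrow> \<Lambda> (op_scale c x) = c *\<^sub>C \<Lambda> x"
  and \<Lambda>_dense: "closure (\<Lambda> ` M) = UNIV"
  using L2 by (auto simp: is_L2_space_def)

lemma cinner_\<Lambda>: "x \<in> M \<Longrightarrow> y \<in> M \<Longrightarrow> cinner (\<Lambda> x) (\<Lambda> y) = \<tau> (hadj y o\<^sub>L x)"
  using L2 by (simp add: is_L2_space_def M_clinear adj_eq_hadj)

lemma \<Lambda>_diff: "x \<in> M \<Longrightarrow> y \<in> M \<Longrightarrow> \<Lambda> (x - y) = \<Lambda> x - \<Lambda> y"
  using \<Lambda>_add[of "x - y" y] by (simp add: M_minus)

lemma \<Lambda>_zero: "\<Lambda> 0 = 0"
  using \<Lambda>_diff[OF M_zero M_zero] by simp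

lemma \<Lambda>_eq_0: assumes "x \<in> M" "\<Lambda> x = 0" shows "x = 0"
proof -
  have "\<tau> (hadj x o\<^sub>L x) = 0" using cinner_\<Lambda>[of x x] assms by simp
  then show ?thesis using trace assms(1) by (simp add: normal_faithful_trace_state_def adj_eq_hadj M_clinear)
qed

lemma \<Lambda>_inj: "inj_on \<Lambda> M"
  by (rule inj_onI) (metis M_minus \<Lambda>_diff \<Lambda>_eq_0 eq_iff_diff_eq_0)

lemma \<Lambda>_csubspace: "csubspace (\<Lambda> ` M)"
  unfolding csubspace_def
proof (intro conjI ballI allI)
  show "0 \<in> \<Lambda> ` M" using M_zero \<Lambda>_zero by (metis imageI)
  show "u + v \<in> \<Lambda> ` M" if "u \<in> \<Lambda> ` M" "v \<in> \<Lambda> ` M" for u v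
    using that by (auto simp flip: \<Lambda>_add intro!: imageI M_plus)
  show "c *\<^sub>C u \<in> \<Lambda> ` M" if "u \<in> \<Lambda> ` M" for c u
    using that by (auto simp flip: \<Lambda>_scale intro!: imageI M_scale)
qed

lemma \<Lambda>_orthogonal: "(\<And>x. x \<in> M \<Longrightarrow> cinner (\<Lambda> x) v = 0) \<Longrightarrow> v = 0"
  using closure_eq_UNIV_iff_orthogonal[OF \<Lambda>_csubspace] \<Lambda>_dense by blast

lemma cinner_\<Lambda>_move:
  "x \<in> M \<Longrightarrow> z \<in> M \<Longrightarrow> w \<in> M \<Longrightarrow> cinner (\<Lambda> (x o\<^sub>L z)) (\<Lambda> w) = cinner (\<Lambda> z) (\<Lambda> (hadj x o\<^sub>L w))"
  by (simp add: cinner_\<Lambda> M_compose M_hadj hadj_compose hadj_hadj clinear_op_hadj M_clinear blinfun_compose_assoc)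

text \<open>Ultraweak continuity of the trace at zero, applied to \<open>hadj x o\<^sub>L x\<close>,
  says that \<open>norm (\<Lambda> x) < 1\<close> as soon as
  \<open>(norm (ell2_map x h))\<^sup>2 < e\<close>. Homogeneity turns this into an inequality of
  norms, and \<open>1 / sqrt e\<close> rescales \<open>h\<close>.\<close>

lemma \<Lambda>_ultrastrong_bound:
  "\<exists>\<zeta> :: 'a ell2. \<forall>x\<in>M. norm (\<Lambda> x) \<le> norm (ell2_map x \<zeta>)"
proof -
  have \<tau>0: "\<tau> 0 = 0"
    using cinner_\<Lambda>[OF M_zero M_id] by (simp add: \<Lambda>_zero)
  have cont: "continuous_map (subtopology ultraweak_topology M) euclidean \<tau>"
    using trace by (simp add: normal_faithful_trace_state_def)
  have "openin (subtopology ultraweak_topology M) {x \<in> topspace (subtopology ultraweak_topology M). \<tau> x \<in> ball 0 1}"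
    by (rule openin_continuous_map_preimage[OF cont]) simp
  then obtain O' where O': "openin ultraweak_topology O'"
    "{x \<in> topspace (subtopology ultraweak_topology M). \<tau> x \<in> ball 0 1} = O' \<inter> M"
    unfolding openin_subtopology by blast
  have "(0 :: 'a \<Rightarrow>\<^sub>L 'a) \<in> topspace ultraweak_topology"
    unfolding ultraweak_topology_def topology_generated_by_topspace
    by (rule UnionI[of UNIV]) (auto intro!: exI[of _ "\<lambda>_. 0"] exI[of _ UNIV] simp: square_summable_def)
  then have "0 \<in> {x \<in> topspace (subtopology ultraweak_topology M). \<tau> x \<in> ball 0 1}"
    by (simp add: topspace_subtopology M_zero \<tau>0)
  then have "0 \<in> O'" unfolding O'(2) by blast
  from ultraweak_neighbourhood[OF O'(1) this] obtain F e where F: "finite F" "e > 0"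
    "\<And>T'. (\<forall>(f, g)\<in>F. cmod (cinner (ell2_map T' f) g - cinner (ell2_map 0 f) g) < e) \<Longrightarrow> T' \<in> O'"
    by blast
  obtain h where h: "\<forall>(f, g)\<in>F. \<forall>T. (norm (ell2_map T f))\<^sup>2 + (norm (ell2_map T g))\<^sup>2 \<le> (norm (ell2_map T h))\<^sup>2"
    using ell2_dominate[OF F(1)] by blast
  have map0: "ell2_map 0 f = (0 :: 'a ell2)" for f
    by (rule ell2_eqI) (simp add: ell2_map.rep_eq zero_ell2.rep_eq)
  have small: "(norm (\<Lambda> x))\<^sup>2 < 1" if x: "x \<in> M" and lt: "(norm (ell2_map x h))\<^sup>2 < e" for x
  proof -
    have "hadj x o\<^sub>L x \<in> O'"
    proof (rule F(3), clarify)
      fix f g assume fg: "(f, g) \<in> F"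
      have "cinner (ell2_map (hadj x o\<^sub>L x) f) g = cinner (ell2_map x f) (ell2_map x g)"
        using cinner_ell2_map[OF clinear_op_hadj[OF M_clinear[OF x]]]
        by (simp add: ell2_map_simps hadj_hadj[OF M_clinear[OF x]])
      then have "cmod (cinner (ell2_map (hadj x o\<^sub>L x) f) g) \<le> norm (ell2_map x f) * norm (ell2_map x g)"
        by (simp add: norm_cinner_le)
      also have "\<dots> \<le> (norm (ell2_map x f))\<^sup>2 + (norm (ell2_map x g))\<^sup>2" by (rule l2_product_bound)
      also have "\<dots> \<le> (norm (ell2_map x h))\<^sup>2" using h fg by blast
      finally show "cmod (cinner (ell2_map (hadj x o\<^sub>L x) f) g - cinner (ell2_map 0 f) g) < e"
        using lt by (simp add: map0)
    qed
    then have "hadj x o\<^sub>L x \<in> O' \<inter> M" using x by (simp add: M_compose M_hadj)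
    then have "cmod (\<tau> (hadj x o\<^sub>L x)) < 1" unfolding O'(2)[symmetric] by simp
    moreover have "\<tau> (hadj x o\<^sub>L x) = of_real ((norm (\<Lambda> x))\<^sup>2)"
      unfolding cinner_\<Lambda>[OF x x, symmetric] by (rule cinner_self)
    ultimately show ?thesis by (simp only: norm_of_real abs_of_nonneg zero_le_power2)
  qed
  have "norm (\<Lambda> x) \<le> norm (ell2_map x ((1 / sqrt e) *\<^sub>C h))" if x: "x \<in> M" for x
  proof (rule ccontr)
    define p where "p = norm (\<Lambda> x)"
    define q where "q = norm (ell2_map x h)"
    assume "\<not> ?thesis"
    then have "q / sqrt e < p" using F(2)
      by (simp add: p_def q_def ell2_map_scaleC[OF M_clinear[OF x]] norm_divide)
    then have qp: "q < p * sqrt e" using F(2) by (simp add: field_simps)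
    have "q \<ge> 0" by (simp add: q_def)
    then have "p * sqrt e > 0" using qp by simp
    then have p: "p > 0" using F(2) by (simp add: zero_less_mult_iff)
    \<comment> \<open>Normalized so that \<open>\<Lambda> ?y\<close> has norm exactly one, in
      conflict with \<open>small\<close>.\<close>
    let ?y = "op_scale (of_real (1 / p)) x"
    have y: "?y \<in> M" by (rule M_scale[OF x])
    have "norm (ell2_map ?y h) = q / p" using p by (simp add: ell2_map_simps q_def norm_divide)
    then have "(norm (ell2_map ?y h))\<^sup>2 = (q / p)\<^sup>2" by simp
    also have "q / p < sqrt e" using qp p by (simp add: field_simps)
    then have "(q / p)\<^sup>2 < (sqrt e)\<^sup>2" using \<open>q \<ge> 0\<close> p by (intro power_strict_mono) auto
    also have "(sqrt e)\<^sup>2 = e" using F(2) by simp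
    finally have "(norm (\<Lambda> ?y))\<^sup>2 < 1" by (rule small[OF y])
    moreover have "norm (\<Lambda> ?y) = 1" using p by (simp add: \<Lambda>_scale[OF x] norm_divide flip: p_def)
    ultimately show False by simp
  qed
  then show ?thesis by blast
qed

end

section \<open>Left multiplication on the standard space and intertwiners\<close>

context tracial_vN
begin

lemma \<Lambda>_bounded: "\<exists>C. \<forall>x\<in>M. norm (\<Lambda> x) \<le> C * norm x"
proof -
  obtain \<zeta> :: "'a ell2" where "\<forall>x\<in>M. norm (\<Lambda> x) \<le> norm (ell2_map x \<zeta>)"
    using \<Lambda>_ultrastrong_bound by blast
  then have "\<forall>x\<in>M. norm (\<Lambda> x) \<le> norm \<zeta> * norm x"
    using norm_ell2_map_le by (metis mult.commute order_trans)
  then show ?thesis by blast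
qed

text \<open>By normality \<open>\<Lambda> x\<close> is the image of \<open>x \<zeta>\<close> under a bounded operator \<open>S\<close> on \<open>\<ell>\<^sup>2\<close> sequences;
  the adjoint of \<open>S\<close> intertwines the two actions of \<open>M\<close>.\<close>

lemma intertwiners_exist:
  obtains T :: "nat \<Rightarrow> 'b \<Rightarrow>\<^sub>L 'a" where "\<And>k. clinear_op (T k)"
    "\<And>k x y. x \<in> M \<Longrightarrow> y \<in> M \<Longrightarrow> blinfun_apply (T k) (\<Lambda> (x o\<^sub>L y)) = blinfun_apply x (blinfun_apply (T k) (\<Lambda> y))"
    "\<And>v. (\<And>k. blinfun_apply (T k) v = 0) \<Longrightarrow> v = 0"
proof -
  obtain \<zeta> :: "'a ell2" where \<zeta>: "\<And>x. x \<in> M \<Longrightarrow> norm (\<Lambda> x) \<le> norm (ell2_map x \<zeta>)"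
    using \<Lambda>_ultrastrong_bound by blast
  let ?X = "(\<lambda>x. ell2_map x \<zeta>) ` M"
  \<comment> \<open>The choice is immaterial: the bound by \<open>\<zeta>\<close> applied to a
    difference shows that \<open>\<Lambda> x\<close> depends only on
    \<open>ell2_map x \<zeta>\<close>.\<close>
  define f where "f h = \<Lambda> (SOME x. x \<in> M \<and> ell2_map x \<zeta> = h)" for h
  have map0: "ell2_map 0 \<zeta> = 0" by (rule ell2_eqI) (simp add: ell2_map.rep_eq zero_ell2.rep_eq)
  have map_diff: "ell2_map (x - y) \<zeta> = ell2_map x \<zeta> - ell2_map y \<zeta>" for x y
    by (rule ell2_eqI) (simp add: ell2_map.rep_eq ell2_nth_minus blinfun.diff_left)
  have f: "f (ell2_map x \<zeta>) = \<Lambda> x" if x: "x \<in> M" for x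
  proof -
    define y where "y = (SOME y. y \<in> M \<and> ell2_map y \<zeta> = ell2_map x \<zeta>)"
    have y: "y \<in> M" "ell2_map y \<zeta> = ell2_map x \<zeta>"
      unfolding y_def using someI[of "\<lambda>y. y \<in> M \<and> ell2_map y \<zeta> = ell2_map x \<zeta>" x] x by auto
    have "norm (\<Lambda> (y - x)) \<le> 0" using \<zeta>[OF M_minus[OF y(1) x]] by (simp add: map_diff y(2))
    then have "\<Lambda> y = \<Lambda> x" using \<Lambda>_diff[OF y(1) x] by simp
    then show ?thesis by (simp add: f_def y_def)
  qed
  have X: "csubspace ?X"
    unfolding csubspace_def
  proof (intro conjI ballI allI)
    show "0 \<in> ?X" using M_zero map0 by (metis imageI)
    show "u + v \<in> ?X" if "u \<in> ?X" "v \<in> ?X" for u v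
      using that by (auto simp flip: ell2_map_simps(1) intro!: imageI M_plus)
    show "c *\<^sub>C u \<in> ?X" if "u \<in> ?X" for c u
      using that by (auto simp flip: ell2_map_simps(3) intro!: imageI M_scale)
  qed
  obtain S where S: "clinear_op S" "\<And>h. h \<in> ?X \<Longrightarrow> blinfun_apply S h = f h"
    "\<And>z. (\<And>h. h \<in> ?X \<Longrightarrow> cinner z h = 0) \<Longrightarrow> blinfun_apply S z = 0"
  proof (rule bounded_extension[OF X, of f 1])
    show "f (u + v) = f u + f v" if "u \<in> ?X" "v \<in> ?X" for u v
      using that by (auto simp: f \<Lambda>_add M_plus simp flip: ell2_map_simps(1))
    show "f (c *\<^sub>C u) = c *\<^sub>C f u" if "u \<in> ?X" for c u
      using that by (auto simp: f \<Lambda>_scale M_scale simp flip: ell2_map_simps(3))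
    show "norm (f u) \<le> 1 * norm u" if "u \<in> ?X" for u
      using that by (auto simp: f \<zeta>)
  qed blast
  have S\<Lambda>: "blinfun_apply S (ell2_map x \<zeta>) = \<Lambda> x" if "x \<in> M" for x
    using S(2) f that by simp
  define T where "T = hadj S"
  have cT: "clinear_op T" unfolding T_def by (rule clinear_op_hadj[OF S(1)])
  have adj: "cinner h (blinfun_apply T v) = cinner (blinfun_apply S h) v" for h v
    by (simp add: T_def cinner_hadj[OF S(1)])
  have int: "blinfun_apply T (\<Lambda> (x o\<^sub>L y)) = ell2_map x (blinfun_apply T (\<Lambda> y))" if x: "x \<in> M" and y: "y \<in> M" for x y
  proof -
    \<comment> \<open>The defect \<open>v\<close> is orthogonal to \<open>?X\<close>, and so is
      \<open>hadj x\<close> applied to it, because \<open>?X\<close> is invariant under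
      \<open>x\<close>. Hence \<open>S\<close> kills both vectors, and expanding one side of
      \<open>cinner v v\<close> through the adjoint relation gives zero.\<close>
    define v where "v = blinfun_apply T (\<Lambda> (x o\<^sub>L y)) - ell2_map x (blinfun_apply T (\<Lambda> y))"
    have cx: "clinear_op x" "clinear_op (hadj x)" using M_clinear[OF x] clinear_op_hadj by auto
    have move: "cinner h (ell2_map x (blinfun_apply T (\<Lambda> y))) = cinner (blinfun_apply S (ell2_map (hadj x) h)) (\<Lambda> y)" for h
      using cinner_ell2_map[OF cx(2), of h "blinfun_apply T (\<Lambda> y)"] by (simp add: hadj_hadj[OF cx(1)] adj)
    have vX: "cinner h v = 0" if hX: "h \<in> ?X" for h
    proof -
      obtain z where z: "z \<in> M" "h = ell2_map z \<zeta>" using hX by blast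
      have "cinner h (ell2_map x (blinfun_apply T (\<Lambda> y))) = cinner (\<Lambda> (hadj x o\<^sub>L z)) (\<Lambda> y)"
        unfolding move z(2) ell2_map_simps(4)[symmetric] by (simp only: S\<Lambda> M_compose M_hadj x z)
      also have "\<dots> = cinner (\<Lambda> z) (\<Lambda> (x o\<^sub>L y))"
        using cinner_\<Lambda>_move[OF M_hadj[OF x] z(1) y] by (simp add: hadj_hadj[OF cx(1)])
      also have "\<dots> = cinner h (blinfun_apply T (\<Lambda> (x o\<^sub>L y)))"
        by (simp add: adj z S\<Lambda>)
      finally show ?thesis by (simp add: v_def cinner_diff_right)
    qed
    have vo: "cinner v h = 0" if "h \<in> ?X" for h using vX[OF that] by (metis cinner_commute complex_cnj_zero)
    have "blinfun_apply S v = 0" by (rule S(3)[OF vo])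
    moreover have "blinfun_apply S (ell2_map (hadj x) v) = 0"
    proof (rule S(3))
      fix h assume "h \<in> ?X"
      then obtain z where z: "z \<in> M" "h = ell2_map z \<zeta>" by blast
      have "cinner (ell2_map (hadj x) v) h = cinner v (ell2_map (x o\<^sub>L z) \<zeta>)"
        using cinner_ell2_map[OF cx(2), of v h] by (simp add: hadj_hadj[OF cx(1)] z ell2_map_simps)
      also have "\<dots> = 0" by (rule vo) (use x z M_compose in blast)
      finally show "cinner (ell2_map (hadj x) v) h = 0" .
    qed
    ultimately have "cinner v v = 0"
    proof -
      assume 0: "blinfun_apply S v = 0" "blinfun_apply S (ell2_map (hadj x) v) = 0"
      have "cinner v (blinfun_apply T (\<Lambda> (x o\<^sub>L y)) - ell2_map x (blinfun_apply T (\<Lambda> y))) = 0"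
        by (simp only: cinner_diff_right adj move 0 cinner_zero_left diff_self)
      then show ?thesis by (simp only: v_def)
    qed
    then show ?thesis by (simp add: cinner_self_eq_0 v_def)
  qed
  have inj: "v = 0" if "blinfun_apply T v = 0" for v
  proof (rule \<Lambda>_orthogonal)
    show "cinner (\<Lambda> x) v = 0" if "x \<in> M" for x
      using adj[of "ell2_map x \<zeta>" v] \<open>blinfun_apply T v = 0\<close> by (simp add: S\<Lambda>[OF that])
  qed
  show thesis
  proof (rule that[of "\<lambda>k. ell2_proj k o\<^sub>L T"])
    show "clinear_op (ell2_proj k o\<^sub>L T)" for k
      using cT by (simp add: clinear_op_def scaleC_ell2.rep_eq)
    show "blinfun_apply (ell2_proj k o\<^sub>L T) (\<Lambda> (x o\<^sub>L y)) = blinfun_apply x (blinfun_apply (ell2_proj k o\<^sub>L T) (\<Lambda> y))"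
      if "x \<in> M" "y \<in> M" for k x y
      by (simp add: int[OF that] ell2_map.rep_eq)
    show "v = 0" if "\<And>k. blinfun_apply (ell2_proj k o\<^sub>L T) v = 0" for v
      by (rule inj, rule ell2_eqI) (use that in \<open>simp add: zero_ell2.rep_eq\<close>)
  qed
qed

text \<open>Left multiplication by \<open>a = hadj x o\<^sub>L x\<close> is symmetric for the trace
  inner product, and \<open>\<Lambda>_bounded\<close> gives a crude bound for its powers on
  \<open>\<Lambda> y\<close>. \<open>power_iteration_bound\<close> then removes the constant,
  leaving \<open>norm a\<close>, at most the square of \<open>norm x\<close>.\<close>

lemma norm_\<Lambda>_compose:
  assumes x: "x \<in> M" and y: "y \<in> M"
  shows "norm (\<Lambda> (x o\<^sub>L y)) \<le> norm x * norm (\<Lambda> y)"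
proof -
  obtain C' where C': "\<And>x. x \<in> M \<Longrightarrow> norm (\<Lambda> x) \<le> C' * norm x" using \<Lambda>_bounded by blast
  define C where "C = \<bar>C'\<bar>"
  have C0: "C \<ge> 0" by (simp add: C_def)
  have C: "norm (\<Lambda> x) \<le> C * norm x" if "x \<in> M" for x
    by (rule order_trans[OF C'[OF that] mult_right_mono]) (auto simp: C_def)
  define a where "a = hadj x o\<^sub>L x"
  have a: "a \<in> M" "hadj a = a"
    using x by (simp_all add: a_def M_compose M_hadj hadj_compose hadj_hadj clinear_op_hadj M_clinear)
  define p where "p m = ((\<lambda>z. a o\<^sub>L z) ^^ m) y" for m
  have pM: "p m \<in> M" for m by (induction m) (auto simp: p_def y M_compose a)
  have pS: "p (Suc m) = a o\<^sub>L p m" for m by (simp add: p_def)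
  have mv: "cinner (\<Lambda> (p (n + m))) (\<Lambda> (p k)) = cinner (\<Lambda> (p n)) (\<Lambda> (p (k + m)))" for n m k
  proof (induction m arbitrary: k)
    case (Suc m)
    have "cinner (\<Lambda> (p (n + Suc m))) (\<Lambda> (p k)) = cinner (\<Lambda> (p (n + m))) (\<Lambda> (p (Suc k)))"
      using cinner_\<Lambda>_move[OF a(1) pM pM, of "n + m" k] by (simp add: pS a(2))
    then show ?case by (simp add: Suc)
  qed simp
  define f where "f m = norm (\<Lambda> (p m))" for m
  have sq: "(f m)\<^sup>2 \<le> f (2 * m) * f 0" for m
  proof -
    have "complex_of_real ((f m)\<^sup>2) = cinner (\<Lambda> (p (2 * m))) (\<Lambda> (p 0))"
      using mv[of m m 0] unfolding f_def cinner_self[symmetric] by (simp add: mult_2)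
    then have "(f m)\<^sup>2 = cmod (cinner (\<Lambda> (p (2 * m))) (\<Lambda> (p 0)))"
      by (metis norm_of_real abs_of_nonneg zero_le_power2)
    then show ?thesis using norm_cinner_le[of "\<Lambda> (p (2 * m))" "\<Lambda> (p 0)"] by (simp add: f_def)
  qed
  have "norm (p m) \<le> norm a ^ m * norm y" for m
  proof (induction m)
    case (Suc m)
    have "norm (p (Suc m)) \<le> norm a * norm (p m)" unfolding pS by (rule norm_blinfun_compose)
    also have "\<dots> \<le> norm a * (norm a ^ m * norm y)" using Suc by (intro mult_left_mono) auto
    finally show ?case by (simp add: mult.assoc)
  qed (simp add: p_def)
  note pb = this
  have bd: "f m \<le> (C * norm y) * norm a ^ m" for m
  proof -
    have "f m \<le> C * (norm a ^ m * norm y)"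
      unfolding f_def by (rule order_trans[OF C[OF pM] mult_left_mono[OF pb C0]])
    then show ?thesis by (simp only: mult_ac)
  qed
  have f1: "f 1 \<le> norm a * f 0"
    by (rule power_iteration_bound[OF _ sq bd]) (auto simp: f_def)
  have "(norm (\<Lambda> (x o\<^sub>L y)))\<^sup>2 = cmod (cinner (\<Lambda> (p 0)) (\<Lambda> (p 1)))"
  proof -
    have "cinner (\<Lambda> (x o\<^sub>L y)) (\<Lambda> (x o\<^sub>L y)) = cinner (\<Lambda> (p 0)) (\<Lambda> (p 1))"
      using cinner_\<Lambda>_move[OF x y M_compose[OF x y]] by (simp add: p_def a_def blinfun_compose_assoc)
    then show ?thesis by (metis cinner_self norm_of_real abs_of_nonneg zero_le_power2)
  qed
  also have "\<dots> \<le> f 0 * f 1" unfolding f_def by (rule norm_cinner_le)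
  also have "\<dots> \<le> f 0 * (norm a * f 0)" using f1 by (intro mult_left_mono) (auto simp: f_def)
  also have "\<dots> \<le> f 0 * ((norm x * norm x) * f 0)"
  proof -
    have "norm a \<le> norm x * norm x" unfolding a_def
      by (rule order_trans[OF norm_blinfun_compose mult_right_mono[OF norm_hadj_le]]) simp
    then show ?thesis by (intro mult_left_mono mult_right_mono) (auto simp: f_def)
  qed
  also have "\<dots> = (norm x * norm (\<Lambda> y))\<^sup>2" by (simp add: f_def p_def power2_eq_square)
  finally show ?thesis by (rule power2_le_imp_le) simp
qed

abbreviation lm :: "('a \<Rightarrow>\<^sub>L 'a) \<Rightarrow> ('b \<Rightarrow>\<^sub>L 'b)" where "lm \<equiv> left_mult M \<Lambda>"

lemma left_mult_ex:
  assumes x: "x \<in> M"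
  shows "\<exists>T. clinear_op T \<and> (\<forall>y\<in>M. blinfun_apply T (\<Lambda> y) = \<Lambda> (x o\<^sub>L y)) \<and> norm T \<le> norm x"
proof -
  define f where "f h = \<Lambda> (x o\<^sub>L inv_into M \<Lambda> h)" for h
  have f: "f (\<Lambda> y) = \<Lambda> (x o\<^sub>L y)" if "y \<in> M" for y
    using that by (simp add: f_def inv_into_f_f[OF \<Lambda>_inj])
  obtain T where T: "clinear_op T" "\<And>h. h \<in> \<Lambda> ` M \<Longrightarrow> blinfun_apply T h = f h"
    "\<And>h. norm (blinfun_apply T h) \<le> \<bar>norm x\<bar> * norm h"
  proof (rule bounded_extension[OF \<Lambda>_csubspace, of f "norm x"])
    show "f (u + v) = f u + f v" if "u \<in> \<Lambda> ` M" "v \<in> \<Lambda> ` M" for u v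
    proof -
      obtain y z where yz: "y \<in> M" "z \<in> M" "u = \<Lambda> y" "v = \<Lambda> z" using \<open>u \<in> \<Lambda> ` M\<close> \<open>v \<in> \<Lambda> ` M\<close> by blast
      have "f (u + v) = \<Lambda> (x o\<^sub>L (y + z))" using yz by (simp add: f M_plus flip: \<Lambda>_add)
      also have "x o\<^sub>L (y + z) = (x o\<^sub>L y) + (x o\<^sub>L z)" by (rule blinfun_eqI) (simp add: blinfun.add_left blinfun.add_right)
      also have "\<Lambda> \<dots> = f u + f v" using yz x by (simp add: f \<Lambda>_add M_compose)
      finally show ?thesis .
    qed
    show "f (c *\<^sub>C u) = c *\<^sub>C f u" if "u \<in> \<Lambda> ` M" for c u
    proof -
      have "x o\<^sub>L op_scale c y = op_scale c (x o\<^sub>L y)" for y by (rule blinfun_eqI) (simp add: clinear_opD[OF M_clinear[OF x]])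
      then show ?thesis using that x by (auto simp: f M_scale M_compose \<Lambda>_scale[symmetric])
    qed
    show "norm (f u) \<le> norm x * norm u" if "u \<in> \<Lambda> ` M" for u
      using that by (auto simp: f norm_\<Lambda>_compose[OF x])
  qed blast
  have "norm T \<le> norm x" by (rule norm_blinfun_bound) (use T(3) in auto)
  then show ?thesis using T f by auto
qed

lemma left_mult:
  assumes x: "x \<in> M"
  shows "clinear_op (lm x)" "y \<in> M \<Longrightarrow> blinfun_apply (lm x) (\<Lambda> y) = \<Lambda> (x o\<^sub>L y)" "norm (lm x) \<le> norm x"
proof -
  obtain T where T: "clinear_op T" "\<forall>y\<in>M. blinfun_apply T (\<Lambda> y) = \<Lambda> (x o\<^sub>L y)" "norm T \<le> norm x"
    using left_mult_ex[OF x] by blast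
  have "lm x = T"
    unfolding left_mult_def
  proof (rule the_equality)
    show "T \<in> bops \<and> (\<forall>y\<in>M. blinfun_apply T (\<Lambda> y) = \<Lambda> (x o\<^sub>L y))" using T by (simp add: bops_iff)
    fix S assume "S \<in> bops \<and> (\<forall>y\<in>M. blinfun_apply S (\<Lambda> y) = \<Lambda> (x o\<^sub>L y))"
    then show "S = T" by (intro clinear_op_eq_on_dense[OF \<Lambda>_dense]) (use T in auto)
  qed
  then show "clinear_op (lm x)" "y \<in> M \<Longrightarrow> blinfun_apply (lm x) (\<Lambda> y) = \<Lambda> (x o\<^sub>L y)" "norm (lm x) \<le> norm x"
    using T by auto
qed

lemma left_mult_hadj:
  assumes x: "x \<in> M" shows "hadj (lm x) = lm (hadj x)"
proof -
  have eq: "cinner (\<Lambda> y) (blinfun_apply (hadj (lm x)) v) = cinner (\<Lambda> y) (blinfun_apply (lm (hadj x)) v)" if y: "y \<in> M" for y v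
  proof -
    have "closed {v. cinner (blinfun_apply (lm x) (\<Lambda> y)) v = cinner (\<Lambda> y) (blinfun_apply (lm (hadj x)) v)}"
      by (intro closed_Collect_eq bounded_linear.continuous_on[OF bounded_linear_cinner_right] continuous_intros)
    moreover have "\<Lambda> ` M \<subseteq> {v. cinner (blinfun_apply (lm x) (\<Lambda> y)) v = cinner (\<Lambda> y) (blinfun_apply (lm (hadj x)) v)}"
      using cinner_\<Lambda>_move[OF x y] by (auto simp: left_mult x y M_hadj)
    ultimately have "closure (\<Lambda> ` M) \<subseteq> {v. cinner (blinfun_apply (lm x) (\<Lambda> y)) v = cinner (\<Lambda> y) (blinfun_apply (lm (hadj x)) v)}"
      by (rule closure_minimal[rotated])
    then show ?thesis unfolding \<Lambda>_dense cinner_hadj[OF left_mult(1)[OF x], symmetric] by blast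
  qed
  show ?thesis
  proof (rule blinfun_eqI)
    fix v
    have "blinfun_apply (hadj (lm x)) v - blinfun_apply (lm (hadj x)) v = 0"
      by (rule \<Lambda>_orthogonal) (simp add: cinner_diff_right eq)
    then show "blinfun_apply (hadj (lm x)) v = blinfun_apply (lm (hadj x)) v" by simp
  qed
qed

definition intertwiner :: "('b \<Rightarrow>\<^sub>L 'a) \<Rightarrow> bool" where
  "intertwiner W \<longleftrightarrow> clinear_op W \<and> (\<forall>x\<in>M. \<forall>v. blinfun_apply W (blinfun_apply (lm x) v) = blinfun_apply x (blinfun_apply W v))"

lemma intertwinerD:
  assumes "intertwiner W"
  shows "clinear_op W" "x \<in> M \<Longrightarrow> blinfun_apply W (blinfun_apply (lm x) v) = blinfun_apply x (blinfun_apply W v)"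
  using assms by (auto simp: intertwiner_def)

lemma separating_intertwiners:
  obtains T :: "nat \<Rightarrow> 'b \<Rightarrow>\<^sub>L 'a" where "\<And>k. intertwiner (T k)"
    "\<And>v. (\<And>k. blinfun_apply (T k) v = 0) \<Longrightarrow> v = 0"
proof -
  obtain T :: "nat \<Rightarrow> 'b \<Rightarrow>\<^sub>L 'a" where T: "\<And>k. clinear_op (T k)"
    "\<And>k x y. x \<in> M \<Longrightarrow> y \<in> M \<Longrightarrow> blinfun_apply (T k) (\<Lambda> (x o\<^sub>L y)) = blinfun_apply x (blinfun_apply (T k) (\<Lambda> y))"
    "\<And>v. (\<And>k. blinfun_apply (T k) v = 0) \<Longrightarrow> v = 0"
    using intertwiners_exist by blast
  have "T k o\<^sub>L lm x = x o\<^sub>L T k" if x: "x \<in> M" for k x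
    by (rule clinear_op_eq_on_dense[OF \<Lambda>_dense]) (auto simp: left_mult x T(2))
  then have "intertwiner (T k)" for k
    unfolding intertwiner_def using T(1) by (metis blinfun_apply_blinfun_compose)
  then show thesis using that T(3) by blast
qed

lemma intertwiner_hadj:
  assumes W: "intertwiner W" and x: "x \<in> M"
  shows "blinfun_apply (hadj W) (blinfun_apply x h) = blinfun_apply (lm x) (blinfun_apply (hadj W) h)"
proof (rule cinner_eqI_right)
  fix v
  have "cinner v (blinfun_apply (hadj W) (blinfun_apply x h)) = cinner (blinfun_apply W v) (blinfun_apply x h)"
    by (simp add: cinner_hadj intertwinerD[OF W])
  also have "\<dots> = cinner (blinfun_apply (hadj x) (blinfun_apply W v)) h"
    by (simp add: cinner_hadj_left M_clinear x)
  also have "\<dots> = cinner (blinfun_apply W (blinfun_apply (hadj (lm x)) v)) h"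
    by (simp add: intertwinerD[OF W] M_hadj x left_mult_hadj)
  also have "\<dots> = cinner v (blinfun_apply (lm x) (blinfun_apply (hadj W) h))"
    by (simp add: cinner_hadj[OF intertwinerD(1)[OF W]] cinner_hadj_left left_mult x)
  finally show "cinner v (blinfun_apply (hadj W) (blinfun_apply x h)) = cinner v (blinfun_apply (lm x) (blinfun_apply (hadj W) h))" .
qed

text \<open>For \<open>Q\<close> commuting with the image of \<open>G\<close>, the operators
  \<open>T k o\<^sub>L Q o\<^sub>L hadj (T l)\<close> act on the given space and commute with
  \<open>G\<close>, hence with \<open>x\<close>. As the \<open>T k\<close> separate vectors, they
  cancel on both sides. Thus generation of \<open>M\<close> by \<open>G\<close> is transported to
  \<open>L2\<close>.\<close>

lemma left_mult_in_double_commutant: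
  assumes G: "G \<subseteq> M" "commutant (commutant G) = M" and x: "x \<in> M"
  shows "lm x \<in> commutant (commutant (lm ` G))"
proof (rule commutantI)
  show "clinear_op (lm x)" by (rule left_mult[OF x])
  fix Q assume Q: "Q \<in> commutant (lm ` G)"
  obtain T :: "nat \<Rightarrow> 'b \<Rightarrow>\<^sub>L 'a" where T: "\<And>k. intertwiner (T k)"
    "\<And>v. (\<And>k. blinfun_apply (T k) v = 0) \<Longrightarrow> v = 0"
    using separating_intertwiners by blast
  have cT: "clinear_op (T k)" "clinear_op (hadj (T k))" for k
    using intertwinerD(1)[OF T(1)] clinear_op_hadj by auto
  have TQT: "T k o\<^sub>L Q o\<^sub>L hadj (T l) \<in> commutant G" for k l
  proof (rule commutantI)
    show "clinear_op (T k o\<^sub>L Q o\<^sub>L hadj (T l))" using cT commutantD(1)[OF Q] by (simp add: clinear_op_compose)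
    fix A assume A: "A \<in> G"
    then have AM: "A \<in> M" using G by blast
    show "(T k o\<^sub>L Q o\<^sub>L hadj (T l)) o\<^sub>L A = A o\<^sub>L (T k o\<^sub>L Q o\<^sub>L hadj (T l))"
      by (rule blinfun_eqI) (simp add: intertwiner_hadj[OF T(1) AM] commutant_apply[OF Q imageI[OF A]] intertwinerD(2)[OF T(1) AM])
  qed
  have xcc: "x \<in> commutant (commutant G)" using x G by simp
  define Z where "Z = (lm x o\<^sub>L Q) - (Q o\<^sub>L lm x)"
  have cZ: "clinear_op Z" unfolding Z_def
    by (intro clinear_op_minus clinear_op_compose left_mult x commutantD(1)[OF Q])
  have Z0: "blinfun_apply (T k) (blinfun_apply Z (blinfun_apply (hadj (T l)) h)) = 0" for k l h
  proof -
    have "blinfun_apply x (blinfun_apply (T k o\<^sub>L Q o\<^sub>L hadj (T l)) h) = blinfun_apply (T k o\<^sub>L Q o\<^sub>L hadj (T l)) (blinfun_apply x h)"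
      by (rule commutant_apply[OF xcc TQT])
    then show ?thesis
      by (simp add: Z_def blinfun.diff_left blinfun.diff_right intertwinerD(2)[OF T(1) x] intertwiner_hadj[OF T(1) x])
  qed
  have "blinfun_apply Z (blinfun_apply (hadj (T l)) h) = 0" for l h by (rule T(2)[OF Z0])
  \<comment> \<open>The right-hand factor \<open>hadj (T l)\<close> is cancelled by passing to the
    adjoint of \<open>Z\<close>, where it becomes \<open>T l\<close> on the left.\<close>
  then have "cinner (blinfun_apply (T l) (blinfun_apply (hadj Z) v)) h = 0" for l h v
    by (simp add: cinner_hadj cinner_hadj_left cT cZ)
  then have "blinfun_apply (T l) (blinfun_apply (hadj Z) v) = 0" for l v
    by (metis cinner_self_eq_0)
  then have hZ: "blinfun_apply (hadj Z) v = 0" for v using T(2) by blast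
  have "blinfun_apply Z v = 0" for v
  proof -
    have "cinner (blinfun_apply Z v) (blinfun_apply Z v) = 0" unfolding cinner_hadj[OF cZ] hZ by simp
    then show ?thesis by (simp add: cinner_self_eq_0)
  qed
  then have "Z = 0" by (intro blinfun_eqI) simp
  then show "lm x o\<^sub>L Q = Q o\<^sub>L lm x" unfolding Z_def by (rule eq_iff_diff_eq_0[THEN iffD2])
qed

text \<open>The projection onto the closure of \<open>X\<close> commutes with the image of
  \<open>G\<close>, hence with all left multiplications. These carry the fixed vector
  \<open>\<Lambda> id_blinfun\<close> to every \<open>\<Lambda> x\<close>.\<close>

lemma dense_invariant_subspace:
  assumes G: "G \<subseteq> M" "\<And>x. x \<in> G \<Longrightarrow> hadj x \<in> G" "commutant (commutant G) = M"
    and X: "csubspace X" "\<Lambda> id_blinfun \<in> X" and inv: "\<And>x v. x \<in> G \<Longrightarrow> v \<in> X \<Longrightarrow> blinfun_apply (lm x) v \<in> X"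
  shows "closure X = UNIV"
proof -
  have inv': "blinfun_apply A v \<in> closure X" if A: "A \<in> lm ` G" and v: "v \<in> closure X" for A v
  proof -
    obtain f where f: "\<And>n. f n \<in> X" "f \<longlonglongrightarrow> v" using v unfolding closure_sequential by blast
    have "(\<lambda>n. blinfun_apply A (f n)) \<longlonglongrightarrow> blinfun_apply A v"
      by (rule bounded_linear.tendsto[OF blinfun.bounded_linear_right f(2)])
    then show ?thesis unfolding closure_sequential using inv A f(1) by (intro exI[of _ "\<lambda>n. blinfun_apply A (f n)"]) auto
  qed
  have cG: "clinear_op A" if "A \<in> lm ` G" for A
    using that left_mult(1) G(1) by blast
  have hG: "hadj A \<in> lm ` G" if A: "A \<in> lm ` G" for A
  proof -
    obtain x where x: "x \<in> G" "A = lm x" using A by blast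
    then have "hadj A = lm (hadj x)" using left_mult_hadj G(1) by blast
    then show ?thesis using G(2)[OF x(1)] by blast
  qed
  obtain P where P: "P \<in> commutant (lm ` G)" "\<And>x. blinfun_apply P x \<in> closure X" "\<And>x. x \<in> closure X \<Longrightarrow> blinfun_apply P x = x"
    using projection_in_commutant[OF csubspace_closure[OF X(1)] closed_closure cG hG inv'] by blast
  have "\<Lambda> x \<in> closure X" if x: "x \<in> M" for x
  proof -
    have "x o\<^sub>L id_blinfun = x" by (rule blinfun_eqI) simp
    then have "\<Lambda> x = blinfun_apply (lm x) (\<Lambda> id_blinfun)" using left_mult(2)[OF x M_id] by simp
    also have "\<dots> = blinfun_apply (lm x) (blinfun_apply P (\<Lambda> id_blinfun))"
      using P(3) X(2) closure_subset by (metis subsetD)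
    also have "\<dots> = blinfun_apply P (blinfun_apply (lm x) (\<Lambda> id_blinfun))"
      by (rule commutant_apply[OF left_mult_in_double_commutant[OF G(1,3) x] P(1)])
    finally show ?thesis using P(2) by metis
  qed
  then have "closure (\<Lambda> ` M) \<subseteq> closure X" by (intro closure_minimal) auto
  then show ?thesis using \<Lambda>_dense by blast
qed

end

section \<open>The bicommutant of \<open>M\<close> on the standard space\<close>

context tracial_vN
begin

text \<open>A list of pairs \<open>(W, v)\<close> stands for a formal sum of tensors of intertwiners
  with vectors of \<open>L2\<close>. \<open>total\<close> is the vector it represents in the given
  space; formal sums are kept because \<open>act Z\<close> is not yet known to depend on
  \<open>total\<close> alone.\<close>

definition act :: "('b \<Rightarrow>\<^sub>L 'b) \<Rightarrow> (('b \<Rightarrow>\<^sub>L 'a) \<times> 'b) list \<Rightarrow> (('b \<Rightarrow>\<^sub>L 'a) \<times> 'b) list" where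
  "act Z = map (\<lambda>(W, v). (W, blinfun_apply Z v))"

definition total :: "(('b \<Rightarrow>\<^sub>L 'a) \<times> 'b) list \<Rightarrow> 'a" where
  "total ps = sum_list (map (\<lambda>(W, v). blinfun_apply W v) ps)"

definition families :: "(('b \<Rightarrow>\<^sub>L 'a) \<times> 'b) list set" where
  "families = {ps. \<forall>(W, v)\<in>set ps. intertwiner W}"

lemma total_simps [simp]: "total [] = 0" "total ((W, v) # ps) = blinfun_apply W v + total ps" "total (ps @ qs) = total ps + total qs"
  by (simp_all add: total_def)

lemma act_simps [simp]: "act Z [] = []" "act Z ((W, v) # ps) = (W, blinfun_apply Z v) # act Z ps" "act Z (ps @ qs) = act Z ps @ act Z qs"
  by (simp_all add: act_def)

lemma families_simps [simp]: "[] \<in> families" "(W, v) # ps \<in> families \<longleftrightarrow> intertwiner W \<and> ps \<in> families"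
  "ps @ qs \<in> families \<longleftrightarrow> ps \<in> families \<and> qs \<in> families"
  by (auto simp: families_def)

lemma act_families: "ps \<in> families \<Longrightarrow> act Z ps \<in> families"
  by (auto simp: families_def act_def)

lemma act_compose: "act Y (act Z ps) = act (Y o\<^sub>L Z) ps"
  by (induction ps) auto

text \<open>This is why an element \<open>Z\<close> of the bicommutant can be moved across the inner
  product of totals: it commutes with \<open>hadj V o\<^sub>L W\<close>.\<close>

lemma intertwiner_product:
  assumes V: "intertwiner V" and W: "intertwiner W"
  shows "hadj V o\<^sub>L W \<in> commutant (lm ` M)"
proof (rule commutantI)
  show "clinear_op (hadj V o\<^sub>L W)"
    using V W by (intro clinear_op_compose clinear_op_hadj intertwinerD)
  fix A assume "A \<in> lm ` M"
  then obtain x where x: "x \<in> M" "A = lm x" by blast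
  show "(hadj V o\<^sub>L W) o\<^sub>L A = A o\<^sub>L (hadj V o\<^sub>L W)"
    by (rule blinfun_eqI) (simp add: x(2) intertwinerD(2)[OF W x(1)] intertwiner_hadj[OF V x(1)])
qed

lemma cinner_act_total:
  assumes Z: "Z \<in> commutant (commutant (lm ` M))"
  shows "ps \<in> families \<Longrightarrow> qs \<in> families \<Longrightarrow> cinner (total (act Z ps)) (total qs) = cinner (total ps) (total (act (hadj Z) qs))"
proof (induction ps)
  case (Cons p ps)
  obtain W v where p: "p = (W, v)" by (cases p)
  then have W: "intertwiner W" using Cons.prems by simp
  have "cinner (blinfun_apply W (blinfun_apply Z v)) (total qs) = cinner (blinfun_apply W v) (total (act (hadj Z) qs))"
    using Cons.prems(2)
  proof (induction qs)
    case (Cons q qs)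
    obtain V u where q: "q = (V, u)" by (cases q)
    then have V: "intertwiner V" using Cons.prems by simp
    have cZ: "clinear_op Z" using Z by (rule commutantD)
    have "cinner (blinfun_apply W (blinfun_apply Z v)) (blinfun_apply V u)
        = cinner (blinfun_apply (hadj V o\<^sub>L W) (blinfun_apply Z v)) u"
      by (simp add: cinner_hadj_left intertwinerD[OF V])
    also have "\<dots> = cinner (blinfun_apply Z (blinfun_apply (hadj V o\<^sub>L W) v)) u"
      by (simp only: commutant_apply[OF Z intertwiner_product[OF V W]])
    also have "\<dots> = cinner (blinfun_apply W v) (blinfun_apply V (blinfun_apply (hadj Z) u))"
      by (simp add: cinner_hadj_left intertwinerD[OF V] cinner_hadj[OF cZ])
    finally show ?case using Cons q by (simp add: cinner_add_right)
  qed simp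
  then show ?case using Cons p by (simp add: cinner_add_left)
qed simp

text \<open>With \<open>A = hadj Z o\<^sub>L Z\<close>, \<open>act A\<close> is symmetric for the
  inner product of totals. The obvious bound \<open>N\<close> depends on the chosen list, but it
  grows only like \<open>norm A ^ m\<close> under iteration, so \<open>power_iteration_bound\<close>
  leaves an estimate in terms of \<open>total\<close> alone; this is what makes the induced operator
  well defined and bounded.\<close>

lemma total_act_bound:
  assumes Z: "Z \<in> commutant (commutant (lm ` M))"
  shows "\<exists>C. \<forall>ps\<in>families. norm (total (act Z ps)) \<le> C * norm (total ps)"
proof -
  define A where "A = hadj Z o\<^sub>L Z"
  have cZ: "clinear_op Z" using Z by (rule commutantD)
  have hcc: "hadj Z \<in> commutant (commutant (lm ` M))"
  proof (rule commutant_hadj[OF commutantD(1) _ Z])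
    fix T assume T: "T \<in> commutant (lm ` M)"
    show "hadj T \<in> commutant (lm ` M)"
    proof (rule commutant_hadj[OF _ _ T])
      show "clinear_op x" if "x \<in> lm ` M" for x using that left_mult by blast
      show "hadj x \<in> lm ` M" if "x \<in> lm ` M" for x using that left_mult_hadj M_hadj by fastforce
    qed
  qed
  have A: "A \<in> commutant (commutant (lm ` M))" unfolding A_def by (rule commutant_compose[OF hcc Z])
  have hA: "hadj A = A" by (simp add: A_def hadj_compose cZ clinear_op_hadj hadj_hadj)
  have "norm (total (act Z ps)) \<le> sqrt (norm A) * norm (total ps)" if ps: "ps \<in> families" for ps
  proof -
    define p where "p m = (act A ^^ m) ps" for m
    have pf: "p m \<in> families" for m by (induction m) (auto simp: p_def ps act_families)
    have mv: "cinner (total (p (n + m))) (total (p k)) = cinner (total (p n)) (total (p (k + m)))" for n m k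
    proof (induction m arbitrary: k)
      case (Suc m)
      have "cinner (total (p (n + Suc m))) (total (p k)) = cinner (total (p (n + m))) (total (p (Suc k)))"
        using cinner_act_total[OF A pf pf, of "n + m" k] by (simp add: p_def hA)
      then show ?case by (simp add: Suc)
    qed simp
    define f where "f m = norm (total (p m))" for m
    have sq: "(f m)\<^sup>2 \<le> f (2 * m) * f 0" for m
    proof -
      have "complex_of_real ((f m)\<^sup>2) = cinner (total (p (2 * m))) (total (p 0))"
        using mv[of m m 0] unfolding f_def cinner_self[symmetric] by (simp add: mult_2)
      then have "(f m)\<^sup>2 = cmod (cinner (total (p (2 * m))) (total (p 0)))"
        by (metis norm_of_real abs_of_nonneg zero_le_power2)
      then show ?thesis using norm_cinner_le[of "total (p (2 * m))" "total (p 0)"] by (simp add: f_def)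
    qed
    define N where "N qs = sum_list (map (\<lambda>(W, v). norm W * norm v) qs)" for qs :: "(('b \<Rightarrow>\<^sub>L 'a) \<times> 'b) list"
    have N1: "norm (total qs) \<le> N qs" for qs
    proof (induction qs)
      case (Cons q qs)
      obtain W v where q: "q = (W, v)" by (cases q)
      have "norm (total (q # qs)) \<le> norm (blinfun_apply W v) + norm (total qs)" by (simp add: q norm_triangle_ineq)
      also have "\<dots> \<le> norm W * norm v + N qs" using Cons norm_blinfun[of W v] by (rule add_mono[rotated])
      finally show ?case by (simp add: q N_def)
    qed (simp add: N_def)
    have N2: "N (act A qs) \<le> norm A * N qs" for qs
    proof (induction qs)
      case (Cons q qs)
      obtain W v where q: "q = (W, v)" by (cases q)
      have "norm W * norm (blinfun_apply A v) \<le> norm W * (norm A * norm v)"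
        by (intro mult_left_mono norm_blinfun) auto
      then show ?case using Cons by (simp add: q N_def distrib_left mult_ac)
    qed (simp add: N_def)
    have "N (p m) \<le> norm A ^ m * N ps" for m
    proof (induction m)
      case (Suc m)
      have "N (p (Suc m)) \<le> norm A * N (p m)" using N2[of "p m"] by (simp add: p_def)
      also have "\<dots> \<le> norm A * (norm A ^ m * N ps)" using Suc by (intro mult_left_mono) auto
      finally show ?case by (simp add: mult.assoc)
    qed (simp add: p_def)
    then have bd: "f m \<le> N ps * norm A ^ m" for m
      using order_trans[OF N1[of "p m"]] unfolding f_def by (metis mult.commute)
    have f1: "f 1 \<le> norm A * f 0"
      by (rule power_iteration_bound[OF _ sq bd]) (auto simp: f_def)
    have "(norm (total (act Z ps)))\<^sup>2 = cmod (cinner (total (p 0)) (total (p 1)))"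
    proof -
      have "cinner (total (act Z ps)) (total (act Z ps)) = cinner (total (p 0)) (total (p 1))"
        using cinner_act_total[OF Z ps act_families[OF ps, of Z]] by (simp add: act_compose p_def A_def)
      then show ?thesis by (metis cinner_self norm_of_real abs_of_nonneg zero_le_power2)
    qed
    also have "\<dots> \<le> f 0 * f 1" unfolding f_def by (rule norm_cinner_le)
    also have "\<dots> \<le> f 0 * (norm A * f 0)" using f1 by (intro mult_left_mono) (auto simp: f_def)
    also have "\<dots> = (sqrt (norm A) * norm (total ps))\<^sup>2" by (simp add: f_def p_def power_mult_distrib) (simp add: power2_eq_square)
    finally show ?thesis by (rule power2_le_imp_le) simp
  qed
  then show ?thesis by blast
qed

text \<open>An operator \<open>Z\<close> in the bicommutant of \<open>M\<close> on \<open>L\<^sup>2\<close> is left multiplication by the operator \<open>x\<close>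
  determined by \<open>x W v = W Z v\<close> for all intertwiners \<open>W\<close>, whose ranges span a dense subspace.\<close>

theorem double_commutant_left_mult:
  assumes Z: "Z \<in> commutant (commutant (lm ` M))"
  shows "Z \<in> lm ` M"
proof -
  obtain C where C: "\<And>ps. ps \<in> families \<Longrightarrow> norm (total (act Z ps)) \<le> C * norm (total ps)"
    using total_act_bound[OF Z] by blast
  have cZ: "clinear_op Z" using Z by (rule commutantD)
  let ?X = "total ` families"
  define f where "f h = total (act Z (SOME ps. ps \<in> families \<and> total ps = h))" for h
  have act_scale: "\<exists>qs\<in>families. total qs = c *\<^sub>C total ps \<and> total (act Z qs) = c *\<^sub>C total (act Z ps)"
    if "ps \<in> families" for c ps
    using that
  proof (induction ps)
    case (Cons p ps)
    obtain W v where p: "p = (W, v)" by (cases p)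
    obtain qs where "qs \<in> families" "total qs = c *\<^sub>C total ps" "total (act Z qs) = c *\<^sub>C total (act Z ps)"
      using Cons p by auto
    then show ?case using Cons.prems p cZ
      by (intro bexI[of _ "(W, c *\<^sub>C v) # qs"]) (auto simp: scaleC_add_right clinear_opD intertwinerD(1))
  qed (auto intro!: bexI[of _ "[]"])
  have f: "f (total ps) = total (act Z ps)" if ps: "ps \<in> families" for ps
  proof -
    define qs where "qs = (SOME qs. qs \<in> families \<and> total qs = total ps)"
    have qs: "qs \<in> families" "total qs = total ps"
      unfolding qs_def using someI[of "\<lambda>qs. qs \<in> families \<and> total qs = total ps" ps] ps by auto
    \<comment> \<open>\<open>rs\<close> represents the negative of \<open>ps\<close>, so
      \<open>qs @ rs\<close> has total zero and the bound forces its image under \<open>Z\<close> to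
      vanish.\<close>
    obtain rs where rs: "rs \<in> families" "total rs = (-1) *\<^sub>C total ps" "total (act Z rs) = (-1) *\<^sub>C total (act Z ps)"
      using act_scale[OF ps] by blast
    have "norm (total (act Z (qs @ rs))) \<le> C * norm (total (qs @ rs))" using qs rs by (intro C) simp
    then have "total (act Z qs) = total (act Z ps)" using qs rs by (simp add: scaleC_minus_left)
    then show ?thesis by (simp add: f_def qs_def)
  qed
  have X: "csubspace ?X"
    unfolding csubspace_def
  proof (intro conjI ballI allI)
    show "0 \<in> ?X" by (rule image_eqI[of _ _ "[]"]) auto
    show "u + v \<in> ?X" if "u \<in> ?X" "v \<in> ?X" for u v
    proof -
      obtain ps qs where "ps \<in> families" "qs \<in> families" "u = total ps" "v = total qs" using \<open>u \<in> ?X\<close> \<open>v \<in> ?X\<close> by blast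
      then show ?thesis by (intro image_eqI[of _ _ "ps @ qs"]) auto
    qed
    show "c *\<^sub>C u \<in> ?X" if "u \<in> ?X" for c u
    proof -
      obtain ps where ps: "ps \<in> families" "u = total ps" using \<open>u \<in> ?X\<close> by blast
      obtain qs where "qs \<in> families" "total qs = c *\<^sub>C total ps" using act_scale[OF ps(1)] by blast
      then show ?thesis using ps(2) by (intro image_eqI[of _ _ qs]) auto
    qed
  qed
  obtain x where x: "clinear_op x" "\<And>h. h \<in> ?X \<Longrightarrow> blinfun_apply x h = f h"
  proof (rule bounded_extension[OF X, of f C])
    show "f (u + v) = f u + f v" if "u \<in> ?X" "v \<in> ?X" for u v
    proof -
      obtain ps qs where p: "ps \<in> families" "qs \<in> families" "u = total ps" "v = total qs" using \<open>u \<in> ?X\<close> \<open>v \<in> ?X\<close> by blast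
      then show ?thesis using f[of "ps @ qs"] f[of ps] f[of qs] by simp
    qed
    show "f (c *\<^sub>C u) = c *\<^sub>C f u" if "u \<in> ?X" for c u
    proof -
      obtain ps where ps: "ps \<in> families" "u = total ps" using \<open>u \<in> ?X\<close> by blast
      obtain qs where "qs \<in> families" "total qs = c *\<^sub>C total ps" "total (act Z qs) = c *\<^sub>C total (act Z ps)"
        using act_scale[OF ps(1)] by blast
      then show ?thesis using f[of qs] f[of ps] ps by simp
    qed
    show "norm (f u) \<le> C * norm u" if "u \<in> ?X" for u using that C f by auto
  qed blast
  have xW: "blinfun_apply x (blinfun_apply W v) = blinfun_apply W (blinfun_apply Z v)" if W: "intertwiner W" for W v
  proof -
    have fam: "[(W, v)] \<in> families" using W by simp
    have "blinfun_apply x (total [(W, v)]) = total (act Z [(W, v)])" using x(2)[OF imageI[OF fam]] f[OF fam] by simp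
    then show ?thesis by simp
  qed
  have WX: "blinfun_apply W v \<in> closure ?X" if "intertwiner W" for W v
  proof -
    have "total [(W, v)] \<in> ?X" by (rule imageI) (use that in simp)
    then show ?thesis using closure_subset[of ?X] by auto
  qed
  \<comment> \<open>Since \<open>Q\<close> in the commutant of \<open>M\<close> preserves
    intertwiners, \<open>?X\<close> is invariant under the commutant and the projection onto its
    closure lies in \<open>M\<close>.\<close>
  have comp: "intertwiner (Q o\<^sub>L W)" if "Q \<in> commutant M" "intertwiner W" for Q W
    using that unfolding intertwiner_def by (auto simp: clinear_op_compose commutantD(1) commutant_apply)
  have inv0: "blinfun_apply Q (total ps) \<in> ?X" if Q: "Q \<in> commutant M" and ps: "ps \<in> families" for Q ps
    using ps
  proof (induction ps)
    case Nil
    then show ?case by (simp add: csubspaceD(1)[OF X])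
  next
    case (Cons p ps)
    obtain W v where p: "p = (W, v)" by (cases p)
    have "[(Q o\<^sub>L W, v)] \<in> families" using comp[OF Q] Cons.prems p by simp
    then have "total [(Q o\<^sub>L W, v)] \<in> ?X" by (rule imageI)
    then have "blinfun_apply Q (blinfun_apply W v) \<in> ?X" by simp
    then show ?case using Cons p by (simp add: blinfun.add_right csubspaceD(2)[OF X])
  qed
  have inv: "blinfun_apply Q h \<in> closure ?X" if Q: "Q \<in> commutant M" and h: "h \<in> closure ?X" for Q h
  proof -
    obtain u where u: "\<And>n. u n \<in> ?X" "u \<longlonglongrightarrow> h" using h unfolding closure_sequential by blast
    have "blinfun_apply Q (u n) \<in> ?X" for n
    proof -
      obtain ps where "u n = total ps" "ps \<in> families" using u(1)[of n] by (rule imageE)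
      then show ?thesis using inv0[OF Q] by simp
    qed
    moreover have "(\<lambda>n. blinfun_apply Q (u n)) \<longlonglongrightarrow> blinfun_apply Q h"
      by (rule bounded_linear.tendsto[OF blinfun.bounded_linear_right u(2)])
    ultimately show ?thesis unfolding closure_sequential by (intro exI[of _ "\<lambda>n. blinfun_apply Q (u n)"] conjI allI)
  qed
  have cM': "clinear_op Q" if "Q \<in> commutant M" for Q using that by (rule commutantD)
  have hadjM': "hadj Q \<in> commutant M" if "Q \<in> commutant M" for Q
    by (rule commutant_hadj[OF M_clinear M_hadj that])
  obtain P where P: "P \<in> commutant (commutant M)" "\<And>h. blinfun_apply P h \<in> closure ?X" "\<And>h. h \<in> closure ?X \<Longrightarrow> blinfun_apply P h = h"
    using projection_in_commutant[OF csubspace_closure[OF X] closed_closure cM' hadjM' inv] by blast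
  obtain T :: "nat \<Rightarrow> 'b \<Rightarrow>\<^sub>L 'a" where T: "\<And>k. intertwiner (T k)"
    "\<And>v. (\<And>k. blinfun_apply (T k) v = 0) \<Longrightarrow> v = 0"
    using separating_intertwiners by blast
  have PM: "P \<in> M" using P(1) by (simp add: M_double)
  have "\<Lambda> P - \<Lambda> id_blinfun = 0"
  \<comment> \<open>\<open>P\<close> is an element of \<open>M\<close> that fixes the ranges of all
    \<open>T k\<close>; through the intertwining relation it cannot be told apart from the identity
    on \<open>\<Lambda> id_blinfun\<close>. Injectivity of \<open>\<Lambda>\<close> then gives
    \<open>P = id_blinfun\<close>, that is, density of \<open>?X\<close>.\<close>
  proof (rule T(2))
    fix k
    have "P o\<^sub>L id_blinfun = P" by (rule blinfun_eqI) simp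
    then have "\<Lambda> P = blinfun_apply (lm P) (\<Lambda> id_blinfun)" using left_mult(2)[OF PM M_id] by simp
    then show "blinfun_apply (T k) (\<Lambda> P - \<Lambda> id_blinfun) = 0"
      by (simp add: blinfun.diff_right intertwinerD(2)[OF T(1) PM] P(3)[OF WX[OF T(1)]])
  qed
  then have "P = id_blinfun" using \<Lambda>_inj PM M_id by (metis eq_iff_diff_eq_0 inj_onD)
  then have Xd: "closure ?X = UNIV" using P(2) by (metis UNIV_eq_I blinfun_apply_id_blinfun id_apply)
  have "x \<in> commutant (commutant M)"
  proof (rule commutantI[OF x(1)])
    fix Q assume Q: "Q \<in> commutant M"
    have "blinfun_apply x (blinfun_apply Q (total ps)) = blinfun_apply Q (blinfun_apply x (total ps))" if "ps \<in> families" for ps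
      using that
    proof (induction ps)
      case (Cons p ps)
      obtain W v where p: "p = (W, v)" by (cases p)
      have W: "intertwiner W" using Cons.prems p by simp
      have "blinfun_apply x (blinfun_apply Q (blinfun_apply W v)) = blinfun_apply Q (blinfun_apply x (blinfun_apply W v))"
        using xW[OF comp[OF Q W], of v] xW[OF W, of v] by simp
      then show ?case using Cons p by (simp add: blinfun.add_right)
    qed simp
    then show "x o\<^sub>L Q = Q o\<^sub>L x" by (intro clinear_op_eq_on_dense[OF Xd]) auto
  qed
  then have xM: "x \<in> M" by (simp add: M_double)
  have "lm x = Z"
  proof (rule blinfun_eqI)
    fix v
    have "blinfun_apply (lm x) v - blinfun_apply Z v = 0"
      by (rule T(2)) (simp add: blinfun.diff_right intertwinerD(2)[OF T(1) xM] xW[OF T(1)])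
    then show "blinfun_apply (lm x) v = blinfun_apply Z v" by simp
  qed
  then show ?thesis using xM by blast
qed

end

text \<open>\<open>S\<close> is closed under adjoints, so its bicommutant is itself a von Neumann
  algebra containing \<open>S\<close> and takes part in the intersection
  \<open>vN_generated\<close>.\<close>

lemma generated_double_commutant:
  assumes vN: "von_neumann_algebra M" and S: "S \<subseteq> M" "\<And>x. x \<in> S \<Longrightarrow> hadj x \<in> S" and gen: "vN_generated S = M"
  shows "commutant (commutant S) = M"
proof
  have cS: "clinear_op x" if "x \<in> S" for x using that S(1) vN by (auto simp: von_neumann_algebra_def bops_iff)
  show "commutant (commutant S) \<subseteq> M"
    using commutant_antimono[OF commutant_antimono[OF S(1)]] vN by (simp add: von_neumann_algebra_def)
  have "von_neumann_algebra (commutant (commutant S))"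
    unfolding von_neumann_algebra_def
  proof (intro conjI ballI)
    show "commutant (commutant S) \<subseteq> bops" by (auto simp: bops_iff commutantD)
    show "commutant (commutant (commutant (commutant S))) = commutant (commutant S)"
      using triple_commutant[OF cS] by simp
    fix x assume x: "x \<in> commutant (commutant S)"
    have "hadj x \<in> commutant (commutant S)"
      by (rule commutant_hadj[OF commutantD(1) commutant_hadj[OF cS S(2)] x])
    then show "adj x \<in> commutant (commutant S)" by (simp add: adj_eq_hadj commutantD(1)[OF x])
  qed
  then show "M \<subseteq> commutant (commutant S)"
    using double_commutant_subset[OF cS] gen by (auto simp: vN_generated_def)
qed

section \<open>Absolutely convergent noncommutative series\<close>

text \<open>Tonelli for nonnegative families, with a majorant \<open>S\<close> of the inner sums
  because the weighted norms below are estimated row by row.\<close>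

lemma nonneg_summable_Sigma:
  fixes F :: "'i \<times> 'j \<Rightarrow> real"
  assumes nn: "\<And>x y. x \<in> A \<Longrightarrow> y \<in> B x \<Longrightarrow> F (x, y) \<ge> 0"
    and inner: "\<And>x. x \<in> A \<Longrightarrow> (\<lambda>y. F (x, y)) summable_on B x"
    and le: "\<And>x. x \<in> A \<Longrightarrow> (\<Sum>\<^sub>\<infinity>y\<in>B x. F (x, y)) \<le> S x" and S: "S summable_on A"
  shows "F summable_on Sigma A B" "infsum F (Sigma A B) \<le> infsum S A"
proof -
  let ?s = "\<lambda>x. \<Sum>\<^sub>\<infinity>y\<in>B x. F (x, y)"
  have s0: "?s x \<ge> 0" if "x \<in> A" for x by (rule infsum_nonneg) (use nn that in auto)
  have s: "?s summable_on A" by (rule summable_on_comparison_test[OF S]) (use le s0 in auto)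
  have "(\<lambda>p. norm (F p)) summable_on Sigma A B"
  proof (rule Infinite_Sum.abs_summable_on_Sigma_iff[THEN iffD2], intro conjI ballI)
    fix x assume x: "x \<in> A"
    show "(\<lambda>y. norm (F (x, y))) summable_on B x"
      by (rule summable_on_cong[THEN iffD1, OF _ inner[OF x]]) (use nn x in auto)
  next
    have "norm (\<Sum>\<^sub>\<infinity>y\<in>B x. norm (F (x, y))) = ?s x" if x: "x \<in> A" for x
    proof -
      have "(\<Sum>\<^sub>\<infinity>y\<in>B x. norm (F (x, y))) = ?s x" by (rule infsum_cong) (use nn x in auto)
      then show ?thesis using s0[OF x] by simp
    qed
    then show "(\<lambda>x. norm (\<Sum>\<^sub>\<infinity>y\<in>B x. norm (F (x, y)))) summable_on A"
      using s by (simp cong: summable_on_cong)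
  qed
  then show sF: "F summable_on Sigma A B" by (rule abs_summable_summable)
  have "infsum F (Sigma A B) = infsum ?s A" by (rule infsum_Sigma_banach[OF sF, symmetric])
  also have "\<dots> \<le> infsum S A" by (rule infsum_mono[OF s S]) (rule le)
  finally show "infsum F (Sigma A B) \<le> infsum S A" .
qed

lemma infsum_linear:
  assumes "bounded_linear h" "f summable_on A"
  shows "(\<lambda>x. h (f x)) summable_on A" "(\<Sum>\<^sub>\<infinity>x\<in>A. h (f x)) = h (infsum f A)"
  using has_sum_bounded_linear[OF assms(1) has_sum_infsum[OF assms(2)]]
  by (auto simp: has_sum_iff)

lemma summable_product:
  fixes f :: "'i \<Rightarrow> real" and g :: "'j \<Rightarrow> real"
  assumes f: "f summable_on A" "\<And>x. x \<in> A \<Longrightarrow> f x \<ge> 0" and g: "g summable_on B" "\<And>y. y \<in> B \<Longrightarrow> g y \<ge> 0"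
  shows "(\<lambda>(x, y). f x * g y) summable_on A \<times> B"
proof (rule nonneg_summable_Sigma(1)[of A "\<lambda>_. B"])
  show "(\<Sum>\<^sub>\<infinity>y\<in>B. case (x, y) of (x, y) \<Rightarrow> f x * g y) \<le> f x * infsum g B" for x
    by (simp add: infsum_cmult_right[OF g(1)])
  show "(\<lambda>x. f x * infsum g B) summable_on A" by (rule summable_on_cmult_left[OF f(1)])
qed (use assms in \<open>auto intro: summable_on_cmult_right\<close>)

lemma infsum_bilinear_product:
  fixes F :: "'i \<Rightarrow> 'x::banach" and G :: "'j \<Rightarrow> 'y::banach" and b :: "'x \<Rightarrow> 'y \<Rightarrow> 'z::banach"
  assumes b: "bounded_bilinear b" and F: "(\<lambda>i. norm (F i)) summable_on A" and G: "(\<lambda>j. norm (G j)) summable_on B"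
  shows "(\<lambda>p. norm (b (F (fst p)) (G (snd p)))) summable_on A \<times> B"
    and "(\<Sum>\<^sub>\<infinity>p\<in>A \<times> B. b (F (fst p)) (G (snd p))) = b (infsum F A) (infsum G B)"
proof -
  interpret b: bounded_bilinear b by fact
  obtain K where K: "\<And>x y. norm (b x y) \<le> norm x * norm y * K" using b.bounded by blast
  have "(\<lambda>p. case p of (x, y) \<Rightarrow> norm (F x) * norm (G y)) summable_on A \<times> B"
    by (rule summable_product[OF F _ G]) auto
  then have "(\<lambda>p. (case p of (x, y) \<Rightarrow> norm (F x) * norm (G y)) * K) summable_on A \<times> B"
    by (rule summable_on_cmult_left)
  then show s: "(\<lambda>p. norm (b (F (fst p)) (G (snd p)))) summable_on A \<times> B"
    by (rule summable_on_comparison_test) (auto simp: K)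
  have "(\<Sum>\<^sub>\<infinity>p\<in>A \<times> B. b (F (fst p)) (G (snd p))) = (\<Sum>\<^sub>\<infinity>x\<in>A. \<Sum>\<^sub>\<infinity>y\<in>B. b (F x) (G y))"
    using infsum_Sigma_banach[OF abs_summable_summable[OF s]] by simp
  also have "\<dots> = (\<Sum>\<^sub>\<infinity>x\<in>A. b (F x) (infsum G B))"
    using infsum_linear(2)[OF b.bounded_linear_right abs_summable_summable[OF G]] by simp
  also have "\<dots> = b (infsum F A) (infsum G B)"
    using infsum_linear(2)[OF b.bounded_linear_left abs_summable_summable[OF F]] by simp
  finally show "(\<Sum>\<^sub>\<infinity>p\<in>A \<times> B. b (F (fst p)) (G (snd p))) = b (infsum F A) (infsum G B)" .
qed

lemma infsum_fibres:
  fixes h :: "'i \<Rightarrow> 'c::banach"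
  assumes "h summable_on I"
  shows "(\<lambda>v. infsum h {i\<in>I. \<omega> i = v}) summable_on UNIV"
    and "(\<Sum>\<^sub>\<infinity>v. infsum h {i\<in>I. \<omega> i = v}) = infsum h I"
proof -
  let ?S = "Sigma UNIV (\<lambda>v. {i\<in>I. \<omega> i = v})"
  have s: "(\<lambda>(v, i). h i) summable_on ?S \<longleftrightarrow> h summable_on I"
    by (rule summable_on_reindex_bij_witness[of _ "\<lambda>i. (\<omega> i, i)" snd]) auto
  have e: "infsum (\<lambda>(v, i). h i) ?S = infsum h I"
    by (rule infsum_reindex_bij_witness[of _ "\<lambda>i. (\<omega> i, i)" snd]) auto
  show "(\<lambda>v. infsum h {i\<in>I. \<omega> i = v}) summable_on UNIV"
    using summable_on_Sigma_banach[of "\<lambda>v i. h i"] s assms by blast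
  show "(\<Sum>\<^sub>\<infinity>v. infsum h {i\<in>I. \<omega> i = v}) = infsum h I"
    using infsum_Sigma'_banach[of "\<lambda>v i. h i"] s e assms by metis
qed

lemma norm_op_scale_le: "norm (op_scale c T) \<le> cmod c * norm (T :: 'a::chilbert_space \<Rightarrow>\<^sub>L 'a)"
  by (rule norm_blinfun_bound)
    (auto simp: mult.assoc intro!: mult_left_mono norm_blinfun)

lemma op_scale_simps:
  fixes S T :: "'a::chilbert_space \<Rightarrow>\<^sub>L 'a"
  shows "op_scale (a + b) T = op_scale a T + op_scale b T" "op_scale a (S + T) = op_scale a S + op_scale a T"
    "op_scale a (op_scale b T) = op_scale (a * b) T" "op_scale 0 T = 0" "op_scale 1 T = T" "op_scale a 0 = 0"
    "op_scale a S o\<^sub>L T = op_scale a (S o\<^sub>L T)"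
    "clinear_op S \<Longrightarrow> S o\<^sub>L op_scale a T = op_scale a (S o\<^sub>L T)"
  by (auto intro!: blinfun_eqI simp: blinfun.add_left scaleC_add_left scaleC_add_right scaleC_scaleC clinear_opD)

lemma bounded_linear_op_scale_left: "bounded_linear (\<lambda>c. op_scale c (T :: 'a::chilbert_space \<Rightarrow>\<^sub>L 'a))"
proof (rule bounded_linear_intro[where K="norm T"])
  show "op_scale (r *\<^sub>R c) T = r *\<^sub>R op_scale c T" for r c
    by (rule blinfun_eqI) (simp add: blinfun.scaleR_left scaleR_eq_scaleC scaleC_scaleC scaleC_complex_def)
qed (auto simp: op_scale_simps norm_op_scale_le)

lemma bounded_linear_op_scale_right: "bounded_linear (\<lambda>T :: 'a::chilbert_space \<Rightarrow>\<^sub>L 'a. op_scale c T)"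
proof (rule bounded_linear_intro[where K="cmod c"])
  show "op_scale c (r *\<^sub>R T) = r *\<^sub>R op_scale c T" for r and T :: "'a \<Rightarrow>\<^sub>L 'a"
    by (rule blinfun_eqI) (simp add: blinfun.scaleR_left scaleC_scaleR)
qed (use norm_op_scale_le[of c] in \<open>auto simp: op_scale_simps mult.commute\<close>)

text \<open>Products, derivations and cyclic derivatives of series all arise by pushing coefficients
  \<open>z\<close> forward along a map \<open>\<omega>\<close> from indices to words. Evaluating
  such a series is then a single sum over the indices, whatever coincidences \<open>\<omega>\<close>
  has.\<close>

lemma infsum_op_scale_fibres:
  fixes \<Phi> :: "'w \<Rightarrow> 'a::chilbert_space \<Rightarrow>\<^sub>L 'a"
  assumes z: "\<And>v. z summable_on {i\<in>I. \<omega> i = v}"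
    and s: "(\<lambda>i. op_scale (z i) (\<Phi> (\<omega> i))) summable_on I"
  shows "(\<Sum>\<^sub>\<infinity>v. op_scale (infsum z {i\<in>I. \<omega> i = v}) (\<Phi> v)) = (\<Sum>\<^sub>\<infinity>i\<in>I. op_scale (z i) (\<Phi> (\<omega> i)))"
proof -
  have "op_scale (infsum z {i\<in>I. \<omega> i = v}) (\<Phi> v) = (\<Sum>\<^sub>\<infinity>i\<in>{i\<in>I. \<omega> i = v}. op_scale (z i) (\<Phi> (\<omega> i)))" for v
  proof -
    have "op_scale (infsum z {i\<in>I. \<omega> i = v}) (\<Phi> v) = (\<Sum>\<^sub>\<infinity>i\<in>{i\<in>I. \<omega> i = v}. op_scale (z i) (\<Phi> v))"
      by (rule infsum_linear(2)[OF bounded_linear_op_scale_left z, symmetric])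
    also have "\<dots> = (\<Sum>\<^sub>\<infinity>i\<in>{i\<in>I. \<omega> i = v}. op_scale (z i) (\<Phi> (\<omega> i)))" by (rule infsum_cong) auto
    finally show ?thesis .
  qed
  then show ?thesis using infsum_fibres(2)[OF s] by simp
qed

section \<open>Weighted norms, products and the formal derivation\<close>

definition nc_norm :: "real \<Rightarrow> 'n ncseries \<Rightarrow> real" where
  "nc_norm \<rho> c = (\<Sum>\<^sub>\<infinity>w. cmod (c w) * \<rho> ^ length w)"

lemma nc_conv_iff: "c \<in> nc_conv \<rho> \<longleftrightarrow> (\<lambda>w. cmod (c w) * \<rho> ^ length w) summable_on UNIV"
  by (simp add: nc_conv_def)

lemma nc_norm_nonneg: "\<rho> \<ge> 0 \<Longrightarrow> nc_norm \<rho> c \<ge> 0"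
  unfolding nc_norm_def by (rule infsum_nonneg) auto

lemma nc_conv_mono:
  assumes "c \<in> nc_conv \<rho>'" "0 \<le> \<rho>" "\<rho> \<le> \<rho>'"
  shows "c \<in> nc_conv \<rho>" "nc_norm \<rho> c \<le> nc_norm \<rho>' c"
proof -
  have le: "cmod (c w) * \<rho> ^ length w \<le> cmod (c w) * \<rho>' ^ length w" for w
    using assms by (intro mult_left_mono power_mono) auto
  show c: "c \<in> nc_conv \<rho>" unfolding nc_conv_iff
    by (rule summable_on_comparison_test[OF assms(1)[unfolded nc_conv_iff]]) (use le assms in auto)
  show "nc_norm \<rho> c \<le> nc_norm \<rho>' c"
    unfolding nc_norm_def by (rule infsum_mono[OF c[unfolded nc_conv_iff] assms(1)[unfolded nc_conv_iff] le])
qed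

text \<open>Collecting terms with the same word cannot increase the weighted norm, by the triangle
  inequality on each fibre. Positivity of \<open>\<rho>\<close> lets the constant weight of a fibre
  be divided out.\<close>

lemma fibre_series:
  assumes \<rho>: "\<rho> > 0" and s: "(\<lambda>i. cmod (z i) * \<rho> ^ length (\<omega> i)) summable_on I"
  shows "z summable_on {i\<in>I. \<omega> i = v}"
    and "(\<lambda>v. infsum z {i\<in>I. \<omega> i = v}) \<in> nc_conv \<rho>"
    and "nc_norm \<rho> (\<lambda>v. infsum z {i\<in>I. \<omega> i = v}) \<le> (\<Sum>\<^sub>\<infinity>i\<in>I. cmod (z i) * \<rho> ^ length (\<omega> i))"
proof -
  have fs: "(\<lambda>i. cmod (z i)) summable_on {i\<in>I. \<omega> i = v}" for v
  proof -
    have "(\<lambda>i. cmod (z i) * \<rho> ^ length (\<omega> i)) summable_on {i\<in>I. \<omega> i = v}"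
      by (rule summable_on_subset_banach[OF s]) auto
    then have "(\<lambda>i. cmod (z i) * \<rho> ^ length v) summable_on {i\<in>I. \<omega> i = v}"
      by (rule summable_on_cong[THEN iffD1, rotated]) auto
    then have "(\<lambda>i. (cmod (z i) * \<rho> ^ length v) * inverse (\<rho> ^ length v)) summable_on {i\<in>I. \<omega> i = v}"
      by (rule summable_on_cmult_left)
    moreover have "cmod (z i) * \<rho> ^ length v * inverse (\<rho> ^ length v) = cmod (z i)" for i using \<rho> by simp
    ultimately show ?thesis by (simp only:)
  qed
  then show "z summable_on {i\<in>I. \<omega> i = v}" for v by (rule abs_summable_summable)
  have le: "cmod (infsum z {i\<in>I. \<omega> i = v}) * \<rho> ^ length v \<le> (\<Sum>\<^sub>\<infinity>i\<in>{i\<in>I. \<omega> i = v}. cmod (z i) * \<rho> ^ length (\<omega> i))" for v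
  proof -
    have "cmod (infsum z {i\<in>I. \<omega> i = v}) * \<rho> ^ length v \<le> (\<Sum>\<^sub>\<infinity>i\<in>{i\<in>I. \<omega> i = v}. cmod (z i)) * \<rho> ^ length v"
      by (intro mult_right_mono norm_infsum_bound fs) (use \<rho> in auto)
    also have "\<dots> = (\<Sum>\<^sub>\<infinity>i\<in>{i\<in>I. \<omega> i = v}. cmod (z i) * \<rho> ^ length v)"
      by (rule infsum_cmult_left[OF fs, symmetric])
    also have "\<dots> = (\<Sum>\<^sub>\<infinity>i\<in>{i\<in>I. \<omega> i = v}. cmod (z i) * \<rho> ^ length (\<omega> i))" by (rule infsum_cong) auto
    finally show ?thesis .
  qed
  note f = infsum_fibres[OF s, of \<omega>]
  show c: "(\<lambda>v. infsum z {i\<in>I. \<omega> i = v}) \<in> nc_conv \<rho>"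
    unfolding nc_conv_iff by (rule summable_on_comparison_test[OF f(1)]) (use le \<rho> in auto)
  show "nc_norm \<rho> (\<lambda>v. infsum z {i\<in>I. \<omega> i = v}) \<le> (\<Sum>\<^sub>\<infinity>i\<in>I. cmod (z i) * \<rho> ^ length (\<omega> i))"
    unfolding f(2)[symmetric] nc_norm_def by (rule infsum_mono[OF c[unfolded nc_conv_iff] f(1) le])
qed

lemma nc_mult_fibres: "nc_mult f g v = (\<Sum>\<^sub>\<infinity>p\<in>{p\<in>UNIV. fst p @ snd p = v}. f (fst p) * g (snd p))"
proof -
  have bij: "bij_betw (\<lambda>i. (take i v, drop i v)) {..length v} {p\<in>UNIV. fst p @ snd p = v}"
    by (rule bij_betw_byWitness[where f'="\<lambda>p. length (fst p)"]) auto
  then have fin: "finite {p\<in>UNIV. fst p @ snd p = v}" using bij_betw_finite by blast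
  have "(\<Sum>p\<in>{p\<in>UNIV. fst p @ snd p = v}. f (fst p) * g (snd p)) = nc_mult f g v"
    unfolding nc_mult_def using sum.reindex_bij_betw[OF bij, of "\<lambda>p. f (fst p) * g (snd p)"] by simp
  then show ?thesis using fin by simp
qed

lemma nc_mult_summable:
  assumes f: "f \<in> nc_conv \<rho>" and g: "g \<in> nc_conv \<rho>" and \<rho>: "\<rho> > 0"
  shows "(\<lambda>p. cmod (f (fst p) * g (snd p)) * \<rho> ^ length (fst p @ snd p)) summable_on UNIV"
proof -
  have "(\<lambda>(a, b). (cmod (f a) * \<rho> ^ length a) * (cmod (g b) * \<rho> ^ length b)) summable_on UNIV \<times> UNIV"
    using f g \<rho> unfolding nc_conv_iff by (intro summable_product) auto
  moreover have "(\<lambda>(a, b). (cmod (f a) * \<rho> ^ length a) * (cmod (g b) * \<rho> ^ length b))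
      = (\<lambda>p. cmod (f (fst p) * g (snd p)) * \<rho> ^ length (fst p @ snd p))"
    by (auto simp: fun_eq_iff norm_mult power_add)
  ultimately show ?thesis by (simp only: UNIV_Times_UNIV)
qed

lemma nc_mult_conv: "f \<in> nc_conv \<rho> \<Longrightarrow> g \<in> nc_conv \<rho> \<Longrightarrow> \<rho> > 0 \<Longrightarrow> nc_mult f g \<in> nc_conv \<rho>"
  using fibre_series(2)[OF _ nc_mult_summable] by (simp add: nc_mult_fibres[abs_def])

text \<open>The derivative of the convex function \<open>x ^ (n + 1)\<close> at
  \<open>\<rho>\<close> is at most its secant slope up to \<open>\<rho>'\<close>. This Cauchy-type
  estimate is the source of every factor \<open>1 / (\<rho>' - \<rho>)\<close>.\<close>

lemma derivative_power_bound:
  fixes \<rho> \<rho>' :: real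
  assumes "0 \<le> \<rho>" "\<rho> \<le> \<rho>'"
  shows "real (Suc n) * \<rho> ^ n * (\<rho>' - \<rho>) \<le> \<rho>' ^ Suc n"
proof (induction n)
  case (Suc n)
  have "real (Suc (Suc n)) * \<rho> ^ Suc n * (\<rho>' - \<rho>) = \<rho> * (real (Suc n) * \<rho> ^ n * (\<rho>' - \<rho>)) + \<rho> ^ Suc n * (\<rho>' - \<rho>)"
    by (simp add: algebra_simps)
  also have "\<dots> \<le> \<rho> * \<rho>' ^ Suc n + \<rho>' ^ Suc n * (\<rho>' - \<rho>)"
    using assms Suc by (intro add_mono mult_left_mono mult_right_mono power_mono) auto
  also have "\<dots> = \<rho>' ^ Suc (Suc n)" by (simp add: algebra_simps)
  finally show ?case .
qed (use assms in simp)

lemma nc_mult_monom_sandwich: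
  "nc_mult (nc_mult (nc_monom a) f) (nc_monom b) v = (\<Sum>\<^sub>\<infinity>u\<in>{u. a @ u @ b = v}. f u)"
proof -
  have left: "nc_mult (nc_monom a) f v = (\<Sum>\<^sub>\<infinity>u\<in>{u. a @ u = v}. f u)" for v
  proof -
    have "nc_mult (nc_monom a) f v = (\<Sum>\<^sub>\<infinity>p\<in>Pair a ` {u. a @ u = v}. nc_monom a (fst p) * f (snd p))"
      unfolding nc_mult_fibres by (rule infsum_cong_neutral) (auto simp: nc_monom_def)
    also have "\<dots> = (\<Sum>\<^sub>\<infinity>u\<in>{u. a @ u = v}. f u)"
      by (subst infsum_reindex) (auto simp: inj_on_def o_def nc_monom_def)
    finally show ?thesis .
  qed
  have right: "nc_mult g (nc_monom b) v = (\<Sum>\<^sub>\<infinity>u\<in>{u. u @ b = v}. g u)" for g v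
  proof -
    have "nc_mult g (nc_monom b) v = (\<Sum>\<^sub>\<infinity>p\<in>(\<lambda>u. (u, b)) ` {u. u @ b = v}. g (fst p) * nc_monom b (snd p))"
      unfolding nc_mult_fibres by (rule infsum_cong_neutral) (auto simp: nc_monom_def)
    also have "\<dots> = (\<Sum>\<^sub>\<infinity>u\<in>{u. u @ b = v}. g u)"
      by (subst infsum_reindex) (auto simp: inj_on_def o_def nc_monom_def)
    finally show ?thesis .
  qed
  show ?thesis
  proof (cases "\<exists>u. a @ u @ b = v")
    case True
    then obtain u where u: "a @ u @ b = v" by blast
    then have "{w. w @ b = v} = {a @ u}" "{w. a @ w = a @ u} = {u}" "{w. a @ w @ b = v} = {u}" by auto
    then show ?thesis by (simp add: right left)
  next
    case False
    have "nc_mult (nc_monom a) f w = 0" if "w @ b = v" for w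
    proof -
      have "{u. a @ u = w} = {}" using False that by auto
      then show ?thesis by (simp add: left)
    qed
    moreover have "{u. a @ u @ b = v} = {}" using False by auto
    ultimately show ?thesis by (simp only: right infsum_empty) (rule infsum_0, blast)
  qed
qed

text \<open>The terms of \<open>D\<^sub>K c\<close> are indexed by a word \<open>w\<close> of \<open>c\<close>, a position \<open>k\<close> in \<open>w\<close>, and a word
  \<open>u\<close> of \<open>K (w ! k)\<close> substituted at that position.\<close>

definition der_index :: "('n list \<times> nat \<times> 'n list) set" where
  "der_index = Sigma UNIV (\<lambda>w. {..<length w} \<times> UNIV)"

definition der_word :: "'n list \<times> nat \<times> 'n list \<Rightarrow> 'n list" where
  "der_word = (\<lambda>(w, k, u). take k w @ u @ drop (Suc k) w)"

definition der_coeff :: "('n \<Rightarrow> 'n ncseries) \<Rightarrow> 'n ncseries \<Rightarrow> 'n list \<times> nat \<times> 'n list \<Rightarrow> complex" where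
  "der_coeff K c = (\<lambda>(w, k, u). c w * K (w ! k) u)"

text \<open>A word of length \<open>m\<close> offers \<open>m\<close> positions, and a substitution
  there trades one letter for a series of norm at most \<open>B\<close>. The resulting
  \<open>m * \<rho> ^ (m - 1)\<close> is paid for by the larger radius.\<close>

lemma der_summable:
  assumes c: "c \<in> nc_conv \<rho>'" and K: "\<And>j. K j \<in> nc_conv \<rho>" "\<And>j. nc_norm \<rho> (K j) \<le> B"
    and \<rho>: "0 < \<rho>" "\<rho> < \<rho>'"
  shows "(\<lambda>i. cmod (der_coeff K c i) * \<rho> ^ length (der_word i)) summable_on der_index"
    and "(\<Sum>\<^sub>\<infinity>i\<in>der_index. cmod (der_coeff K c i) * \<rho> ^ length (der_word i)) \<le> B / (\<rho>' - \<rho>) * nc_norm \<rho>' c"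
proof -
  let ?F = "\<lambda>i. cmod (der_coeff K c i) * \<rho> ^ length (der_word i)"
  have B: "B \<ge> 0" using K(2) nc_norm_nonneg[of \<rho>] \<rho> by (meson less_imp_le order_trans)
  have F: "?F (w, k, u) = cmod (c w) * \<rho> ^ (length w - 1) * (cmod (K (w ! k) u) * \<rho> ^ length u)" if "k < length w" for w k u
  proof -
    have "length (der_word (w, k, u)) = (length w - 1) + length u" using that by (auto simp: der_word_def)
    then show ?thesis by (simp add: der_coeff_def norm_mult power_add mult_ac)
  qed
  have row: "(\<lambda>p. ?F (w, p)) summable_on {..<length w} \<times> UNIV \<and>
     (\<Sum>\<^sub>\<infinity>p\<in>{..<length w} \<times> UNIV. ?F (w, p)) \<le> B / (\<rho>' - \<rho>) * (cmod (c w) * \<rho>' ^ length w)" for w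
  proof -
    let ?S = "\<lambda>k. cmod (c w) * \<rho> ^ (length w - 1) * B"
    have in_s: "(\<lambda>u. ?F (w, k, u)) summable_on UNIV" and in_le: "(\<Sum>\<^sub>\<infinity>u. ?F (w, k, u)) \<le> ?S k" if "k \<in> {..<length w}" for k
    proof -
      have k: "k < length w" using that by simp
      show "(\<lambda>u. ?F (w, k, u)) summable_on UNIV"
        unfolding F[OF k] by (rule summable_on_cmult_right[OF K(1)[unfolded nc_conv_iff]])
      have "(\<Sum>\<^sub>\<infinity>u. ?F (w, k, u)) = cmod (c w) * \<rho> ^ (length w - 1) * nc_norm \<rho> (K (w ! k))"
        unfolding F[OF k] nc_norm_def by (rule infsum_cmult_right[OF K(1)[unfolded nc_conv_iff]])
      also have "\<dots> \<le> ?S k" using \<rho> by (intro mult_left_mono K(2)) auto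
      finally show "(\<Sum>\<^sub>\<infinity>u. ?F (w, k, u)) \<le> ?S k" .
    qed
    have Ss: "?S summable_on {..<length w}" by simp
    note N = nonneg_summable_Sigma[of "{..<length w}" "\<lambda>_. UNIV" "\<lambda>p. ?F (w, p)" ?S, OF _ in_s in_le Ss]
    have nn: "?F i \<ge> 0" for i using \<rho> by simp
    have "(\<Sum>\<^sub>\<infinity>p\<in>{..<length w} \<times> UNIV. ?F (w, p)) \<le> infsum ?S {..<length w}" by (rule N(2)) (use nn in auto)
    also have "\<dots> = B * cmod (c w) * (real (length w) * \<rho> ^ (length w - 1))" by simp
    also have "\<dots> \<le> B * cmod (c w) * (\<rho>' ^ length w / (\<rho>' - \<rho>))"
    proof -
      have "real (length w) * \<rho> ^ (length w - 1) \<le> \<rho>' ^ length w / (\<rho>' - \<rho>)"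
      proof (cases "length w")
        case (Suc n)
        have "real (Suc n) * \<rho> ^ n * (\<rho>' - \<rho>) \<le> \<rho>' ^ Suc n" by (rule derivative_power_bound) (use \<rho> in auto)
        then show ?thesis unfolding Suc diff_Suc_1 using \<rho> by (subst pos_le_divide_eq) simp_all
      qed (use \<rho> in auto)
      then show ?thesis by (rule mult_left_mono) (use B in simp)
    qed
    also have "\<dots> = B / (\<rho>' - \<rho>) * (cmod (c w) * \<rho>' ^ length w)" by simp
    finally show ?thesis using N(1) nn by auto
  qed
  have S: "(\<lambda>w. B / (\<rho>' - \<rho>) * (cmod (c w) * \<rho>' ^ length w)) summable_on UNIV"
    by (rule summable_on_cmult_right[OF c[unfolded nc_conv_iff]])
  note N = nonneg_summable_Sigma[of UNIV "\<lambda>w. {..<length w} \<times> UNIV" ?F, OF _ conjunct1[OF row] conjunct2[OF row] S]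
  have nn: "?F i \<ge> 0" for i using \<rho> by simp
  show "?F summable_on der_index" unfolding der_index_def by (rule N(1)) (use nn in auto)
  have "infsum ?F der_index \<le> (\<Sum>\<^sub>\<infinity>w. B / (\<rho>' - \<rho>) * (cmod (c w) * \<rho>' ^ length w))"
    unfolding der_index_def by (rule N(2)) (use nn in auto)
  also have "\<dots> = B / (\<rho>' - \<rho>) * nc_norm \<rho>' c"
    unfolding nc_norm_def by (rule infsum_cmult_right[OF c[unfolded nc_conv_iff]])
  finally show "infsum ?F der_index \<le> B / (\<rho>' - \<rho>) * nc_norm \<rho>' c" .
qed

text \<open>Prefix and suffix determine the substituted word, so each \<open>?U w k\<close> has at
  most one element and the product formula in \<open>nc_derivation_word\<close> is just the sum over
  the fibre.\<close>

lemma nc_derivation_fibres: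
  assumes s: "der_coeff K c summable_on {i\<in>der_index. der_word i = v}"
  shows "nc_derivation K c v = infsum (der_coeff K c) {i\<in>der_index. der_word i = v}"
proof -
  let ?U = "\<lambda>w k. {u. take k w @ u @ drop (Suc k) w = v}"
  let ?I = "\<lambda>w. Sigma {..<length w} (?U w)"
  have set: "{i\<in>der_index. der_word i = v} = Sigma UNIV ?I"
    by (auto simp: der_index_def der_word_def)
  have s': "(\<lambda>(w, p). der_coeff K c (w, p)) summable_on Sigma UNIV ?I" using s unfolding set by simp
  have fin: "finite (?U w k)" for w k
  proof -
    have "?U w k = {} \<or> (\<exists>u. ?U w k = {u})" by auto
    then show ?thesis by (metis finite.emptyI finite_insert)
  qed
  have inner: "(\<Sum>\<^sub>\<infinity>p\<in>?I w. der_coeff K c (w, p)) = c w * nc_derivation_word K w v" for w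
  proof -
    have "finite (?I w)" by (rule finite_SigmaI) (auto intro: fin)
    then have "(\<Sum>\<^sub>\<infinity>p\<in>?I w. der_coeff K c (w, p)) = (\<Sum>p\<in>?I w. der_coeff K c (w, p))" by (rule infsum_finite)
    also have "\<dots> = (\<Sum>k<length w. \<Sum>u\<in>?U w k. der_coeff K c (w, k, u))"
      by (subst sum.Sigma) (auto intro: fin simp: case_prod_beta)
    also have "\<dots> = (\<Sum>k<length w. c w * nc_mult (nc_mult (nc_monom (take k w)) (K (w ! k))) (nc_monom (drop (Suc k) w)) v)"
      by (simp add: nc_mult_monom_sandwich der_coeff_def sum_distrib_left fin)
    finally show ?thesis by (simp add: nc_derivation_word_def sum_distrib_left)
  qed
  have "infsum (der_coeff K c) {i\<in>der_index. der_word i = v} = (\<Sum>\<^sub>\<infinity>w. \<Sum>\<^sub>\<infinity>p\<in>?I w. der_coeff K c (w, p))"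
    unfolding set using infsum_Sigma'_banach[OF s'] by simp
  then show ?thesis by (simp add: inner nc_derivation_def)
qed

lemma nc_derivation_conv:
  assumes c: "c \<in> nc_conv \<rho>'" and K: "\<And>j. K j \<in> nc_conv \<rho>" "\<And>j. nc_norm \<rho> (K j) \<le> B"
    and \<rho>: "0 < \<rho>" "\<rho> < \<rho>'"
  shows "nc_derivation K c \<in> nc_conv \<rho>" "nc_norm \<rho> (nc_derivation K c) \<le> B / (\<rho>' - \<rho>) * nc_norm \<rho>' c"
proof -
  note ds = der_summable[OF assms]
  have eq: "nc_derivation K c = (\<lambda>v. infsum (der_coeff K c) {i\<in>der_index. der_word i = v})"
    by (rule ext, rule nc_derivation_fibres, rule fibre_series(1)[OF \<rho>(1) ds(1)])
  show "nc_derivation K c \<in> nc_conv \<rho>" unfolding eq by (rule fibre_series(2)[OF \<rho>(1) ds(1)])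
  show "nc_norm \<rho> (nc_derivation K c) \<le> B / (\<rho>' - \<rho>) * nc_norm \<rho>' c"
    unfolding eq by (rule order_trans[OF fibre_series(3)[OF \<rho>(1) ds(1)] ds(2)])
qed

section \<open>The derivation on convergent series in the generators\<close>

text \<open>The evaluated derivation on a single word, written as the Leibniz recursion. It needs
  only the operators \<open>K j\<close>, not their series, so that algebraic identities can be
  proved on words.\<close>

primrec word_der :: "('n \<Rightarrow> ('a::chilbert_space \<Rightarrow>\<^sub>L 'a)) \<Rightarrow> ('n \<Rightarrow> ('a \<Rightarrow>\<^sub>L 'a)) \<Rightarrow> 'n list \<Rightarrow> ('a \<Rightarrow>\<^sub>L 'a)" where
  "word_der Y K [] = 0"
| "word_der Y K (j # w) = (K j o\<^sub>L word_op Y w) + (Y j o\<^sub>L word_der Y K w)"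

lemma word_op_simps [simp]: "word_op Y [] = id_blinfun" "word_op Y (j # w) = Y j o\<^sub>L word_op Y w"
  by (simp_all add: word_op_def)

lemma blinfun_compose_simps:
  fixes S S' T :: "'a::real_normed_vector \<Rightarrow>\<^sub>L 'a"
  shows
  "id_blinfun o\<^sub>L T = T" "T o\<^sub>L id_blinfun = T" "0 o\<^sub>L T = 0" "T o\<^sub>L 0 = 0"
  "(S + S') o\<^sub>L T = (S o\<^sub>L T) + (S' o\<^sub>L T)" "T o\<^sub>L (S + S') = (T o\<^sub>L S) + (T o\<^sub>L S')"
  by (auto intro!: blinfun_eqI simp: blinfun.add_left blinfun.add_right)

lemma blinfun_compose_sum:
  fixes T :: "'a::real_normed_vector \<Rightarrow>\<^sub>L 'a" and f :: "'i \<Rightarrow> 'a \<Rightarrow>\<^sub>L 'a"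
  shows "T o\<^sub>L sum f A = (\<Sum>i\<in>A. T o\<^sub>L f i)"
  by (induction A rule: infinite_finite_induct) (auto simp: blinfun_compose_simps)

lemma word_op_append: "word_op Y (a @ b) = word_op Y a o\<^sub>L word_op Y b"
  by (induction a) (auto simp: blinfun_compose_simps blinfun_compose_assoc)

lemma word_der_append: "word_der Y K (a @ b) = (word_der Y K a o\<^sub>L word_op Y b) + (word_op Y a o\<^sub>L word_der Y K b)"
  by (induction a) (auto simp: blinfun_compose_simps blinfun_compose_assoc word_op_append)

lemma word_der_sum:
  "word_der Y K w = (\<Sum>k<length w. word_op Y (take k w) o\<^sub>L (K (w ! k) o\<^sub>L word_op Y (drop (Suc k) w)))"
proof (induction w)
  case (Cons j w)
  have "(\<Sum>k<length (j # w). word_op Y (take k (j # w)) o\<^sub>L (K ((j # w) ! k) o\<^sub>L word_op Y (drop (Suc k) (j # w))))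
      = (K j o\<^sub>L word_op Y w) + (\<Sum>k<length w. Y j o\<^sub>L (word_op Y (take k w) o\<^sub>L (K (w ! k) o\<^sub>L word_op Y (drop (Suc k) w))))"
    unfolding length_Cons sum.lessThan_Suc_shift by (simp add: blinfun_compose_simps blinfun_compose_assoc)
  then show ?case by (simp add: Cons blinfun_compose_sum)
qed simp

lemma word_op_clinear: "(\<And>j. clinear_op (Y j)) \<Longrightarrow> clinear_op (word_op Y w)"
  by (induction w) (auto simp: clinear_op_compose)

lemma word_der_clinear: "(\<And>j. clinear_op (Y j)) \<Longrightarrow> (\<And>j. clinear_op (K j)) \<Longrightarrow> clinear_op (word_der Y K w)"
  by (induction w) (auto simp: clinear_op_compose clinear_op_plus word_op_clinear, simp add: clinear_op_def)

lemma norm_word_op_le: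
  assumes "\<And>j. norm (Y j) \<le> R" "R \<ge> 0"
  shows "norm (word_op Y w) \<le> R ^ length w"
proof (induction w)
  case Nil
  show ?case by (simp add: norm_blinfun_bound)
next
  case (Cons j w)
  have "norm (word_op Y (j # w)) \<le> norm (Y j) * norm (word_op Y w)" by (simp add: norm_blinfun_compose)
  also have "\<dots> \<le> R * R ^ length w" using assms Cons by (intro mult_mono) auto
  finally show ?case by simp
qed

lemma norm_word_der_le:
  assumes "\<And>j. norm (Y j) \<le> R" "R \<ge> 0" "\<And>j. norm (K j) \<le> B" "B \<ge> 0"
  shows "norm (word_der Y K w) \<le> B * (real (length w) * R ^ (length w - 1))"
proof (induction w)
  case (Cons j w)
  have "norm (word_der Y K (j # w)) \<le> norm (K j o\<^sub>L word_op Y w) + norm (Y j o\<^sub>L word_der Y K w)"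
    by (simp add: norm_triangle_ineq)
  also have "\<dots> \<le> norm (K j) * norm (word_op Y w) + norm (Y j) * norm (word_der Y K w)"
    by (intro add_mono norm_blinfun_compose)
  also have "\<dots> \<le> B * R ^ length w + R * (B * (real (length w) * R ^ (length w - 1)))"
    using assms Cons norm_word_op_le[of Y R w] by (intro add_mono mult_mono) auto
  also have "\<dots> = B * (real (length (j # w)) * R ^ (length (j # w) - 1))"
    by (cases w) (simp_all add: algebra_simps)
  finally show ?case .
qed simp

lemma hadj_word_op: "(\<And>j. clinear_op (Y j)) \<Longrightarrow> (\<And>j. hadj (Y j) = Y j) \<Longrightarrow> hadj (word_op Y w) = word_op Y (rev w)"
  by (induction w) (auto simp: hadj_compose word_op_clinear word_op_append blinfun_compose_simps)

lemma hadj_word_der: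
  fixes Y K :: "'n \<Rightarrow> ('a::chilbert_space \<Rightarrow>\<^sub>L 'a)"
  assumes "\<And>j. clinear_op (Y j)" "\<And>j. clinear_op (K j)" "\<And>j. hadj (Y j) = Y j" "\<And>j. hadj (K j) = K j"
  shows "hadj (word_der Y K w) = word_der Y K (rev w)"
proof (induction w)
  case Nil
  have "hadj (0 :: 'a \<Rightarrow>\<^sub>L 'a) = 0" by (rule hadj_unique) (auto simp: clinear_op_def)
  then show ?case by simp
next
  case (Cons j w)
  then show ?case using assms
    by (simp add: hadj_plus hadj_compose clinear_op_compose word_op_clinear word_der_clinear hadj_word_op
        word_der_append blinfun_compose_simps add.commute)
qed

text \<open>One radius \<open>R1\<close> and one bound \<open>B\<close> for all \<open>K j\<close>
  are fixed here; they exist because there are finitely many variables.\<close>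

locale nc_flow = tracial_vN M \<tau> \<Lambda>
  for M :: "('a::chilbert_space \<Rightarrow>\<^sub>L 'a) set" and \<tau> :: "('a \<Rightarrow>\<^sub>L 'a) \<Rightarrow> complex"
    and \<Lambda> :: "('a \<Rightarrow>\<^sub>L 'a) \<Rightarrow> 'b::chilbert_space" +
  fixes Y K :: "'n::finite \<Rightarrow> ('a \<Rightarrow>\<^sub>L 'a)" and R R1 B :: real
  assumes YM: "Y j \<in> M" and Yh: "hadj (Y j) = Y j" and gen: "commutant (commutant (range Y)) = M"
    and R: "R > 0" and YR: "norm (Y j) \<le> R" and inj: "inj_on (nc_eval Y) (nc_conv_gt R)"
    and KA: "K j \<in> nc_eval Y ` nc_conv_gt R" and Ka: "adj (K j) = K j"
    and tp: "trace_preserving \<tau> Y K"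
    and R1: "R < R1" and K1: "nc_eval_inv R Y (K j) \<in> nc_conv R1" and B: "nc_norm R1 (nc_eval_inv R Y (K j)) \<le> B"
    and B0: "B > 0"
begin

abbreviation "Kt \<equiv> \<lambda>j. nc_eval_inv R Y (K j)"
abbreviation "Dt \<equiv> nc_derivation Kt"
abbreviation "ev \<equiv> nc_eval Y"
abbreviation "wd \<equiv> word_op Y"
abbreviation "dw \<equiv> word_der Y K"

lemma Y_clinear: "clinear_op (Y j)"
  by (rule M_clinear[OF YM])

lemma wd_clinear: "clinear_op (wd w)"
  by (rule word_op_clinear[OF Y_clinear])

lemma wdM: "wd w \<in> M"
  by (induction w) (auto simp: M_id M_compose YM)

lemma norm_wd: "norm (wd w) \<le> R ^ length w"
  by (rule norm_word_op_le) (use YR R in auto)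

lemma infsum_in_M:
  assumes "f summable_on A" "\<And>i. i \<in> A \<Longrightarrow> f i \<in> M"
  shows "infsum f A \<in> M"
proof (rule Lim_in_closed_set[OF M_closed])
  show "(sum f \<longlongrightarrow> infsum f A) (finite_subsets_at_top A)"
    using has_sum_infsum[OF assms(1)] by (simp add: has_sum_def)
  show "\<forall>\<^sub>F F in finite_subsets_at_top A. sum f F \<in> M"
    by (auto simp: eventually_finite_subsets_at_top intro!: exI[of _ "{}"] M_sum assms(2))
qed simp

lemma \<Lambda>_infsum:
  assumes f: "f summable_on A" "\<And>i. i \<in> A \<Longrightarrow> f i \<in> M"
  shows "((\<lambda>i. \<Lambda> (f i)) has_sum \<Lambda> (infsum f A)) A"
proof -
  obtain C where C: "\<And>x. x \<in> M \<Longrightarrow> norm (\<Lambda> x) \<le> C * norm x" using \<Lambda>_bounded by blast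
  have sM: "infsum f A \<in> M" by (rule infsum_in_M[OF f])
  have lim: "(sum f \<longlongrightarrow> infsum f A) (finite_subsets_at_top A)"
    using has_sum_infsum[OF f(1)] by (simp add: has_sum_def)
  have "((\<lambda>F. C * norm (sum f F - infsum f A)) \<longlongrightarrow> C * norm (infsum f A - infsum f A)) (finite_subsets_at_top A)"
    by (intro tendsto_intros lim)
  then have null: "((\<lambda>F. C * norm (sum f F - infsum f A)) \<longlongrightarrow> 0) (finite_subsets_at_top A)" by simp
  have \<Lambda>sum: "\<Lambda> (sum f F) = (\<Sum>i\<in>F. \<Lambda> (f i))" if "F \<subseteq> A" for F
    using that f(2) by (induction F rule: infinite_finite_induct) (auto simp: \<Lambda>_zero \<Lambda>_add M_sum subset_iff)
  have "((\<lambda>F. (\<Sum>i\<in>F. \<Lambda> (f i)) - \<Lambda> (infsum f A)) \<longlongrightarrow> 0) (finite_subsets_at_top A)"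
  proof (rule Lim_null_comparison[OF _ null])
    have "norm ((\<Sum>i\<in>F. \<Lambda> (f i)) - \<Lambda> (infsum f A)) \<le> C * norm (sum f F - infsum f A)" if F: "F \<subseteq> A" for F
    proof -
      have FM: "sum f F \<in> M" using F f(2) by (intro M_sum) auto
      have "(\<Sum>i\<in>F. \<Lambda> (f i)) - \<Lambda> (infsum f A) = \<Lambda> (sum f F - infsum f A)"
        by (simp add: \<Lambda>_diff FM sM \<Lambda>sum F)
      then show ?thesis using C[OF M_minus[OF FM sM]] by simp
    qed
    then show "\<forall>\<^sub>F F in finite_subsets_at_top A. norm ((\<Sum>i\<in>F. \<Lambda> (f i)) - \<Lambda> (infsum f A)) \<le> C * norm (sum f F - infsum f A)"
      by (auto simp: eventually_finite_subsets_at_top intro!: exI[of _ "{}"])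
  qed
  then show ?thesis unfolding has_sum_def by (rule LIM_zero_cancel)
qed

lemma ev_summable:
  assumes "c \<in> nc_conv \<rho>" "R \<le> \<rho>"
  shows "(\<lambda>w. norm (op_scale (c w) (wd w))) summable_on UNIV" "(\<lambda>w. op_scale (c w) (wd w)) summable_on UNIV"
    and "norm (ev c) \<le> nc_norm \<rho> c"
proof -
  have le: "norm (op_scale (c w) (wd w)) \<le> cmod (c w) * \<rho> ^ length w" for w
  proof -
    have "norm (op_scale (c w) (wd w)) \<le> cmod (c w) * norm (wd w)" by (rule norm_op_scale_le)
    also have "\<dots> \<le> cmod (c w) * R ^ length w" by (intro mult_left_mono norm_wd) auto
    also have "\<dots> \<le> cmod (c w) * \<rho> ^ length w" using assms R by (intro mult_left_mono power_mono) auto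
    finally show ?thesis .
  qed
  show s: "(\<lambda>w. norm (op_scale (c w) (wd w))) summable_on UNIV"
    by (rule summable_on_comparison_test[OF assms(1)[unfolded nc_conv_iff]]) (use le in auto)
  then show "(\<lambda>w. op_scale (c w) (wd w)) summable_on UNIV" by (rule abs_summable_summable)
  have "norm (ev c) \<le> (\<Sum>\<^sub>\<infinity>w. norm (op_scale (c w) (wd w)))" unfolding nc_eval_def by (rule norm_infsum_bound[OF s])
  also have "\<dots> \<le> nc_norm \<rho> c" unfolding nc_norm_def by (rule infsum_mono[OF s assms(1)[unfolded nc_conv_iff] le])
  finally show "norm (ev c) \<le> nc_norm \<rho> c" .
qed

text \<open>A radius of convergence may be lowered to at most \<open>R1\<close>, so that the series
  of \<open>K\<close> converge on it too.\<close>

lemma gtD: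
  assumes "c \<in> nc_conv_gt R" shows "\<exists>\<rho>. R < \<rho> \<and> \<rho> \<le> R1 \<and> c \<in> nc_conv \<rho>"
proof -
  obtain \<rho> where "R < \<rho>" "c \<in> nc_conv \<rho>" using assms by (auto simp: nc_conv_gt_def)
  then show ?thesis using R1 R nc_conv_mono(1)[of c \<rho> "min \<rho> R1"] by (intro exI[of _ "min \<rho> R1"]) auto
qed

lemma gtD2:
  assumes "c \<in> nc_conv_gt R" "d \<in> nc_conv_gt R"
  shows "\<exists>\<rho>. R < \<rho> \<and> \<rho> \<le> R1 \<and> c \<in> nc_conv \<rho> \<and> d \<in> nc_conv \<rho>"
proof -
  obtain \<rho> \<rho>' where "R < \<rho>" "\<rho> \<le> R1" "c \<in> nc_conv \<rho>" "R < \<rho>'" "\<rho>' \<le> R1" "d \<in> nc_conv \<rho>'"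
    using gtD[OF assms(1)] gtD[OF assms(2)] by blast
  then show ?thesis using R nc_conv_mono(1)[of c \<rho> "min \<rho> \<rho>'"] nc_conv_mono(1)[of d \<rho>' "min \<rho> \<rho>'"]
    by (intro exI[of _ "min \<rho> \<rho>'"]) auto
qed

lemma gtI: "c \<in> nc_conv \<rho> \<Longrightarrow> R < \<rho> \<Longrightarrow> c \<in> nc_conv_gt R"
  by (auto simp: nc_conv_gt_def)

lemma evM: "c \<in> nc_conv_gt R \<Longrightarrow> ev c \<in> M"
proof -
  assume "c \<in> nc_conv_gt R"
  then obtain \<rho> where "R < \<rho>" "c \<in> nc_conv \<rho>" using gtD by blast
  then show ?thesis unfolding nc_eval_def by (intro infsum_in_M M_scale wdM ev_summable(2)[of c \<rho>]) auto
qed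

lemma Kt: "Kt j \<in> nc_conv_gt R" "ev (Kt j) = K j"
  using the_inv_into_into[OF inj KA subset_refl] f_the_inv_into_f[OF inj KA] by (auto simp: nc_eval_inv_def)

lemma KM: "K j \<in> M"
  using evM[OF Kt(1)] by (simp add: Kt(2))

lemma Kh: "hadj (K j) = K j"
  using Ka[of j] adj_eq_hadj[OF M_clinear[OF KM], of j] by simp

lemma norm_K: "norm (K j) \<le> B"
  using ev_summable(3)[OF K1, of j] B[of j] R1 by (simp add: Kt(2))

lemma dwM: "dw w \<in> M"
  by (induction w) (auto simp: M_zero M_plus M_compose YM KM wdM)

lemma norm_op_scale_dw:
  assumes "R < \<rho>"
  shows "norm (op_scale c (dw w)) \<le> B / (\<rho> - R) * (cmod c * \<rho> ^ length w)"
proof -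
  have "real (length w) * R ^ (length w - 1) \<le> \<rho> ^ length w / (\<rho> - R)"
  proof (cases "length w")
    case (Suc n)
    have "real (Suc n) * R ^ n * (\<rho> - R) \<le> \<rho> ^ Suc n" by (rule derivative_power_bound) (use assms R in auto)
    then show ?thesis unfolding Suc diff_Suc_1 using assms by (subst pos_le_divide_eq) simp_all
  qed (use assms in auto)
  then have "B * (real (length w) * R ^ (length w - 1)) \<le> B * (\<rho> ^ length w / (\<rho> - R))"
    using B0 by (intro mult_left_mono) auto
  moreover have "norm (dw w) \<le> B * (real (length w) * R ^ (length w - 1))"
    by (rule norm_word_der_le) (use YR R norm_K B0 in auto)
  ultimately have "norm (dw w) \<le> B * (\<rho> ^ length w / (\<rho> - R))" by linarith
  then have "cmod c * norm (dw w) \<le> cmod c * (B * (\<rho> ^ length w / (\<rho> - R)))" by (intro mult_left_mono) auto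
  then show ?thesis using norm_op_scale_le[of c "dw w"] by (simp add: mult_ac)
qed

lemma dw_summable:
  assumes "c \<in> nc_conv \<rho>" "R < \<rho>"
  shows "(\<lambda>w. norm (op_scale (c w) (dw w))) summable_on UNIV"
proof (rule summable_on_comparison_test)
  show "(\<lambda>w. B / (\<rho> - R) * (cmod (c w) * \<rho> ^ length w)) summable_on UNIV"
    by (rule summable_on_cmult_right[OF assms(1)[unfolded nc_conv_iff]])
qed (use norm_op_scale_dw[OF assms(2)] in simp_all)

lemma Dt_conv:
  assumes "c \<in> nc_conv \<rho>'" "R \<le> \<rho>" "\<rho> < \<rho>'" "\<rho>' \<le> R1"
  shows "Dt c \<in> nc_conv \<rho>" "nc_norm \<rho> (Dt c) \<le> B / (\<rho>' - \<rho>) * nc_norm \<rho>' c"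
proof -
  have \<rho>: "0 < \<rho>" "0 \<le> \<rho>" "\<rho> \<le> R1" using assms R by auto
  note m = nc_conv_mono[OF K1 \<rho>(2,3)]
  show "Dt c \<in> nc_conv \<rho>" "nc_norm \<rho> (Dt c) \<le> B / (\<rho>' - \<rho>) * nc_norm \<rho>' c"
    by (rule nc_derivation_conv[OF assms(1) m(1) order_trans[OF m(2) B] \<rho>(1) assms(3)])+
qed

text \<open>After evaluation the derivation acts term by term through the operators
  \<open>dw w\<close>. Linearity, the Leibniz rule and skew-symmetry of \<open>\<delta>\<close>
  thereby reduce to statements about words.\<close>

lemma ev_Dt:
  assumes c: "c \<in> nc_conv_gt R"
  shows "ev (Dt c) = (\<Sum>\<^sub>\<infinity>w. op_scale (c w) (dw w))"
proof -
  obtain \<rho>' where \<rho>': "R < \<rho>'" "\<rho>' \<le> R1" "c \<in> nc_conv \<rho>'" using gtD[OF c] by blast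
  \<comment> \<open>The radius \<open>R\<close> itself suffices for evaluation, as every
    \<open>Y j\<close> has norm at most \<open>R\<close>; \<open>c\<close> converges strictly beyond
    it, which pays for one derivation.\<close>
  have KR: "Kt j \<in> nc_conv R" "nc_norm R (Kt j) \<le> B" for j
    using nc_conv_mono[OF K1, of R j] B[of j] R R1 by auto
  note ds = der_summable(1)[OF \<rho>'(3) KR R \<rho>'(1)]
  note fs = fibre_series(1)[OF R ds]
  let ?z = "der_coeff Kt c"
  let ?h = "\<lambda>i. op_scale (?z i) (wd (der_word i))"
  have "norm (?h i) \<le> cmod (?z i) * R ^ length (der_word i)" for i
    by (rule order_trans[OF norm_op_scale_le mult_left_mono[OF norm_wd]]) simp
  then have abs: "(\<lambda>i. norm (?h i)) summable_on der_index"
    by (intro summable_on_comparison_test[OF ds]) auto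
  then have s: "?h summable_on der_index" by (rule abs_summable_summable)
  have row: "(\<Sum>\<^sub>\<infinity>p\<in>{..<length w} \<times> UNIV. ?h (w, p)) = op_scale (c w) (dw w)" for w
  proof -
    have "(\<lambda>p. norm (?h (w, p))) summable_on {..<length w} \<times> UNIV"
      using Infinite_Sum.abs_summable_on_Sigma_iff[THEN iffD1, OF abs[unfolded der_index_def]] by blast
    then have "(\<lambda>p. ?h (w, p)) summable_on {..<length w} \<times> UNIV" by (rule abs_summable_summable)
    then have "(\<Sum>\<^sub>\<infinity>p\<in>{..<length w} \<times> UNIV. ?h (w, p)) = (\<Sum>\<^sub>\<infinity>k\<in>{..<length w}. \<Sum>\<^sub>\<infinity>u. ?h (w, k, u))"
      by (rule infsum_Sigma_banach[symmetric])
    also have "\<dots> = (\<Sum>k<length w. \<Sum>\<^sub>\<infinity>u. ?h (w, k, u))" by simp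
    also have "\<dots> = (\<Sum>k<length w. op_scale (c w) (wd (take k w) o\<^sub>L (K (w ! k) o\<^sub>L wd (drop (Suc k) w))))"
    proof (rule sum.cong[OF refl])
      fix k
      let ?L = "\<lambda>T. op_scale (c w) (wd (take k w) o\<^sub>L (T o\<^sub>L wd (drop (Suc k) w)))"
      have L: "bounded_linear ?L"
        by (rule bounded_linear_compose[OF bounded_linear_op_scale_right
            bounded_linear_compose[OF bounded_bilinear.bounded_linear_right[OF bounded_bilinear_blinfun_compose]
              bounded_bilinear.bounded_linear_left[OF bounded_bilinear_blinfun_compose]]])
      have "(\<Sum>\<^sub>\<infinity>u. ?h (w, k, u)) = (\<Sum>\<^sub>\<infinity>u. ?L (op_scale (Kt (w ! k) u) (wd u)))"
        by (rule infsum_cong)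
          (simp add: der_coeff_def der_word_def word_op_append op_scale_simps wd_clinear blinfun_compose_assoc)
      also have "\<dots> = ?L (ev (Kt (w ! k)))"
        unfolding nc_eval_def by (rule infsum_linear(2)[OF L ev_summable(2)[OF KR(1)]]) simp
      finally show "(\<Sum>\<^sub>\<infinity>u. ?h (w, k, u)) = ?L (K (w ! k))" by (simp only: Kt(2))
    qed
    also have "\<dots> = op_scale (c w) (dw w)"
      unfolding word_der_sum by (rule linear_sum[OF bounded_linear.linear[OF bounded_linear_op_scale_right], symmetric])
    finally show ?thesis .
  qed
  have "ev (Dt c) = (\<Sum>\<^sub>\<infinity>v. op_scale (infsum ?z {i\<in>der_index. der_word i = v}) (wd v))"
    unfolding nc_eval_def nc_derivation_fibres[OF fs] ..
  also have "\<dots> = infsum ?h der_index" by (rule infsum_op_scale_fibres[OF fs s])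
  also have "\<dots> = (\<Sum>\<^sub>\<infinity>w. \<Sum>\<^sub>\<infinity>p\<in>{..<length w} \<times> UNIV. ?h (w, p))"
    unfolding der_index_def by (rule infsum_Sigma_banach[symmetric]) (use s in \<open>simp add: der_index_def\<close>)
  finally show ?thesis by (simp only: row)
qed

text \<open>The Leibniz rule is obtained only after evaluation, from \<open>word_der_append\<close>
  and absolute convergence of products of series; no identity between formal derivations is
  proved.\<close>

lemma ev_mult:
  assumes f: "f \<in> nc_conv_gt R" and g: "g \<in> nc_conv_gt R"
  shows "nc_mult f g \<in> nc_conv_gt R" "ev (nc_mult f g) = ev f o\<^sub>L ev g"
    and "ev (Dt (nc_mult f g)) = (ev (Dt f) o\<^sub>L ev g) + (ev f o\<^sub>L ev (Dt g))"
proof -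
  obtain \<rho> where \<rho>: "R < \<rho>" "\<rho> \<le> R1" "f \<in> nc_conv \<rho>" "g \<in> nc_conv \<rho>" using gtD2[OF f g] by blast
  have \<rho>0: "\<rho> > 0" using \<rho> R by simp
  let ?z = "\<lambda>p. f (fst p) * g (snd p)" and ?\<omega> = "\<lambda>p :: 'n list \<times> 'n list. fst p @ snd p"
  note fs = fibre_series(1)[OF \<rho>0 nc_mult_summable[OF \<rho>(3,4) \<rho>0]]
  show fg: "nc_mult f g \<in> nc_conv_gt R" using nc_mult_conv[OF \<rho>(3,4) \<rho>0] \<rho>(1) by (rule gtI)
  note bil = infsum_bilinear_product[OF bounded_bilinear_blinfun_compose, where A=UNIV and B=UNIV, unfolded UNIV_Times_UNIV]
  note sf = ev_summable(1)[OF \<rho>(3) less_imp_le[OF \<rho>(1)]] and sg = ev_summable(1)[OF \<rho>(4) less_imp_le[OF \<rho>(1)]]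
  note df = dw_summable[OF \<rho>(3,1)] and dg = dw_summable[OF \<rho>(4,1)]
  have z: "op_scale (?z p) (wd (?\<omega> p)) = op_scale (f (fst p)) (wd (fst p)) o\<^sub>L op_scale (g (snd p)) (wd (snd p))" for p
    by (simp add: word_op_append op_scale_simps wd_clinear mult.commute)
  have "ev (nc_mult f g) = (\<Sum>\<^sub>\<infinity>p. op_scale (?z p) (wd (?\<omega> p)))"
    unfolding nc_eval_def nc_mult_fibres
    by (rule infsum_op_scale_fibres[OF fs]) (use abs_summable_summable[OF bil(1)[OF sf sg]] in \<open>simp only: z\<close>)
  also have "\<dots> = ev f o\<^sub>L ev g" unfolding z nc_eval_def by (rule bil(2)[OF sf sg])
  finally show "ev (nc_mult f g) = ev f o\<^sub>L ev g" .
  have dz: "op_scale (?z p) (dw (?\<omega> p)) = (op_scale (f (fst p)) (dw (fst p)) o\<^sub>L op_scale (g (snd p)) (wd (snd p)))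
      + (op_scale (f (fst p)) (wd (fst p)) o\<^sub>L op_scale (g (snd p)) (dw (snd p)))" for p
    by (simp add: word_der_append op_scale_simps wd_clinear M_clinear[OF dwM] mult.commute)
  note s1 = abs_summable_summable[OF bil(1)[OF df sg]] and s2 = abs_summable_summable[OF bil(1)[OF sf dg]]
  have "ev (Dt (nc_mult f g)) = (\<Sum>\<^sub>\<infinity>p. op_scale (?z p) (dw (?\<omega> p)))"
    unfolding ev_Dt[OF fg] nc_mult_fibres
    by (rule infsum_op_scale_fibres[OF fs]) (use summable_on_add[OF s1 s2] in \<open>simp only: dz\<close>)
  also have "\<dots> = (\<Sum>\<^sub>\<infinity>p. op_scale (f (fst p)) (dw (fst p)) o\<^sub>L op_scale (g (snd p)) (wd (snd p)))
      + (\<Sum>\<^sub>\<infinity>p. op_scale (f (fst p)) (wd (fst p)) o\<^sub>L op_scale (g (snd p)) (dw (snd p)))"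
    unfolding dz by (rule infsum_add[OF s1 s2])
  also have "\<dots> = (ev (Dt f) o\<^sub>L ev g) + (ev f o\<^sub>L ev (Dt g))"
    by (simp only: bil(2)[OF df sg] bil(2)[OF sf dg] ev_Dt[OF f] ev_Dt[OF g]) (simp only: nc_eval_def)
  finally show "ev (Dt (nc_mult f g)) = (ev (Dt f) o\<^sub>L ev g) + (ev f o\<^sub>L ev (Dt g))" .
qed

end

lemma power_over_fact_le_exp: "0 \<le> x \<Longrightarrow> x ^ n / fact n \<le> exp (x :: real)"
proof -
  assume x: "0 \<le> x"
  have "(\<Sum>k\<in>{n}. inverse (fact k) * x ^ k) \<le> (\<Sum>k. inverse (fact k) * x ^ k)"
    by (rule sum_le_suminf[OF summable_exp]) (use x in auto)
  then show ?thesis by (simp add: exp_def divide_inverse scaleR_conv_of_real mult.commute)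
qed

lemma binomial_sum_step:
  fixes f :: "nat \<Rightarrow> nat \<Rightarrow> 'v::real_vector"
  shows "(\<Sum>k\<le>N. real (N choose k) *\<^sub>R (f (Suc k) (N - k) + f k (Suc (N - k))))
    = (\<Sum>k\<le>Suc N. real (Suc N choose k) *\<^sub>R f k (Suc N - k))"
proof -
  let ?g = "\<lambda>k. f k (Suc N - k)"
  have "(\<Sum>k\<le>Suc N. real (Suc N choose k) *\<^sub>R ?g k) = ?g 0 + (\<Sum>k\<le>N. real (Suc N choose Suc k) *\<^sub>R ?g (Suc k))"
    by (subst sum.atMost_Suc_shift) simp
  also have "\<dots> = (\<Sum>k\<le>N. real (N choose k) *\<^sub>R ?g (Suc k)) + (?g 0 + (\<Sum>k\<le>N. real (N choose Suc k) *\<^sub>R ?g (Suc k)))"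
    by (simp add: scaleR_add_left sum.distrib algebra_simps)
  also have "?g 0 + (\<Sum>k\<le>N. real (N choose Suc k) *\<^sub>R ?g (Suc k)) = (\<Sum>k\<le>Suc N. real (N choose k) *\<^sub>R ?g k)"
    by (subst sum.atMost_Suc_shift) simp
  also have "\<dots> = (\<Sum>k\<le>N. real (N choose k) *\<^sub>R ?g k)" by simp
  also have "\<dots> = (\<Sum>k\<le>N. real (N choose k) *\<^sub>R f k (Suc (N - k)))"
    by (rule sum.cong) (auto simp: Suc_diff_le)
  finally show ?thesis by (simp add: scaleR_add_right sum.distrib)
qed

section \<open>Skew-symmetry of the derivation, growth of its iterates, analytic elements\<close>

context nc_flow
begin

abbreviation "A \<equiv> ev ` nc_conv_gt R"
abbreviation "\<delta> \<equiv> D_eps R Y K"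

text \<open>Injectivity of the evaluation makes the derivation on operators read off from any
  convergent series that represents them.\<close>

lemma \<delta>_ev: "c \<in> nc_conv_gt R \<Longrightarrow> \<delta> (ev c) = ev (Dt c)"
  by (simp add: D_eps_def nc_eval_inv_def the_inv_into_f_f[OF inj])

lemma Dt_gt: assumes "c \<in> nc_conv_gt R" shows "Dt c \<in> nc_conv_gt R"
proof -
  obtain \<rho> where \<rho>: "R < \<rho>" "\<rho> \<le> R1" "c \<in> nc_conv \<rho>" using gtD[OF assms] by blast
  have "Dt c \<in> nc_conv ((R + \<rho>) / 2)" by (rule Dt_conv(1)[OF \<rho>(3) _ _ \<rho>(2)]) (use \<rho> in auto)
  then show ?thesis by (rule gtI) (use \<rho> in simp)
qed

lemma A_M: "a \<in> A \<Longrightarrow> a \<in> M"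
  using evM by blast

lemma \<delta>A: "a \<in> A \<Longrightarrow> \<delta> a \<in> A"
  using \<delta>_ev Dt_gt by auto

lemma A_add: assumes "a \<in> A" "b \<in> A" shows "a + b \<in> A" "\<delta> (a + b) = \<delta> a + \<delta> b"
proof -
  obtain c d where c: "c \<in> nc_conv_gt R" "a = ev c" and d: "d \<in> nc_conv_gt R" "b = ev d" using assms by blast
  obtain \<rho> where \<rho>: "R < \<rho>" "\<rho> \<le> R1" "c \<in> nc_conv \<rho>" "d \<in> nc_conv \<rho>" using gtD2[OF c(1) d(1)] by blast
  let ?s = "\<lambda>w. c w + d w"
  have "(\<lambda>w. cmod (c w) * \<rho> ^ length w + cmod (d w) * \<rho> ^ length w) summable_on UNIV"
    using \<rho> unfolding nc_conv_iff by (intro summable_on_add) auto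
  then have "?s \<in> nc_conv \<rho>" unfolding nc_conv_iff
    by (rule summable_on_comparison_test) (use \<rho> R in \<open>auto simp: distrib_right[symmetric] intro!: mult_right_mono norm_triangle_ineq\<close>)
  then have s: "?s \<in> nc_conv_gt R" using \<rho>(1) by (rule gtI)
  have e: "ev ?s = a + b"
    unfolding c d nc_eval_def op_scale_simps
    by (rule infsum_add[OF ev_summable(2)[OF \<rho>(3)] ev_summable(2)[OF \<rho>(4)]]) (use \<rho> in auto)
  show "a + b \<in> A" unfolding e[symmetric] using s by (rule imageI)
  have "ev (Dt ?s) = ev (Dt c) + ev (Dt d)"
    unfolding ev_Dt[OF s] ev_Dt[OF c(1)] ev_Dt[OF d(1)] op_scale_simps
    by (rule infsum_add[OF abs_summable_summable[OF dw_summable[OF \<rho>(3,1)]] abs_summable_summable[OF dw_summable[OF \<rho>(4,1)]]])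
  then show "\<delta> (a + b) = \<delta> a + \<delta> b"
    unfolding e[symmetric] \<delta>_ev[OF s] by (simp add: c d \<delta>_ev)
qed

lemma A_scale: assumes "a \<in> A" shows "op_scale k a \<in> A" "\<delta> (op_scale k a) = op_scale k (\<delta> a)"
proof -
  obtain c where c: "c \<in> nc_conv_gt R" "a = ev c" using assms by blast
  obtain \<rho> where \<rho>: "R < \<rho>" "\<rho> \<le> R1" "c \<in> nc_conv \<rho>" using gtD[OF c(1)] by blast
  let ?s = "\<lambda>w. k * c w"
  have "(\<lambda>w. cmod k * (cmod (c w) * \<rho> ^ length w)) summable_on UNIV"
    using \<rho> unfolding nc_conv_iff by (intro summable_on_cmult_right) auto
  then have "?s \<in> nc_conv \<rho>" unfolding nc_conv_iff by (simp add: norm_mult mult.assoc)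
  then have s: "?s \<in> nc_conv_gt R" using \<rho>(1) by (rule gtI)
  have e: "ev ?s = op_scale k a"
    unfolding c nc_eval_def op_scale_simps(3)[symmetric]
    by (rule infsum_linear(2)[OF bounded_linear_op_scale_right ev_summable(2)[OF \<rho>(3)]]) (use \<rho> in auto)
  show "op_scale k a \<in> A" unfolding e[symmetric] using s by (rule imageI)
  have "ev (Dt ?s) = op_scale k (ev (Dt c))"
    unfolding ev_Dt[OF s] ev_Dt[OF c(1)] op_scale_simps(3)[symmetric]
    by (rule infsum_linear(2)[OF bounded_linear_op_scale_right abs_summable_summable[OF dw_summable[OF \<rho>(3,1)]]])
  then show "\<delta> (op_scale k a) = op_scale k (\<delta> a)"
    unfolding e[symmetric] \<delta>_ev[OF s] by (simp add: c \<delta>_ev)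
qed

lemma A_mult: assumes "a \<in> A" "b \<in> A" shows "a o\<^sub>L b \<in> A" "\<delta> (a o\<^sub>L b) = (\<delta> a o\<^sub>L b) + (a o\<^sub>L \<delta> b)"
proof -
  obtain c d where c: "c \<in> nc_conv_gt R" "a = ev c" and d: "d \<in> nc_conv_gt R" "b = ev d" using assms by blast
  note m = ev_mult[OF c(1) d(1)]
  show "a o\<^sub>L b \<in> A" using m(1,2) c d by (metis imageI)
  show "\<delta> (a o\<^sub>L b) = (\<delta> a o\<^sub>L b) + (a o\<^sub>L \<delta> b)"
    unfolding c d m(2)[symmetric] \<delta>_ev[OF m(1)] m(3) \<delta>_ev[OF c(1)] \<delta>_ev[OF d(1)] ..
qed

lemma infsum_monom:
  fixes \<Phi> :: "'n list \<Rightarrow> 'a \<Rightarrow>\<^sub>L 'a"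
  shows "(\<Sum>\<^sub>\<infinity>v. op_scale (nc_monom w v) (\<Phi> v)) = \<Phi> w"
proof -
  have "(\<Sum>\<^sub>\<infinity>v. op_scale (nc_monom w v) (\<Phi> v)) = (\<Sum>\<^sub>\<infinity>v\<in>{w}. op_scale (nc_monom w v) (\<Phi> v))"
    by (rule infsum_cong_neutral) (auto simp: nc_monom_def op_scale_simps)
  then show ?thesis by (simp add: nc_monom_def op_scale_simps)
qed

lemma monom_conv: "nc_monom w \<in> nc_conv \<rho>"
proof -
  have "(\<lambda>v. cmod (nc_monom w v) * \<rho> ^ length v) summable_on {w}" by simp
  then show ?thesis unfolding nc_conv_iff
    by (rule summable_on_cong_neutral[THEN iffD1, rotated -1]) (auto simp: nc_monom_def)
qed

lemma ev_monom: "nc_monom w \<in> nc_conv_gt R" "ev (nc_monom w) = wd w" "\<delta> (wd w) = dw w"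
proof -
  show g: "nc_monom w \<in> nc_conv_gt R" using monom_conv R1 by (rule gtI)
  show e: "ev (nc_monom w) = wd w" unfolding nc_eval_def by (rule infsum_monom)
  show "\<delta> (wd w) = dw w" unfolding e[symmetric] \<delta>_ev[OF g] ev_Dt[OF g] by (rule infsum_monom)
qed

lemma \<tau>_sum: "(\<And>i. i \<in> I \<Longrightarrow> f i \<in> M) \<Longrightarrow> \<tau> (sum f I) = (\<Sum>i\<in>I. \<tau> (f i))"
proof (induction I rule: infinite_finite_induct)
  case (insert i I)
  then show ?case using trace by (simp add: normal_faithful_trace_state_def M_sum)
qed (use cinner_\<Lambda>[OF M_zero M_id] in \<open>simp_all add: \<Lambda>_zero\<close>)

lemma \<tau>_commute: "x \<in> M \<Longrightarrow> y \<in> M \<Longrightarrow> \<tau> (x o\<^sub>L y) = \<tau> (y o\<^sub>L x)"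
  using trace by (simp add: normal_faithful_trace_state_def)

text \<open>The hypothesis on the cyclic gradient is applied to the single monomial
  \<open>w\<close>. Cyclicity of the trace moves the tail of \<open>w\<close> back behind the
  inserted \<open>K j\<close>, and the sum over all letters becomes the trace of the derivation of
  \<open>w\<close>.\<close>

lemma \<tau>_word_der: "\<tau> (dw w) = 0"
proof -
  let ?I = "\<lambda>j. {k. k < length w \<and> w ! k = j}"
  let ?om = "\<lambda>k. drop (Suc k) w @ take k w"
  have ev_cd: "ev (cyclic_deriv j (nc_monom w)) = (\<Sum>k\<in>?I j. wd (?om k))" for j
  proof -
    have "{v. nc_monom w v \<noteq> 0} = {w}" by (auto simp: nc_monom_def)
    then have "cyclic_deriv j (nc_monom w) = (\<lambda>v. \<Sum>k\<in>?I j. nc_monom (?om k) v)"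
      by (simp add: cyclic_deriv_def cyclic_deriv_word_def) (simp add: nc_monom_def)
    \<comment> \<open>Different positions can give the same rotated word; writing the coefficient as
      a count over a fibre keeps the multiplicity and fits
      \<open>infsum_op_scale_fibres\<close>.\<close>
    moreover have "(\<Sum>k\<in>?I j. nc_monom (?om k) v) = infsum (\<lambda>_. 1) {k\<in>?I j. ?om k = v}" for v
    proof -
      have "(\<Sum>k\<in>?I j. nc_monom (?om k) v) = (\<Sum>k\<in>?I j. if ?om k = v then 1 else 0)"
        by (rule sum.cong) (auto simp: nc_monom_def)
      also have "\<dots> = (\<Sum>k\<in>{k\<in>?I j. ?om k = v}. 1)" by (rule sum.inter_filter[symmetric]) simp
      also have "\<dots> = infsum (\<lambda>_. 1) {k\<in>?I j. ?om k = v}" by (rule infsum_finite[symmetric]) simp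
      finally show ?thesis .
    qed
    ultimately have cd: "cyclic_deriv j (nc_monom w) = (\<lambda>v. infsum (\<lambda>_. 1) {k\<in>?I j. ?om k = v})" by simp
    have "ev (cyclic_deriv j (nc_monom w)) = (\<Sum>\<^sub>\<infinity>k\<in>?I j. op_scale 1 (wd (?om k)))"
      unfolding cd nc_eval_def by (rule infsum_op_scale_fibres) auto
    also have "\<dots> = (\<Sum>k\<in>?I j. wd (?om k))" by (simp add: op_scale_simps)
    finally show ?thesis .
  qed
  have "nc_monom w \<in> nc_polys" by (auto simp: nc_polys_def nc_monom_def)
  then have "0 = (\<Sum>j\<in>UNIV. \<tau> (ev (cyclic_deriv j (nc_monom w)) o\<^sub>L K j))"
    using tp by (simp add: trace_preserving_def)
  also have "\<dots> = (\<Sum>j\<in>UNIV. \<Sum>k\<in>?I j. \<tau> (wd (take k w) o\<^sub>L (K (w ! k) o\<^sub>L wd (drop (Suc k) w))))"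
  proof (rule sum.cong[OF refl])
    fix j
    have "ev (cyclic_deriv j (nc_monom w)) o\<^sub>L K j = (\<Sum>k\<in>?I j. wd (?om k) o\<^sub>L K j)"
      unfolding ev_cd by (rule linear_sum[OF bounded_linear.linear[OF bounded_bilinear.bounded_linear_left[OF bounded_bilinear_blinfun_compose]]])
    then have "\<tau> (ev (cyclic_deriv j (nc_monom w)) o\<^sub>L K j) = (\<Sum>k\<in>?I j. \<tau> (wd (?om k) o\<^sub>L K j))"
      by (simp add: \<tau>_sum M_compose wdM KM)
    also have "\<dots> = (\<Sum>k\<in>?I j. \<tau> (wd (take k w) o\<^sub>L (K (w ! k) o\<^sub>L wd (drop (Suc k) w))))"
    proof (rule sum.cong[OF refl])
      fix k assume "k \<in> ?I j"
      then have j: "w ! k = j" by simp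
      have "wd (?om k) o\<^sub>L K j = wd (drop (Suc k) w) o\<^sub>L (wd (take k w) o\<^sub>L K j)"
        by (simp add: word_op_append blinfun_compose_assoc)
      then have "\<tau> (wd (?om k) o\<^sub>L K j) = \<tau> ((wd (take k w) o\<^sub>L K j) o\<^sub>L wd (drop (Suc k) w))"
        using \<tau>_commute[OF wdM M_compose[OF wdM KM]] by simp
      then show "\<tau> (wd (?om k) o\<^sub>L K j) = \<tau> (wd (take k w) o\<^sub>L (K (w ! k) o\<^sub>L wd (drop (Suc k) w)))"
        by (simp only: j blinfun_compose_assoc)
    qed
    finally show "\<tau> (ev (cyclic_deriv j (nc_monom w)) o\<^sub>L K j) = (\<Sum>k\<in>?I j. \<tau> (wd (take k w) o\<^sub>L (K (w ! k) o\<^sub>L wd (drop (Suc k) w))))" .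
  qed
  \<comment> \<open>The positions of \<open>w\<close> are regrouped: every position belongs to
    exactly one letter \<open>j\<close>.\<close>
  also have "\<dots> = (\<Sum>k<length w. \<tau> (wd (take k w) o\<^sub>L (K (w ! k) o\<^sub>L wd (drop (Suc k) w))))"
    using sum.group[of "{..<length w}" UNIV "\<lambda>k. w ! k" "\<lambda>k. \<tau> (wd (take k w) o\<^sub>L (K (w ! k) o\<^sub>L wd (drop (Suc k) w)))"]
    by (simp only: lessThan_iff finite_lessThan finite subset_UNIV simp_thms True_implies_equals)
  also have "\<dots> = \<tau> (dw w)"
    unfolding word_der_sum by (rule \<tau>_sum[symmetric]) (simp add: M_compose wdM KM)
  finally show ?thesis by simp
qed

lemma K_clinear: "clinear_op (K j)"
  by (rule M_clinear[OF KM])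

text \<open>Leibniz rule for the vanishing trace of the derivation of \<open>rev u @ w\<close>.
  Selfadjointness of \<open>Y\<close> and \<open>K\<close> enters because the adjoint of
  \<open>dw u\<close> must be \<open>dw (rev u)\<close>.\<close>

lemma skew_words: "cinner (\<Lambda> (dw w)) (\<Lambda> (wd u)) = - cinner (\<Lambda> (wd w)) (\<Lambda> (dw u))"
proof -
  have "0 = \<tau> (dw (rev u @ w))" by (simp add: \<tau>_word_der)
  also have "\<dots> = \<tau> (dw (rev u) o\<^sub>L wd w) + \<tau> (wd (rev u) o\<^sub>L dw w)"
    using trace by (simp add: word_der_append normal_faithful_trace_state_def M_compose wdM dwM)
  also have "\<tau> (wd (rev u) o\<^sub>L dw w) = cinner (\<Lambda> (dw w)) (\<Lambda> (wd u))"
    by (simp add: cinner_\<Lambda> wdM dwM hadj_word_op[OF Y_clinear Yh])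
  also have "\<tau> (dw (rev u) o\<^sub>L wd w) = cinner (\<Lambda> (wd w)) (\<Lambda> (dw u))"
    by (simp add: cinner_\<Lambda> wdM dwM hadj_word_der[OF Y_clinear K_clinear Yh Kh])
  finally show ?thesis by (simp add: eq_neg_iff_add_eq_0 add.commute)
qed

lemma skew_A:
  assumes "a \<in> A" "b \<in> A"
  shows "cinner (\<Lambda> (\<delta> a)) (\<Lambda> b) = - cinner (\<Lambda> a) (\<Lambda> (\<delta> b))"
proof -
  obtain c d where c: "c \<in> nc_conv_gt R" "a = ev c" and d: "d \<in> nc_conv_gt R" "b = ev d" using assms by blast
  obtain \<rho> where \<rho>: "R < \<rho>" "\<rho> \<le> R1" "c \<in> nc_conv \<rho>" "d \<in> nc_conv \<rho>" using gtD2[OF c(1) d(1)] by blast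
  have wsum: "((\<lambda>w. e w *\<^sub>C \<Lambda> (wd w)) has_sum \<Lambda> (ev e)) UNIV" if "e \<in> nc_conv \<rho>" for e
  proof -
    have "((\<lambda>w. \<Lambda> (op_scale (e w) (wd w))) has_sum \<Lambda> (ev e)) UNIV"
      unfolding nc_eval_def by (rule \<Lambda>_infsum[OF ev_summable(2)[OF that]]) (use \<rho> in \<open>auto intro: M_scale wdM\<close>)
    then show ?thesis by (simp add: \<Lambda>_scale wdM)
  qed
  have dsum: "((\<lambda>w. e w *\<^sub>C \<Lambda> (dw w)) has_sum \<Lambda> (ev (Dt e))) UNIV" if "e \<in> nc_conv \<rho>" for e
  proof -
    have "((\<lambda>w. \<Lambda> (op_scale (e w) (dw w))) has_sum \<Lambda> (ev (Dt e))) UNIV"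
      unfolding ev_Dt[OF gtI[OF that \<rho>(1)]]
      by (rule \<Lambda>_infsum[OF abs_summable_summable[OF dw_summable[OF that \<rho>(1)]]]) (auto intro: M_scale dwM)
    then show ?thesis by (simp add: \<Lambda>_scale dwM)
  qed
  have inner: "cinner (\<Lambda> (dw w)) (\<Lambda> b) = - cinner (\<Lambda> (wd w)) (\<Lambda> (\<delta> b))" for w
  proof (rule has_sum_unique)
    show "((\<lambda>u. cinner (\<Lambda> (dw w)) (d u *\<^sub>C \<Lambda> (wd u))) has_sum cinner (\<Lambda> (dw w)) (\<Lambda> b)) UNIV"
      unfolding d(2) by (rule has_sum_bounded_linear[OF bounded_linear_cinner_right wsum[OF \<rho>(4)], unfolded o_def])
    have "((\<lambda>u. - cinner (\<Lambda> (wd w)) (d u *\<^sub>C \<Lambda> (dw u))) has_sum - cinner (\<Lambda> (wd w)) (\<Lambda> (\<delta> b))) UNIV"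
      unfolding d(2) \<delta>_ev[OF d(1)] has_sum_uminus minus_minus
      by (rule has_sum_bounded_linear[OF bounded_linear_cinner_right dsum[OF \<rho>(4)], unfolded o_def])
    then show "((\<lambda>u. cinner (\<Lambda> (dw w)) (d u *\<^sub>C \<Lambda> (wd u))) has_sum - cinner (\<Lambda> (wd w)) (\<Lambda> (\<delta> b))) UNIV"
      by (simp add: cinner_scaleC_right skew_words)
  qed
  show ?thesis
  proof (rule has_sum_unique)
    show "((\<lambda>w. cinner (c w *\<^sub>C \<Lambda> (dw w)) (\<Lambda> b)) has_sum cinner (\<Lambda> (\<delta> a)) (\<Lambda> b)) UNIV"
      unfolding c(2) \<delta>_ev[OF c(1)] by (rule has_sum_bounded_linear[OF bounded_linear_cinner_left dsum[OF \<rho>(3)], unfolded o_def])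
    have "((\<lambda>w. - cinner (c w *\<^sub>C \<Lambda> (wd w)) (\<Lambda> (\<delta> b))) has_sum - cinner (\<Lambda> a) (\<Lambda> (\<delta> b))) UNIV"
      unfolding c(2) has_sum_uminus minus_minus by (rule has_sum_bounded_linear[OF bounded_linear_cinner_left wsum[OF \<rho>(3)], unfolded o_def])
    then show "((\<lambda>w. cinner (c w *\<^sub>C \<Lambda> (dw w)) (\<Lambda> b)) has_sum - cinner (\<Lambda> a) (\<Lambda> (\<delta> b))) UNIV"
      by (simp add: cinner_scaleC_left inner)
  qed
qed

text \<open>Each application gives up a further \<open>h\<close> of the radius and costs a factor
  \<open>B / h\<close>; \<open>n\<close> steps must fit between \<open>R\<close> and
  \<open>R1\<close>.\<close>

lemma Dt_iterate:
  assumes c: "c \<in> nc_conv R1" and h: "h > 0" "R + real n * h \<le> R1"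
  shows "(Dt ^^ n) c \<in> nc_conv (R1 - real n * h) \<and> nc_norm (R1 - real n * h) ((Dt ^^ n) c) \<le> (B / h) ^ n * nc_norm R1 c"
  using h(2)
proof (induction n)
  case (Suc n)
  let ?r = "\<lambda>n. R1 - real n * h"
  have le: "R + real n * h \<le> R1" using Suc.prems h(1) by (simp add: algebra_simps)
  have IH: "(Dt ^^ n) c \<in> nc_conv (?r n)" "nc_norm (?r n) ((Dt ^^ n) c) \<le> (B / h) ^ n * nc_norm R1 c"
    using Suc.IH[OF le] by auto
  have r: "R \<le> ?r (Suc n)" "?r (Suc n) < ?r n" "?r n \<le> R1" "?r n - ?r (Suc n) = h"
    using Suc.prems h(1) by (auto simp: algebra_simps)
  note D = Dt_conv[OF IH(1) r(1-3)]
  have "nc_norm (?r (Suc n)) ((Dt ^^ Suc n) c) \<le> B / h * nc_norm (?r n) ((Dt ^^ n) c)"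
    using D(2) unfolding r(4) by simp
  also have "\<dots> \<le> B / h * ((B / h) ^ n * nc_norm R1 c)" using IH(2) B0 h(1) by (intro mult_left_mono) auto
  finally show ?case using D(1) by simp
qed (use c in simp)

lemma \<delta>_iterate: "c \<in> nc_conv_gt R \<Longrightarrow> (Dt ^^ n) c \<in> nc_conv_gt R \<and> (\<delta> ^^ n) (ev c) = ev ((Dt ^^ n) c)"
  by (induction n) (auto simp: \<delta>_ev Dt_gt)

text \<open>Reciprocal of the geometric growth rate. The loss \<open>(B / h) ^ n\<close> with
  \<open>h = (R1 - R) / (n + 1)\<close> is at most
  \<open>fact n * exp 1 * (B * exp 1 / (R1 - R)) ^ n\<close>, because one term of the exponential
  series gives \<open>(n + 1) ^ n \<le> fact n * exp (n + 1)\<close>.\<close>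

definition r0 :: real where "r0 = (R1 - R) / (B * exp 1)"

lemma r0: "r0 > 0"
  using R1 B0 by (simp add: r0_def)

text \<open>Splitting \<open>[R, R1]\<close> into \<open>n + 1\<close> steps gives a loss of \<open>(n + 1)\<^sup>n\<close>, which is \<open>n!\<close> up to a geometric factor.\<close>

lemma norm_\<delta>_iterate:
  assumes c: "c \<in> nc_conv R1"
  shows "norm ((\<delta> ^^ n) (ev c)) \<le> fact n * (exp 1 * nc_norm R1 c) * (1 / r0) ^ n"
proof -
  define h where "h = (R1 - R) / real (Suc n)"
  have h: "h > 0" using R1 by (simp add: h_def)
  have hs: "R + real n * h + h = R1"
  proof -
    have "real (Suc n) * h = R1 - R" by (simp add: h_def)
    then show ?thesis by (simp add: algebra_simps)
  qed
  have le: "R + real n * h \<le> R1" using hs h by linarith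
  note it = Dt_iterate[OF c h le]
  have N: "nc_norm R1 c \<ge> 0" using R R1 by (intro nc_norm_nonneg) simp
  have "norm ((\<delta> ^^ n) (ev c)) \<le> nc_norm (R1 - real n * h) ((Dt ^^ n) c)"
    using \<delta>_iterate[OF gtI[OF c R1], of n] ev_summable(3)[OF conjunct1[OF it]] hs h by simp
  also have "\<dots> \<le> (B / h) ^ n * nc_norm R1 c" using it by simp
  also have "(B / h) ^ n = (B / (R1 - R)) ^ n * (real (Suc n)) ^ n"
    by (simp add: h_def flip: power_mult_distrib)
  also have "\<dots> \<le> (B / (R1 - R)) ^ n * (fact n * exp (real (Suc n)))"
    using power_over_fact_le_exp[of "real (Suc n)" n] B0 R1 by (intro mult_left_mono) (auto simp: field_simps)
  also have "exp (real (Suc n)) = exp 1 * exp 1 ^ n" by (simp add: exp_of_nat_mult[symmetric] mult_exp_exp)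
  also have "(B / (R1 - R)) ^ n * (fact n * (exp 1 * exp 1 ^ n)) = fact n * exp 1 * (1 / r0) ^ n"
    by (simp add: r0_def power_divide power_mult_distrib)
  finally show ?thesis using N by (simp add: mult_right_mono mult_ac)
qed

text \<open>Neither obvious candidate is preserved by \<open>\<delta>\<close>: polynomials leave
  their class because \<open>K\<close> consists of series, and series on radius \<open>R1\<close>
  lose radius. Defining the space by summability with the common bound \<open>r0\<close> gives an
  algebra that contains all words and is invariant under \<open>\<delta>\<close>.\<close>

definition An :: "('a \<Rightarrow>\<^sub>L 'a) set" where
  "An = {a \<in> A. \<forall>\<rho>. 0 \<le> \<rho> \<and> \<rho> < r0 \<longrightarrow> summable (\<lambda>n. \<rho> ^ n / fact n * norm ((\<delta> ^^ n) a))}"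

lemma AnD: "a \<in> An \<Longrightarrow> a \<in> A" "a \<in> An \<Longrightarrow> 0 \<le> \<rho> \<Longrightarrow> \<rho> < r0 \<Longrightarrow> summable (\<lambda>n. \<rho> ^ n / fact n * norm ((\<delta> ^^ n) a))"
  by (auto simp: An_def)

lemma wd_An: "wd w \<in> An"
  unfolding An_def
proof (intro CollectI conjI allI impI)
  show "wd w \<in> A" using ev_monom(1,2)[of w] by (metis imageI)
  fix \<rho> assume \<rho>: "0 \<le> \<rho> \<and> \<rho> < r0"
  let ?C = "exp 1 * nc_norm R1 (nc_monom w)"
  show "summable (\<lambda>n. \<rho> ^ n / fact n * norm ((\<delta> ^^ n) (wd w)))"
  proof (rule summable_comparison_test')
    show "summable (\<lambda>n. ?C * (\<rho> / r0) ^ n)"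
      using \<rho> r0 by (intro summable_mult summable_geometric) simp
    fix n :: nat
    have "\<rho> ^ n / fact n * norm ((\<delta> ^^ n) (wd w)) \<le> \<rho> ^ n / fact n * (fact n * ?C * (1 / r0) ^ n)"
      using norm_\<delta>_iterate[OF monom_conv[of w R1], of n] \<rho> unfolding ev_monom(2) by (intro mult_left_mono) auto
    also have "\<dots> = ?C * (\<rho> / r0) ^ n" by (simp add: power_divide)
    finally show "norm (\<rho> ^ n / fact n * norm ((\<delta> ^^ n) (wd w))) \<le> ?C * (\<rho> / r0) ^ n" using \<rho> by simp
  qed
qed

lemma \<delta>nA: "a \<in> A \<Longrightarrow> (\<delta> ^^ n) a \<in> A"
  by (induction n) (auto intro!: \<delta>A simp del: image_iff)

lemma \<delta>n_add: "a \<in> A \<Longrightarrow> b \<in> A \<Longrightarrow> (\<delta> ^^ n) (a + b) = (\<delta> ^^ n) a + (\<delta> ^^ n) b"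
  by (induction n) (simp_all add: A_add(2)[OF \<delta>nA \<delta>nA])

lemma \<delta>n_scale: "a \<in> A \<Longrightarrow> (\<delta> ^^ n) (op_scale k a) = op_scale k ((\<delta> ^^ n) a)"
  by (induction n) (simp_all add: A_scale(2)[OF \<delta>nA])

lemma scaleR_op_scale: "r *\<^sub>R T = op_scale (complex_of_real r) (T :: 'c::chilbert_space \<Rightarrow>\<^sub>L 'c)"
  by (rule blinfun_eqI) (simp add: blinfun.scaleR_left scaleR_eq_scaleC)

lemma A_sum:
  assumes "finite I" "\<And>i. i \<in> I \<Longrightarrow> f i \<in> A"
  shows "sum f I \<in> A \<and> \<delta> (sum f I) = (\<Sum>i\<in>I. \<delta> (f i))"
  using assms
proof (induction I)
  case empty
  have "op_scale 0 (wd []) = 0" by (rule op_scale_simps)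
  then show ?case using A_scale[OF AnD(1)[OF wd_An[of "[]"]], of 0] by (simp add: op_scale_simps)
next
  case (insert i I)
  then have "f i \<in> A" "sum f I \<in> A" "\<delta> (sum f I) = (\<Sum>i\<in>I. \<delta> (f i))" by blast+
  then show ?case using insert(1,2) A_add by simp
qed

lemma \<delta>_leibniz:
  assumes a: "a \<in> A" and b: "b \<in> A"
  shows "(\<delta> ^^ N) (a o\<^sub>L b) = (\<Sum>k\<le>N. real (N choose k) *\<^sub>R ((\<delta> ^^ k) a o\<^sub>L (\<delta> ^^ (N - k)) b))"
proof (induction N)
  case (Suc N)
  let ?f = "\<lambda>k m. (\<delta> ^^ k) a o\<^sub>L (\<delta> ^^ m) b"
  have fA: "?f k m \<in> A" for k m by (rule A_mult(1)[OF \<delta>nA[OF a] \<delta>nA[OF b]])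
  have \<delta>f: "\<delta> (real c *\<^sub>R ?f k m) = real c *\<^sub>R (?f (Suc k) m + ?f k (Suc m))" for c k m
    unfolding scaleR_op_scale A_scale(2)[OF fA] A_mult(2)[OF \<delta>nA[OF a] \<delta>nA[OF b]] by simp
  have "(\<delta> ^^ Suc N) (a o\<^sub>L b) = \<delta> (\<Sum>k\<le>N. real (N choose k) *\<^sub>R ?f k (N - k))" by (simp add: Suc)
  also have "\<dots> = (\<Sum>k\<le>N. \<delta> (real (N choose k) *\<^sub>R ?f k (N - k)))"
    by (rule conjunct2[OF A_sum]) (auto simp only: scaleR_op_scale finite_atMost intro!: A_scale(1)[OF fA])
  also have "\<dots> = (\<Sum>k\<le>N. real (N choose k) *\<^sub>R (?f (Suc k) (N - k) + ?f k (Suc (N - k))))"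
    by (simp only: \<delta>f)
  also have "\<dots> = (\<Sum>k\<le>Suc N. real (Suc N choose k) *\<^sub>R ?f k (Suc N - k))" by (rule binomial_sum_step)
  finally show ?case .
qed simp

lemma \<delta>_leibniz_divided:
  assumes "a \<in> A" "b \<in> A"
  shows "(t ^ N / fact N) *\<^sub>R (\<delta> ^^ N) (a o\<^sub>L b) = (\<Sum>k\<le>N. ((t ^ k / fact k) *\<^sub>R (\<delta> ^^ k) a) o\<^sub>L ((t ^ (N - k) / fact (N - k)) *\<^sub>R (\<delta> ^^ (N - k)) b))"
  unfolding \<delta>_leibniz[OF assms] scaleR_sum_right
proof (rule sum.cong[OF refl])
  fix k assume "k \<in> {..N}"
  then have k: "k \<le> N" by simp
  have "t ^ N = t ^ k * t ^ (N - k)" using k by (simp flip: power_add)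
  then have "t ^ N / fact N * real (N choose k) = t ^ k / fact k * (t ^ (N - k) / fact (N - k))"
    by (simp add: binomial_fact[OF k])
  moreover have "(r *\<^sub>R S) o\<^sub>L (s *\<^sub>R T) = (r * s) *\<^sub>R (S o\<^sub>L T)" for r s and S T :: "'a \<Rightarrow>\<^sub>L 'a"
    by (rule blinfun_eqI) (simp add: blinfun.scaleR_left blinfun.scaleR_right)
  ultimately show "(t ^ N / fact N) *\<^sub>R real (N choose k) *\<^sub>R ((\<delta> ^^ k) a o\<^sub>L (\<delta> ^^ (N - k)) b)
      = ((t ^ k / fact k) *\<^sub>R (\<delta> ^^ k) a) o\<^sub>L ((t ^ (N - k) / fact (N - k)) *\<^sub>R (\<delta> ^^ (N - k)) b)"
    by (simp only: scaleR_scaleR)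
qed

text \<open>The divided Leibniz rule dominates the series of the product by a Cauchy product, so the
  radius \<open>r0\<close> is kept.\<close>

lemma An_mult: assumes a: "a \<in> An" and b: "b \<in> An" shows "a o\<^sub>L b \<in> An"
  unfolding An_def
proof (intro CollectI conjI allI impI)
  note aA = AnD(1)[OF a] and bA = AnD(1)[OF b]
  show "a o\<^sub>L b \<in> A" by (rule A_mult(1)[OF aA bA])
  fix \<rho> assume \<rho>: "0 \<le> \<rho> \<and> \<rho> < r0"
  let ?n = "\<lambda>a n. \<rho> ^ n / fact n * norm ((\<delta> ^^ n) a)"
  have nn: "norm (?n a n) = ?n a n" for a n using \<rho> by simp
  show "summable (?n (a o\<^sub>L b))"
  proof (rule summable_comparison_test')
    show "summable (\<lambda>N. \<Sum>k\<le>N. ?n a k * ?n b (N - k))"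
      by (rule summable_Cauchy_product) (use AnD(2)[OF a] AnD(2)[OF b] \<rho> in \<open>simp_all only: nn\<close>)
    fix N :: nat
    have "norm (?n (a o\<^sub>L b) N) = norm ((\<rho> ^ N / fact N) *\<^sub>R (\<delta> ^^ N) (a o\<^sub>L b))" using \<rho> by simp
    also have "\<dots> \<le> (\<Sum>k\<le>N. norm (((\<rho> ^ k / fact k) *\<^sub>R (\<delta> ^^ k) a) o\<^sub>L ((\<rho> ^ (N - k) / fact (N - k)) *\<^sub>R (\<delta> ^^ (N - k)) b)))"
      unfolding \<delta>_leibniz_divided[OF aA bA] by (rule norm_sum)
    also have "\<dots> \<le> (\<Sum>k\<le>N. ?n a k * ?n b (N - k))"
    proof (rule sum_mono)
      fix k
      show "norm (((\<rho> ^ k / fact k) *\<^sub>R (\<delta> ^^ k) a) o\<^sub>L ((\<rho> ^ (N - k) / fact (N - k)) *\<^sub>R (\<delta> ^^ (N - k)) b)) \<le> ?n a k * ?n b (N - k)"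
        by (rule order_trans[OF norm_blinfun_compose]) (use \<rho> in simp)
    qed
    finally show "norm (?n (a o\<^sub>L b) N) \<le> (\<Sum>k\<le>N. ?n a k * ?n b (N - k))" .
  qed
qed

lemma An_add: assumes a: "a \<in> An" and b: "b \<in> An" shows "a + b \<in> An"
  unfolding An_def
proof (intro CollectI conjI allI impI)
  note aA = AnD(1)[OF a] and bA = AnD(1)[OF b]
  show "a + b \<in> A" by (rule A_add(1)[OF aA bA])
  fix \<rho> assume \<rho>: "0 \<le> \<rho> \<and> \<rho> < r0"
  show "summable (\<lambda>n. \<rho> ^ n / fact n * norm ((\<delta> ^^ n) (a + b)))"
  proof (rule summable_comparison_test')
    show "summable (\<lambda>n. \<rho> ^ n / fact n * norm ((\<delta> ^^ n) a) + \<rho> ^ n / fact n * norm ((\<delta> ^^ n) b))"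
      using AnD(2)[OF a] AnD(2)[OF b] \<rho> by (intro summable_add) auto
    show "norm (\<rho> ^ n / fact n * norm ((\<delta> ^^ n) (a + b))) \<le> \<rho> ^ n / fact n * norm ((\<delta> ^^ n) a) + \<rho> ^ n / fact n * norm ((\<delta> ^^ n) b)" for n
    proof -
      have "\<rho> ^ n / fact n * norm ((\<delta> ^^ n) a + (\<delta> ^^ n) b) \<le> \<rho> ^ n / fact n * (norm ((\<delta> ^^ n) a) + norm ((\<delta> ^^ n) b))"
        using \<rho> by (intro mult_left_mono norm_triangle_ineq) auto
      then show ?thesis using \<rho> by (simp only: \<delta>n_add[OF aA bA] distrib_left real_norm_def abs_of_nonneg[OF mult_nonneg_nonneg[OF divide_nonneg_nonneg[OF zero_le_power fact_ge_zero] norm_ge_zero]])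
    qed
  qed
qed

lemma An_scale: assumes a: "a \<in> An" shows "op_scale k a \<in> An"
  unfolding An_def
proof (intro CollectI conjI allI impI)
  note aA = AnD(1)[OF a]
  show "op_scale k a \<in> A" by (rule A_scale(1)[OF aA])
  fix \<rho> assume \<rho>: "0 \<le> \<rho> \<and> \<rho> < r0"
  show "summable (\<lambda>n. \<rho> ^ n / fact n * norm ((\<delta> ^^ n) (op_scale k a)))"
  proof (rule summable_comparison_test')
    show "summable (\<lambda>n. cmod k * (\<rho> ^ n / fact n * norm ((\<delta> ^^ n) a)))"
      using AnD(2)[OF a] \<rho> by (intro summable_mult) auto
    show "norm (\<rho> ^ n / fact n * norm ((\<delta> ^^ n) (op_scale k a))) \<le> cmod k * (\<rho> ^ n / fact n * norm ((\<delta> ^^ n) a))" for n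
    proof -
      have "\<rho> ^ n / fact n * norm (op_scale k ((\<delta> ^^ n) a)) \<le> \<rho> ^ n / fact n * (cmod k * norm ((\<delta> ^^ n) a))"
        using \<rho> by (intro mult_left_mono norm_op_scale_le) auto
      then show ?thesis using \<rho> by (simp add: \<delta>n_scale[OF aA] mult_ac)
    qed
  qed
qed

text \<open>Shifting the index by one costs a factor \<open>n + 1\<close>, which the slightly larger
  radius \<open>\<rho>'\<close>, half-way to \<open>r0\<close>, absorbs. This works because
  membership in \<open>An\<close> quantifies over all radii strictly below
  \<open>r0\<close>.\<close>

lemma An_\<delta>: assumes a: "a \<in> An" shows "\<delta> a \<in> An"
  unfolding An_def
proof (intro CollectI conjI allI impI)
  show "\<delta> a \<in> A" by (rule \<delta>A[OF AnD(1)[OF a]])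
  fix \<rho> assume \<rho>: "0 \<le> \<rho> \<and> \<rho> < r0"
  define \<rho>' where "\<rho>' = (\<rho> + r0) / 2"
  have \<rho>': "0 \<le> \<rho>'" "\<rho>' < r0" "\<rho> < \<rho>'" using \<rho> by (auto simp: \<rho>'_def)
  show "summable (\<lambda>n. \<rho> ^ n / fact n * norm ((\<delta> ^^ n) (\<delta> a)))"
  proof (rule summable_comparison_test')
    show "summable (\<lambda>n. 1 / (\<rho>' - \<rho>) * (\<rho>' ^ Suc n / fact (Suc n) * norm ((\<delta> ^^ Suc n) a)))"
      by (rule summable_mult, rule summable_Suc_iff[THEN iffD2]) (rule AnD(2)[OF a \<rho>'(1,2)])
    fix n :: nat
    have "real (Suc n) * \<rho> ^ n * (\<rho>' - \<rho>) \<le> \<rho>' ^ Suc n" by (rule derivative_power_bound) (use \<rho> \<rho>' in auto)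
    then have "\<rho> ^ n \<le> \<rho>' ^ Suc n / (real (Suc n) * (\<rho>' - \<rho>))"
      using \<rho>' by (subst pos_le_divide_eq) (auto simp: mult_ac)
    then have "\<rho> ^ n / fact n \<le> \<rho>' ^ Suc n / (real (Suc n) * (\<rho>' - \<rho>)) / fact n" by (rule divide_right_mono) simp
    also have "\<dots> = 1 / (\<rho>' - \<rho>) * (\<rho>' ^ Suc n / fact (Suc n))" by (simp add: mult_ac)
    finally have "\<rho> ^ n / fact n * norm ((\<delta> ^^ Suc n) a) \<le> 1 / (\<rho>' - \<rho>) * (\<rho>' ^ Suc n / fact (Suc n)) * norm ((\<delta> ^^ Suc n) a)"
      by (rule mult_right_mono) simp
    moreover have "(\<delta> ^^ n) (\<delta> a) = (\<delta> ^^ Suc n) a" by (simp only: funpow_Suc_right o_apply)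
    moreover have "0 \<le> \<rho> ^ n / fact n * norm ((\<delta> ^^ Suc n) a)" using \<rho> by simp
    ultimately show "norm (\<rho> ^ n / fact n * norm ((\<delta> ^^ n) (\<delta> a))) \<le> 1 / (\<rho>' - \<rho>) * (\<rho>' ^ Suc n / fact (Suc n) * norm ((\<delta> ^^ Suc n) a))"
      by (simp only: real_norm_def abs_of_nonneg mult.assoc)
  qed
qed

end

section \<open>The automorphism group\<close>

context nc_flow
begin

text \<open>\<open>\<delta>\<close> transported to vectors; \<open>\<Lambda>\<close> can be inverted
  on \<open>M\<close> because the trace is faithful.\<close>

definition Db :: "'b \<Rightarrow> 'b" where
  "Db v = \<Lambda> (\<delta> (inv_into M \<Lambda> v))"

lemma Db_\<Lambda>: "a \<in> A \<Longrightarrow> Db (\<Lambda> a) = \<Lambda> (\<delta> a)"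
  by (simp add: Db_def inv_into_f_f[OF \<Lambda>_inj A_M] del: image_iff)

lemma Dbn_\<Lambda>: "a \<in> A \<Longrightarrow> (Db ^^ n) (\<Lambda> a) = \<Lambda> ((\<delta> ^^ n) a)"
  by (induction n) (simp_all add: Db_\<Lambda> \<delta>nA del: image_iff)

lemma An_M: "a \<in> An \<Longrightarrow> a \<in> M"
  using AnD(1) A_M by blast

lemma An_csubspace: "csubspace (\<Lambda> ` An)"
  unfolding csubspace_def
proof (intro conjI ballI allI)
  have "op_scale 0 (wd []) \<in> An" by (rule An_scale[OF wd_An])
  then have "0 \<in> An" by (simp add: op_scale_simps)
  then have "\<Lambda> 0 \<in> \<Lambda> ` An" by (rule imageI)
  then show "0 \<in> \<Lambda> ` An" by (simp only: \<Lambda>_zero)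
  show "u + v \<in> \<Lambda> ` An" if "u \<in> \<Lambda> ` An" "v \<in> \<Lambda> ` An" for u v
  proof -
    obtain a b where ab: "a \<in> An" "b \<in> An" "u = \<Lambda> a" "v = \<Lambda> b" using \<open>u \<in> \<Lambda> ` An\<close> \<open>v \<in> \<Lambda> ` An\<close> by blast
    then have "u + v = \<Lambda> (a + b)" by (simp add: \<Lambda>_add An_M)
    then show ?thesis using An_add[OF ab(1,2)] by blast
  qed
  show "c *\<^sub>C u \<in> \<Lambda> ` An" if "u \<in> \<Lambda> ` An" for c u
  proof -
    obtain a where a: "a \<in> An" "u = \<Lambda> a" using \<open>u \<in> \<Lambda> ` An\<close> by blast
    then have "c *\<^sub>C u = \<Lambda> (op_scale c a)" by (simp add: \<Lambda>_scale An_M)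
    then show ?thesis using An_scale[OF a(1)] by blast
  qed
qed

lemma Y_An: "Y j \<in> An"
  using wd_An[of "[j]"] by (simp add: blinfun_compose_simps)

lemma An_dense: "closure (\<Lambda> ` An) = UNIV"
proof (rule dense_invariant_subspace[of "range Y"])
  show "range Y \<subseteq> M" using YM by blast
  show "hadj x \<in> range Y" if "x \<in> range Y" for x using that Yh by auto
  show "commutant (commutant (range Y)) = M" by (rule gen)
  show "csubspace (\<Lambda> ` An)" by (rule An_csubspace)
  show "\<Lambda> id_blinfun \<in> \<Lambda> ` An" using wd_An[of "[]"] by simp
  fix x v assume x: "x \<in> range Y" and v: "v \<in> \<Lambda> ` An"
  obtain j where j: "x = Y j" using x by blast
  obtain a where a: "a \<in> An" "v = \<Lambda> a" using v by blast
  have "blinfun_apply (lm x) v = \<Lambda> (Y j o\<^sub>L a)" by (simp add: j a left_mult YM An_M)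
  then show "blinfun_apply (lm x) v \<in> \<Lambda> ` An" using An_mult[OF Y_An a(1)] by blast
qed

lemma Db_analytic_skew: "analytic_skew (\<Lambda> ` An) Db r0"
proof
  show "csubspace (\<Lambda> ` An)" by (rule An_csubspace)
  show "closure (\<Lambda> ` An) = UNIV" by (rule An_dense)
  show "r0 > 0" by (rule r0)
  fix u v assume "u \<in> \<Lambda> ` An"
  then obtain a where a: "a \<in> An" "u = \<Lambda> a" by blast
  note aA = AnD(1)[OF a(1)]
  show "Db u \<in> \<Lambda> ` An" using An_\<delta>[OF a(1)] by (simp only: a(2) Db_\<Lambda>[OF aA] imageI)
  show "Db (c *\<^sub>C u) = c *\<^sub>C Db u" for c
  proof -
    have "c *\<^sub>C u = \<Lambda> (op_scale c a)" by (simp add: a \<Lambda>_scale An_M)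
    then show ?thesis by (simp only: Db_\<Lambda>[OF A_scale(1)[OF aA]] A_scale(2)[OF aA] a(2) Db_\<Lambda>[OF aA] \<Lambda>_scale[OF A_M[OF \<delta>A[OF aA]]])
  qed
  show "summable (\<lambda>n. \<rho> ^ n / fact n * norm ((Db ^^ n) u))" if \<rho>: "0 \<le> \<rho>" "\<rho> < r0" for \<rho>
  proof -
    obtain C where C: "\<And>x. x \<in> M \<Longrightarrow> norm (\<Lambda> x) \<le> C * norm x" using \<Lambda>_bounded by blast
    show ?thesis
    proof (rule summable_comparison_test')
      show "summable (\<lambda>n. C * (\<rho> ^ n / fact n * norm ((\<delta> ^^ n) a)))" by (rule summable_mult[OF AnD(2)[OF a(1) \<rho>]])
      fix n :: nat
      have "\<rho> ^ n / fact n * norm (\<Lambda> ((\<delta> ^^ n) a)) \<le> \<rho> ^ n / fact n * (C * norm ((\<delta> ^^ n) a))"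
        using \<rho> by (intro mult_left_mono C A_M \<delta>nA aA) auto
      then show "norm (\<rho> ^ n / fact n * norm ((Db ^^ n) u)) \<le> C * (\<rho> ^ n / fact n * norm ((\<delta> ^^ n) a))"
        using \<rho> unfolding a(2) Dbn_\<Lambda>[OF aA] by (simp add: mult_ac)
    qed
  qed
  assume "v \<in> \<Lambda> ` An"
  then obtain b where b: "b \<in> An" "v = \<Lambda> b" by blast
  note bA = AnD(1)[OF b(1)]
  show "Db (u + v) = Db u + Db v"
  proof -
    have "u + v = \<Lambda> (a + b)" by (simp add: a b \<Lambda>_add An_M)
    then show ?thesis by (simp only: Db_\<Lambda>[OF A_add(1)[OF aA bA]] A_add(2)[OF aA bA] a(2) b(2) Db_\<Lambda>[OF aA] Db_\<Lambda>[OF bA]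
        \<Lambda>_add[OF A_M[OF \<delta>A[OF aA]] A_M[OF \<delta>A[OF bA]]])
  qed
  show "cinner (Db u) v = - cinner u (Db v)"
    unfolding a(2) b(2) Db_\<Lambda>[OF aA] Db_\<Lambda>[OF bA] by (rule skew_A[OF aA bA])
qed

lemma \<Lambda>_scaleR: "x \<in> M \<Longrightarrow> \<Lambda> (r *\<^sub>R x) = r *\<^sub>R \<Lambda> x"
  by (simp only: scaleR_op_scale \<Lambda>_scale scaleR_eq_scaleC)

lemma M_scaleR: "x \<in> M \<Longrightarrow> r *\<^sub>R x \<in> M"
  by (simp only: scaleR_op_scale M_scale)

lemma \<Lambda>_sum: "(\<And>i. i \<in> I \<Longrightarrow> f i \<in> M) \<Longrightarrow> \<Lambda> (sum f I) = (\<Sum>i\<in>I. \<Lambda> (f i))"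
  by (induction I rule: infinite_finite_induct) (auto simp: \<Lambda>_zero \<Lambda>_add M_sum)

text \<open>\<open>Z\<close> is the exponential series of \<open>\<delta>\<close> at
  \<open>Y j\<close>, acting by left multiplication. It is recorded only that \<open>Z\<close>
  commutes with the commutant, which a norm limit of left multiplications inherits and which is all
  that the bicommutant argument uses.\<close>

lemma flow_left_mult:
  assumes U: "\<And>x t. x \<in> \<Lambda> ` An \<Longrightarrow> \<bar>t\<bar> \<le> r0 / 4 \<Longrightarrow> blinfun_apply (U t) x = analytic_skew.expD Db t x"
    and t: "\<bar>t\<bar> \<le> r0 / 4"
  shows "\<exists>Z. (\<forall>Q\<in>commutant (lm ` M). Q o\<^sub>L Z = Z o\<^sub>L Q) \<and> U t o\<^sub>L lm (Y j) = Z o\<^sub>L U t"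
proof -
  interpret S: analytic_skew "\<Lambda> ` An" Db r0 by (rule Db_analytic_skew)
  have t': "\<bar>t\<bar> < r0" using t r0 by linarith
  let ?y = "\<lambda>m. (\<delta> ^^ m) (Y j)"
  let ?T = "\<lambda>m. (t ^ m / fact m) *\<^sub>R lm (?y m)"
  have YA: "Y j \<in> A" by (rule AnD(1)[OF Y_An])
  have yM: "?y m \<in> M" for m by (rule A_M[OF \<delta>nA[OF YA]])
  have sT: "summable (\<lambda>m. norm (?T m))"
  proof (rule summable_comparison_test')
    show "summable (\<lambda>m. \<bar>t\<bar> ^ m / fact m * norm (?y m))" by (rule AnD(2)[OF Y_An]) (use t' in auto)
    show "norm (norm (?T m)) \<le> \<bar>t\<bar> ^ m / fact m * norm (?y m)" for m
    proof -
      have "\<bar>t\<bar> ^ m / fact m * norm (lm (?y m)) \<le> \<bar>t\<bar> ^ m / fact m * norm (?y m)"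
        by (intro mult_left_mono left_mult(3)[OF yM]) simp
      then show ?thesis by (simp add: power_abs)
    qed
  qed
  define Z where "Z = (\<Sum>m. ?T m)"
  have Zs: "?T sums Z" unfolding Z_def by (rule summable_sums[OF summable_norm_cancel[OF sT]])
  have QZ: "Q o\<^sub>L Z = Z o\<^sub>L Q" if Q: "Q \<in> commutant (lm ` M)" for Q
  proof (rule sums_unique2)
    show "(\<lambda>m. Q o\<^sub>L ?T m) sums (Q o\<^sub>L Z)"
      by (rule bounded_linear.sums[OF bounded_bilinear.bounded_linear_right[OF bounded_bilinear_blinfun_compose] Zs])
    have "Q o\<^sub>L ?T m = ?T m o\<^sub>L Q" for m
      by (rule blinfun_eqI) (simp add: blinfun.scaleR_left blinfun.scaleR_right commutant_apply[OF Q imageI[OF yM]])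
    moreover have "(\<lambda>m. ?T m o\<^sub>L Q) sums (Z o\<^sub>L Q)"
      by (rule bounded_linear.sums[OF bounded_bilinear.bounded_linear_left[OF bounded_bilinear_blinfun_compose] Zs])
    ultimately show "(\<lambda>m. Q o\<^sub>L ?T m) sums (Z o\<^sub>L Q)" by simp
  qed
  have "U t o\<^sub>L lm (Y j) = Z o\<^sub>L U t"
  proof (rule clinear_op_eq_on_dense[OF An_dense])
    fix v assume "v \<in> \<Lambda> ` An"
    then obtain a where a: "a \<in> An" "v = \<Lambda> a" by blast
    note aA = AnD(1)[OF a(1)]
    have vE: "\<Lambda> a \<in> \<Lambda> ` An" and yvE: "\<Lambda> (Y j o\<^sub>L a) \<in> \<Lambda> ` An" using a(1) An_mult[OF Y_An a(1)] by blast+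
    let ?v = "\<lambda>n. (t ^ n / fact n) *\<^sub>R \<Lambda> ((\<delta> ^^ n) a)"
    let ?f = "\<lambda>m n. blinfun_apply (?T m) (?v n)"
    have vs: "?v sums S.expD t (\<Lambda> a)" and sv: "summable (\<lambda>n. norm (?v n))"
      using S.exp_sums[OF vE t'] S.exp_summable(1)[OF vE t'] by (simp_all only: Dbn_\<Lambda>[OF aA])
    have aM: "(\<delta> ^^ n) a \<in> M" for n by (rule A_M[OF \<delta>nA[OF aA]])
    \<comment> \<open>The diagonal of order \<open>N\<close> is the Leibniz rule for
      \<open>\<delta> ^^ N\<close>; summing by rows instead gives \<open>Z\<close> applied to the
      flowed vector.\<close>
    have diag: "(\<Sum>k\<le>N. ?f k (N - k)) = (t ^ N / fact N) *\<^sub>R \<Lambda> ((\<delta> ^^ N) (Y j o\<^sub>L a))" for N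
    proof -
      have yaM: "(\<delta> ^^ N) (Y j o\<^sub>L a) \<in> M" by (rule A_M[OF \<delta>nA[OF A_mult(1)[OF YA aA]]])
      have "(t ^ N / fact N) *\<^sub>R \<Lambda> ((\<delta> ^^ N) (Y j o\<^sub>L a))
          = (\<Sum>k\<le>N. \<Lambda> (((t ^ k / fact k) *\<^sub>R ?y k) o\<^sub>L ((t ^ (N - k) / fact (N - k)) *\<^sub>R (\<delta> ^^ (N - k)) a)))"
        unfolding \<Lambda>_scaleR[OF yaM, symmetric] \<delta>_leibniz_divided[OF YA aA]
        by (rule \<Lambda>_sum) (intro M_compose M_scaleR yM aM)
      also have "\<dots> = (\<Sum>k\<le>N. ?f k (N - k))"
      proof (rule sum.cong[OF refl])
        fix k
        have "(r *\<^sub>R S') o\<^sub>L (s *\<^sub>R T') = s *\<^sub>R r *\<^sub>R (S' o\<^sub>L T')" for r s and S' T' :: "'a \<Rightarrow>\<^sub>L 'a"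
          by (rule blinfun_eqI) (simp add: blinfun.scaleR_left blinfun.scaleR_right)
        then show "\<Lambda> (((t ^ k / fact k) *\<^sub>R ?y k) o\<^sub>L ((t ^ (N - k) / fact (N - k)) *\<^sub>R (\<delta> ^^ (N - k)) a)) = ?f k (N - k)"
          by (simp only: \<Lambda>_scaleR M_scaleR M_compose yM aM blinfun.scaleR_left blinfun.scaleR_right left_mult(2)[OF yM aM])
      qed
      finally show ?thesis by simp
    qed
    have sd: "summable (\<lambda>N. \<Sum>k\<le>N. norm (?f k (N - k)))"
    proof (rule summable_comparison_test')
      show "summable (\<lambda>N. \<Sum>k\<le>N. norm (?T k) * norm (?v (N - k)))"
        by (rule summable_Cauchy_product) (simp_all only: real_norm_def abs_norm_cancel sT sv)
      show "norm (\<Sum>k\<le>N. norm (?f k (N - k))) \<le> (\<Sum>k\<le>N. norm (?T k) * norm (?v (N - k)))" for N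
      proof -
        have "(\<Sum>k\<le>N. norm (?f k (N - k))) \<le> (\<Sum>k\<le>N. norm (?T k) * norm (?v (N - k)))"
          by (intro sum_mono norm_blinfun)
        moreover have "0 \<le> (\<Sum>k\<le>N. norm (?f k (N - k)))" by (intro sum_nonneg norm_ge_zero)
        ultimately show ?thesis by (simp only: real_norm_def abs_of_nonneg)
      qed
    qed
    have row: "(\<Sum>n. ?f m n) = blinfun_apply (?T m) (S.expD t (\<Lambda> a))" for m
      by (rule sums_unique[symmetric], rule bounded_linear.sums[OF blinfun.bounded_linear_right vs])
    have "(\<lambda>m. \<Sum>n. ?f m n) sums (\<Sum>N. (t ^ N / fact N) *\<^sub>R \<Lambda> ((\<delta> ^^ N) (Y j o\<^sub>L a)))"
      using double_series_diagonal(1)[OF sd] unfolding diag .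
    moreover have "(\<lambda>m. \<Sum>n. ?f m n) sums blinfun_apply Z (S.expD t (\<Lambda> a))"
      unfolding row by (rule bounded_linear.sums[OF blinfun.bounded_linear_left Zs])
    ultimately have "blinfun_apply Z (S.expD t (\<Lambda> a)) = (\<Sum>N. (t ^ N / fact N) *\<^sub>R \<Lambda> ((\<delta> ^^ N) (Y j o\<^sub>L a)))"
      by (rule sums_unique2[symmetric])
    also have "\<dots> = S.expD t (\<Lambda> (Y j o\<^sub>L a))"
      unfolding S.expD_def Dbn_\<Lambda>[OF A_mult(1)[OF YA aA]] ..
    finally show "blinfun_apply (U t o\<^sub>L lm (Y j)) v = blinfun_apply (Z o\<^sub>L U t) v"
      by (simp add: a left_mult YM An_M U[OF vE t] U[OF yvE t])
  qed
  then show ?thesis using QZ by blast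
qed

theorem exponentiates: "exponentiates_to_automorphisms M \<Lambda> (D_eps_graph R Y K \<Lambda>)"
proof -
  interpret S: analytic_skew "\<Lambda> ` An" Db r0 by (rule Db_analytic_skew)
  obtain U where U: "\<And>t. clinear_op (U t)" "\<And>t x. norm (blinfun_apply (U t) x) = norm x"
    "\<And>t. hadj (U t) = U (- t)" "U 0 = id_blinfun" "\<And>s t. U (s + t) = U s o\<^sub>L U t"
    "\<And>x t. x \<in> \<Lambda> ` An \<Longrightarrow> \<bar>t\<bar> \<le> r0 / 4 \<Longrightarrow> blinfun_apply (U t) x = S.expD t x"
    using S.unitary_group by blast
  interpret G: analytic_skew_group "\<Lambda> ` An" Db r0 U
    by unfold_locales (fact U)+
  define H where "H = {(x, (- \<i>) *\<^sub>C y) | x y. (x, y) \<in> D_eps_graph R Y K \<Lambda>}"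
  have H_iff: "(u, v) \<in> H \<longleftrightarrow> (\<exists>a\<in>A. u = \<Lambda> a \<and> v = (- \<i>) *\<^sub>C \<Lambda> (\<delta> a))" for u v
    by (auto simp: H_def D_eps_graph_def)
  have H0: "(x, (- \<i>) *\<^sub>C Db x) \<in> H" if x: "x \<in> \<Lambda> ` An" for x
  proof -
    obtain a where a: "a \<in> An" "x = \<Lambda> a" using x by blast
    show ?thesis unfolding H_iff a(2) by (rule bexI[OF _ AnD(1)[OF a(1)]]) (simp only: Db_\<Lambda>[OF AnD(1)[OF a(1)]] simp_thms)
  qed
  have sym: "cinner y x' = cinner x y'" if "(x, y) \<in> H" "(x', y') \<in> H" for x y x' y'
  proof -
    obtain a b where ab: "a \<in> A" "x = \<Lambda> a" "y = (- \<i>) *\<^sub>C \<Lambda> (\<delta> a)" "b \<in> A" "x' = \<Lambda> b" "y' = (- \<i>) *\<^sub>C \<Lambda> (\<delta> b)"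
      using \<open>(x, y) \<in> H\<close> \<open>(x', y') \<in> H\<close> unfolding H_iff by blast
    show ?thesis unfolding ab(2,3,5,6) cinner_scaleC_left cinner_scaleC_right skew_A[OF ab(1,4)] by simp
  qed
  note main = G.closure_selfadjoint_and_generates[OF H0 sym]
  let ?N = "lm ` M" and ?\<alpha> = "\<lambda>t x. U t o\<^sub>L x o\<^sub>L U (- t)"
  have inv: "U t o\<^sub>L U (-t) = id_blinfun" for t using U(5)[of t "-t"] U(4) by simp
  have inv': "blinfun_apply (U (- t)) (blinfun_apply (U t) v) = v" "blinfun_apply (U t) (blinfun_apply (U (- t)) v) = v" for t v
    using inv[of t] inv[of "-t"] by (metis add.inverse_inverse blinfun_apply_blinfun_compose blinfun_apply_id_blinfun id_apply)+
  have local: "?\<alpha> t x \<in> ?N" if t: "\<bar>t\<bar> \<le> r0 / 4" and x: "x \<in> ?N" for t x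
  proof -
    obtain z where z: "z \<in> M" "x = lm z" using x by blast
    have "?\<alpha> t x \<in> commutant (commutant ?N)"
    proof (rule commutantI)
      show "clinear_op (?\<alpha> t x)" unfolding z(2) by (intro clinear_op_compose U(1) left_mult z(1))
      fix Q assume Q: "Q \<in> commutant ?N"
      \<comment> \<open>That \<open>?\<alpha> t x\<close> commutes with \<open>Q\<close> means that
        \<open>x\<close> commutes with \<open>Q'\<close>. By \<open>flow_left_mult\<close> the
        latter commutes with the generators, hence with every left multiplication, so series are
        needed for the \<open>Y j\<close> alone.\<close>
      define Q' where "Q' = U (-t) o\<^sub>L Q o\<^sub>L U t"
      have "Q' \<in> commutant (lm ` range Y)"
      proof (rule commutantI)
        show "clinear_op Q'" unfolding Q'_def by (intro clinear_op_compose U(1) commutantD(1)[OF Q])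
        fix T assume "T \<in> lm ` range Y"
        then obtain j where j: "T = lm (Y j)" by blast
        obtain Z where Z: "Q o\<^sub>L Z = Z o\<^sub>L Q" "U t o\<^sub>L lm (Y j) = Z o\<^sub>L U t"
          using flow_left_mult[OF U(6) t, of j] Q by blast
        have Za: "blinfun_apply (U t) (blinfun_apply (lm (Y j)) v) = blinfun_apply Z (blinfun_apply (U t) v)"
          "blinfun_apply Q (blinfun_apply Z v) = blinfun_apply Z (blinfun_apply Q v)" for v
          using Z by (metis blinfun_apply_blinfun_compose)+
        have Zb: "blinfun_apply (U (-t)) (blinfun_apply Z v) = blinfun_apply (lm (Y j)) (blinfun_apply (U (-t)) v)" for v
          using arg_cong[OF Za(1)[of "blinfun_apply (U (-t)) v"], of "blinfun_apply (U (-t))"] by (simp add: inv')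
        show "Q' o\<^sub>L T = T o\<^sub>L Q'"
          by (rule blinfun_eqI) (simp add: Q'_def j Za Zb)
      qed
      moreover have "lm z \<in> commutant (commutant (lm ` range Y))"
        by (rule left_mult_in_double_commutant[OF _ gen z(1)]) (use YM in blast)
      ultimately have c: "blinfun_apply (lm z) (blinfun_apply Q' v) = blinfun_apply Q' (blinfun_apply (lm z) v)" for v
        by (rule commutant_apply[rotated])
      show "?\<alpha> t x o\<^sub>L Q = Q o\<^sub>L ?\<alpha> t x"
      proof (rule blinfun_eqI)
        fix v
        have "blinfun_apply (lm z) (blinfun_apply (U (-t)) (blinfun_apply Q v)) = blinfun_apply (U (-t)) (blinfun_apply Q (blinfun_apply (U t) (blinfun_apply (lm z) (blinfun_apply (U (-t)) v))))"
          using c[of "blinfun_apply (U (-t)) v"] by (simp add: Q'_def inv')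
        then show "blinfun_apply (?\<alpha> t x o\<^sub>L Q) v = blinfun_apply (Q o\<^sub>L ?\<alpha> t x) v"
          by (simp add: z(2) inv')
      qed
    qed
    then show ?thesis by (rule double_commutant_left_mult)
  qed
  have \<alpha>add: "?\<alpha> (s + t) x = ?\<alpha> s (?\<alpha> t x)" for s t x
  proof -
    have "U (- (s + t)) = U (-t) o\<^sub>L U (-s)" using U(5)[of "-t" "-s"] by (simp add: add.commute)
    then show ?thesis by (simp add: U(5)[of s t] blinfun_compose_assoc)
  qed
  have \<alpha>0: "?\<alpha> 0 x = x" for x by (rule blinfun_eqI) (simp add: U(4))
  have \<alpha>N: "?\<alpha> t x \<in> ?N" if x: "x \<in> ?N" for t x
  proof -
    \<comment> \<open>An arbitrary time is reached by \<open>n\<close> steps of size at most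
      \<open>r0 / 4\<close>, each of which maps the algebra into itself.\<close>
    have mult: "?\<alpha> (real n * s) x \<in> ?N" if s: "\<bar>s\<bar> \<le> r0 / 4" for n s
    proof (induction n)
      case 0
      show ?case using x \<alpha>0[of x] by simp
    next
      case (Suc n)
      have "?\<alpha> (real (Suc n) * s) x = ?\<alpha> s (?\<alpha> (real n * s) x)"
        using \<alpha>add[of s "real n * s" x] by (simp add: algebra_simps)
      then show ?case using local[OF s Suc] by (simp only:)
    qed
    obtain n :: nat where n: "\<bar>t\<bar> / (r0 / 4) < real n" using reals_Archimedean2 by blast
    moreover have "0 \<le> \<bar>t\<bar> / (r0 / 4)" using r0 by simp
    ultimately have n0: "real n > 0" by linarith
    then have "\<bar>t / real n\<bar> \<le> r0 / 4" using n r0 by (simp add: field_simps)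
    from mult[OF this, of n] show ?thesis using n0 by simp
  qed
  have clN: "clinear_op x" if "x \<in> ?N" for x using that left_mult(1) by blast
  have "one_parameter_automorphism_group ?N ?\<alpha>"
    unfolding one_parameter_automorphism_group_def
  proof (intro conjI allI ballI)
    fix t
    show "star_automorphism ?N (?\<alpha> t)"
      unfolding star_automorphism_def
    proof (intro conjI allI ballI)
      show "bij_betw (?\<alpha> t) ?N ?N"
      proof (rule bij_betw_byWitness[where f'="?\<alpha> (-t)"])
        show "\<forall>x\<in>?N. ?\<alpha> (- t) (?\<alpha> t x) = x" using \<alpha>add[of "-t" t] \<alpha>0 by simp
        show "\<forall>x\<in>?N. ?\<alpha> t (?\<alpha> (- t) x) = x" using \<alpha>add[of t "-t"] \<alpha>0 by simp
      qed (use \<alpha>N in blast)+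
      fix x assume x: "x \<in> ?N"
      show "?\<alpha> t (op_scale c x) = op_scale c (?\<alpha> t x)" for c
        by (rule blinfun_eqI) (simp add: clinear_opD[OF U(1)])
      have "hadj (?\<alpha> t x) = ?\<alpha> t (hadj x)"
        using U(3)[of t] U(3)[of "-t"] by (simp add: hadj_compose clinear_op_compose U(1) clN[OF x] blinfun_compose_assoc)
      then show "?\<alpha> t (adj x) = adj (?\<alpha> t x)"
        by (simp add: adj_eq_hadj clinear_op_compose U(1) clN[OF x])
      fix y assume y: "y \<in> ?N"
      show "?\<alpha> t (x + y) = ?\<alpha> t x + ?\<alpha> t y"
        by (rule blinfun_eqI) (simp add: blinfun.add_left blinfun.add_right)
      show "?\<alpha> t (x o\<^sub>L y) = ?\<alpha> t x o\<^sub>L ?\<alpha> t y"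
        by (rule blinfun_eqI) (simp add: inv')
    qed
  next
    fix x assume "x \<in> ?N"
    show "?\<alpha> 0 x = x" by (rule \<alpha>0)
    show "?\<alpha> (s + t) x = ?\<alpha> s (?\<alpha> t x)" for s t by (rule \<alpha>add)
    show "continuous_on UNIV (\<lambda>t. blinfun_apply (?\<alpha> t x) v)" for v
      unfolding continuous_on_def
    proof
      fix t :: real
      have cU: "((\<lambda>s. blinfun_apply (U s) w) \<longlongrightarrow> blinfun_apply (U t) w) (at t)" for w and t :: real
        using G.U_continuous[of w] unfolding continuous_on_def by blast
      have "((\<lambda>s. - s) \<longlongrightarrow> - t) (at t)" by (rule tendsto_minus[OF tendsto_ident_at])
      then have neg: "((\<lambda>s. blinfun_apply (U (- s)) v) \<longlongrightarrow> blinfun_apply (U (- t)) v) (at t)"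
        by (rule continuous_on_tendsto_compose[OF G.U_continuous]) auto
      let ?w = "\<lambda>s. blinfun_apply x (blinfun_apply (U (- s)) v)"
      have wl: "(?w \<longlongrightarrow> ?w t) (at t)" by (rule bounded_linear.tendsto[OF blinfun.bounded_linear_right neg])
      \<comment> \<open>The product is split as \<open>U s (?w s - ?w t) + U s (?w t)\<close>:
        isometry handles the first summand and strong continuity of \<open>U\<close> the
        second.\<close>
      have "((\<lambda>s. norm (?w s - ?w t)) \<longlongrightarrow> norm (?w t - ?w t)) (at t)" by (intro tendsto_intros wl)
      then have "((\<lambda>s. norm (blinfun_apply (U s) (?w s - ?w t))) \<longlongrightarrow> 0) (at t)" by (simp add: U(2))
      then have "((\<lambda>s. blinfun_apply (U s) (?w s - ?w t)) \<longlongrightarrow> 0) (at t)" by (rule tendsto_norm_zero_cancel)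
      from tendsto_add[OF this cU[of "?w t" t]]
      show "((\<lambda>t. blinfun_apply (?\<alpha> t x) v) \<longlongrightarrow> blinfun_apply (?\<alpha> t x) v) (at t)"
        by (simp add: blinfun.diff_right)
    qed
  qed
  then show ?thesis
    unfolding exponentiates_to_automorphisms_def Let_def H_def[symmetric] using main by blast
qed

end

theorem mainTheorem3:
  fixes M :: "('a::chilbert_space \<Rightarrow>\<^sub>L 'a) set"
    and \<tau> :: "('a \<Rightarrow>\<^sub>L 'a) \<Rightarrow> complex"
    and \<Lambda> :: "('a \<Rightarrow>\<^sub>L 'a) \<Rightarrow> 'b::chilbert_space"
    and Y K :: "'n::finite \<Rightarrow> ('a \<Rightarrow>\<^sub>L 'a)"
    and R :: real
  assumes "von_neumann_algebra M"
    and "normal_faithful_trace_state M \<tau>"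
    and "is_L2_space M \<tau> \<Lambda>"
    and "\<And>j. Y j \<in> M"
    and "\<And>j. adj (Y j) = Y j"
    and "vN_generated (range Y) = M"
    and "R > 0"
    and "\<And>j. norm (Y j) \<le> R"
    and "inj_on (nc_eval Y) (nc_conv_gt R)"
    and "\<And>j. K j \<in> nc_eval Y ` nc_conv_gt R"
    and "\<And>j. adj (K j) = K j"
    and "trace_preserving \<tau> Y K"
  shows "exponentiates_to_automorphisms M \<Lambda> (D_eps_graph R Y K \<Lambda>)"
proof -
  interpret T: tracial_vN M \<tau> \<Lambda> by unfold_locales fact+
  have Yh: "hadj (Y j) = Y j" for j
    using assms(5)[of j] adj_eq_hadj[OF T.M_clinear[OF assms(4)], of j] by simp
  have gen: "commutant (commutant (range Y)) = M"
    by (rule generated_double_commutant[OF assms(1) _ _ assms(6)]) (use assms(4) Yh in auto)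
  let ?Kt = "\<lambda>j. nc_eval_inv R Y (K j)"
  have Kt: "?Kt j \<in> nc_conv_gt R" "nc_eval Y (?Kt j) = K j" for j
    unfolding nc_eval_inv_def
    by (rule the_inv_into_into[OF assms(9,10) subset_refl], rule f_the_inv_into_f[OF assms(9,10)])
  have "\<forall>j. \<exists>\<rho>. R < \<rho> \<and> ?Kt j \<in> nc_conv \<rho>" using Kt(1) by (fastforce simp: nc_conv_gt_def)
  then obtain \<rho> where \<rho>: "\<And>j. R < \<rho> j" "\<And>j. ?Kt j \<in> nc_conv (\<rho> j)" by metis
  \<comment> \<open>The minimum over finitely many variables is still strictly above
    \<open>R\<close>.\<close>
  define R1 where "R1 = Min (range \<rho>)"
  have R1: "R < R1" using \<rho>(1) by (simp add: R1_def)
  have K1: "?Kt j \<in> nc_conv R1" for j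
    by (rule nc_conv_mono(1)[OF \<rho>(2) less_imp_le[OF less_trans[OF assms(7) R1]]]) (simp add: R1_def)
  \<comment> \<open>The added one makes \<open>B\<close> positive even if all \<open>K j\<close>
    vanish, as the definition of \<open>r0\<close> divides by it.\<close>
  define B where "B = Max (range (\<lambda>j. nc_norm R1 (?Kt j))) + 1"
  have B: "nc_norm R1 (?Kt j) \<le> B" for j
  proof -
    have "nc_norm R1 (?Kt j) \<le> Max (range (\<lambda>j. nc_norm R1 (?Kt j)))" by (rule Max_ge) auto
    then show ?thesis unfolding B_def by linarith
  qed
  have B0: "B > 0"
  proof -
    have "0 \<le> nc_norm R1 (?Kt undefined)" using R1 assms(7) by (intro nc_norm_nonneg) simp
    also have "\<dots> \<le> Max (range (\<lambda>j. nc_norm R1 (?Kt j)))" by (rule Max_ge) auto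
    finally show ?thesis by (simp add: B_def)
  qed
  interpret nc_flow M \<tau> \<Lambda> Y K R R1 B
    by unfold_locales (fact assms Yh gen R1 K1 B B0)+
  show ?thesis by (rule exponentiates)
qed

end
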